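(* Let $d\geq2$ be an integer, $T>0$, $J_T=[0,T]$ and $k\in\mathbb{N}$ with $k>\frac d2$. For $f\in H^{k+2}$ and $v_1,v_2\in C(J_T;H^{k+2}_\sigma)$ let $$\varphi_{v_1},\varphi_{v_2}\in C(J_T;H^{k+2})\cap L^2(J_T;H^{k+3})\cap H^1(J_T;H^{k+1})$$ be the (unique) solutions of $$\partial_t\varphi_{v_i}+v_i\cdot\nabla\varphi_{v_i}-\Delta\varphi_{v_i}=0\ \text{ in }J_T\times\mathbb{T}^d,\qquad\varphi_{v_i}(0,\cdot)=f,\qquad i=1,2.$$ Then for every $R>0$ there exists a constant $C=C(R,T,k,d)>0$ such that whenever $$\|f\|_{k+2}+\|v_1\|_{C(J_T;H^{k+2}_\sigma)}+\|v_2\|_{C(J_T;H^{k+2}_\sigma)}\leq R,$$ one has $$\|\varphi_{v_1}-\varphi_{v_2}\|_{C(J_T;H^k)}\leq C\,|||v_1-v_2|||_{T,k}^{1/2}.$$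
   Context: $\mathbb{T}^d=\mathbb{R}^d/2\pi\mathbb{Z}^d$. $H^k=\{\varphi\in H^k(\mathbb{T}^d):\int_{\mathbb{T}^d}\varphi\,dx=0\}$ is the Sobolev space of zero-average scalar functions, with the standard $H^k$ norm $\|\cdot\|_k$ (also used for vector fields, componentwise). $H^k_\sigma$ is the space of divergence-free $\mathbb{R}^d$-valued vector fields on $\mathbb{T}^d$ whose components belong to $H^k$, with norm $\|v\|_{H^k_\sigma}^2=\sum_{j=1}^d\|v_j\|_k^2$. The relaxation norm is $$|||v|||_{T,k}=\sup_{t\in[0,T]}\left\|\int_0^tv(s)\,ds\right\|_k.$$ *)

theory Defs
  imports "HOL-Analysis.Analysis"
begin

text \<open>
  Functions on the torus R^d / (2 pi Z)^d are represented by functions on R^d (type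
  \<open>real ^ 'n\<close>, d = \<open>CARD('n)\<close>) that are 2 pi-periodic in every coordinate, and integrals over the
  torus are integrals over the cube [0, 2 pi]^d.  Elements of \<open>L\<^sup>2\<close> and of the Sobolev spaces are
  representatives: two functions that agree almost everywhere stand for the same element, so the
  norms below are seminorms on representatives, and equations between elements of these
  spaces are stated almost everywhere.
\<close>

subsection \<open>Smooth functions\<close>

definition iter_deriv :: "'a::euclidean_space list \<Rightarrow> ('a \<Rightarrow> real) \<Rightarrow> 'a \<Rightarrow> real" where
  "iter_deriv bs f = foldr (\<lambda>b g x. frechet_derivative g (at x) b) bs f"

definition smooth :: "('a::euclidean_space \<Rightarrow> real) \<Rightarrow> bool" where
  "smooth f \<longleftrightarrow> (\<forall>bs. set bs \<subseteq> Basis \<longrightarrow> (\<forall>x. iter_deriv bs f differentiable (at x)))"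

subsection \<open>Sobolev spaces on the torus\<close>

definition periodic :: "(real ^ 'n \<Rightarrow> real) \<Rightarrow> bool" where
  "periodic u \<longleftrightarrow> (\<forall>x i. u (x + (2 * pi) *\<^sub>R axis i 1) = u x)"

definition torus :: "(real ^ 'n) measure" where
  "torus = lebesgue_on (cbox 0 (\<chi> i. 2 * pi))"

definition L2_torus :: "(real ^ 'n \<Rightarrow> real) set" where
  "L2_torus = {u. periodic u \<and> u \<in> borel_measurable lebesgue \<and> integrable torus (\<lambda>x. (u x)\<^sup>2)}"

definition pdiff :: "'n list \<Rightarrow> (real ^ 'n \<Rightarrow> real) \<Rightarrow> real ^ 'n \<Rightarrow> real" where
  "pdiff js = iter_deriv (map (\<lambda>j. axis j 1) js)"

definition is_weak_deriv :: "'n list \<Rightarrow> (real ^ 'n \<Rightarrow> real) \<Rightarrow> (real ^ 'n \<Rightarrow> real) \<Rightarrow> bool" where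
  "is_weak_deriv js u g \<longleftrightarrow> g \<in> L2_torus \<and>
     (\<forall>\<eta>. smooth \<eta> \<and> periodic \<eta> \<longrightarrow>
        (LINT x|torus. g x * \<eta> x) = (-1) ^ length js * (LINT x|torus. u x * pdiff js \<eta> x))"

text \<open>A representative of the weak derivative, which is unique up to null sets.\<close>

definition wderiv :: "'n list \<Rightarrow> (real ^ 'n \<Rightarrow> real) \<Rightarrow> real ^ 'n \<Rightarrow> real" where
  "wderiv js u = (SOME g. is_weak_deriv js u g)"

text \<open>The space of zero-average functions in the Sobolev space of order \<open>m\<close>.\<close>

definition sobolev :: "nat \<Rightarrow> (real ^ 'n \<Rightarrow> real) set" where
  "sobolev m = {u \<in> L2_torus. (LINT x|torus. u x) = 0 \<and>
     (\<forall>js. length js \<le> m \<longrightarrow> (\<exists>g. is_weak_deriv js u g))}"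

text \<open>
  Summation over all index tuples of length \<open>l\<close> yields the squared \<open>L\<^sup>2\<close> norm of the full
  derivative tensor of order \<open>l\<close>.  Hence the squared norm is the sum, over multi-indices \<open>\<alpha>\<close>
  of order at most \<open>m\<close>, of the squared \<open>L\<^sup>2\<close> norms of the derivatives, weighted by the
  multinomial coefficient of \<open>\<alpha>\<close>.  The tuple of length 0 contributes the \<open>L\<^sup>2\<close> norm of \<open>u\<close>.
\<close>

definition sob_norm :: "nat \<Rightarrow> (real ^ 'n \<Rightarrow> real) \<Rightarrow> real" where
  "sob_norm m u = sqrt (\<Sum>js | length js \<le> m. LINT x|torus. (wderiv js u x)\<^sup>2)"

definition vec_sob_norm :: "nat \<Rightarrow> (real ^ 'n \<Rightarrow> real ^ 'n) \<Rightarrow> real" where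
  "vec_sob_norm m v = sqrt (\<Sum>j\<in>UNIV. (sob_norm m (\<lambda>x. v x $ j))\<^sup>2)"

definition divergence_free :: "(real ^ 'n \<Rightarrow> real ^ 'n) \<Rightarrow> bool" where
  "divergence_free v \<longleftrightarrow> (\<forall>\<eta>. smooth \<eta> \<and> periodic \<eta> \<longrightarrow>
     (LINT x|torus. (\<Sum>j\<in>UNIV. v x $ j * pdiff [j] \<eta> x)) = 0)"

definition sobolev_sigma :: "nat \<Rightarrow> (real ^ 'n \<Rightarrow> real ^ 'n) set" where
  "sobolev_sigma m = {v. (\<forall>j. (\<lambda>x. v x $ j) \<in> sobolev m) \<and> divergence_free v}"

subsection \<open>Sobolev-valued functions of time\<close>

definition C_sob :: "nat \<Rightarrow> real set \<Rightarrow> (real \<Rightarrow> real ^ 'n \<Rightarrow> real) set" where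
  "C_sob m J = {u. (\<forall>t\<in>J. u t \<in> sobolev m) \<and>
     (\<forall>t\<^sub>0\<in>J. ((\<lambda>t. sob_norm m (\<lambda>x. u t x - u t\<^sub>0 x)) \<longlongrightarrow> 0) (at t\<^sub>0 within J))}"

definition C_sob_sigma :: "nat \<Rightarrow> real set \<Rightarrow> (real \<Rightarrow> real ^ 'n \<Rightarrow> real ^ 'n) set" where
  "C_sob_sigma m J = {v. (\<forall>t\<in>J. v t \<in> sobolev_sigma m) \<and>
     (\<forall>t\<^sub>0\<in>J. ((\<lambda>t. vec_sob_norm m (\<lambda>x. v t x - v t\<^sub>0 x)) \<longlongrightarrow> 0) (at t\<^sub>0 within J))}"

definition C_norm :: "nat \<Rightarrow> real set \<Rightarrow> (real \<Rightarrow> real ^ 'n \<Rightarrow> real) \<Rightarrow> real" where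
  "C_norm m J u = (SUP t\<in>J. sob_norm m (u t))"

definition vec_C_norm :: "nat \<Rightarrow> real set \<Rightarrow> (real \<Rightarrow> real ^ 'n \<Rightarrow> real ^ 'n) \<Rightarrow> real" where
  "vec_C_norm m J v = (SUP t\<in>J. vec_sob_norm m (v t))"

text \<open>
  Bochner measurability and Bochner integral for functions with values in \<open>sobolev m\<close>, following
  the library's \<open>has_bochner_integral\<close>, which is not applicable directly because the Sobolev
  space is a set of representatives and not a type of class \<open>banach\<close>.  The time interval \<open>J\<close>
  is assumed to have finite measure.
\<close>

definition sob_simple :: "nat \<Rightarrow> real set \<Rightarrow> (real \<Rightarrow> real ^ 'n \<Rightarrow> real) \<Rightarrow> bool" where
  "sob_simple m J s \<longleftrightarrow> finite (s ` J) \<and> s ` J \<subseteq> sobolev m \<and>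
     (\<forall>g. {t \<in> J. s t = g} \<in> sets lebesgue)"

definition sob_simple_integral :: "real set \<Rightarrow> (real \<Rightarrow> real ^ 'n \<Rightarrow> real) \<Rightarrow> real ^ 'n \<Rightarrow> real" where
  "sob_simple_integral J s = (\<lambda>x. \<Sum>g\<in>s ` J. measure lebesgue {t \<in> J. s t = g} * g x)"

definition sob_measurable :: "nat \<Rightarrow> real set \<Rightarrow> (real \<Rightarrow> real ^ 'n \<Rightarrow> real) \<Rightarrow> bool" where
  "sob_measurable m J u \<longleftrightarrow> (AE t in lebesgue_on J. u t \<in> sobolev m) \<and>
     (\<exists>s. (\<forall>n::nat. sob_simple m J (s n)) \<and>
        (AE t in lebesgue_on J. (\<lambda>n. sob_norm m (\<lambda>x. s n t x - u t x)) \<longlonglongrightarrow> 0))"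

definition has_sob_integral ::
  "nat \<Rightarrow> real set \<Rightarrow> (real \<Rightarrow> real ^ 'n \<Rightarrow> real) \<Rightarrow> (real ^ 'n \<Rightarrow> real) \<Rightarrow> bool" where
  "has_sob_integral m J u U \<longleftrightarrow> sob_measurable m J u \<and> U \<in> sobolev m \<and>
     (\<exists>s. (\<forall>n::nat. sob_simple m J (s n)) \<and>
        (\<lambda>n. \<integral>\<^sup>+ t. ennreal (sob_norm m (\<lambda>x. s n t x - u t x)) \<partial>lebesgue_on J) \<longlonglongrightarrow> 0 \<and>
        (\<lambda>n. sob_norm m (\<lambda>x. sob_simple_integral J (s n) x - U x)) \<longlonglongrightarrow> 0)"

definition sob_integral ::
  "nat \<Rightarrow> real set \<Rightarrow> (real \<Rightarrow> real ^ 'n \<Rightarrow> real) \<Rightarrow> real ^ 'n \<Rightarrow> real" where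
  "sob_integral m J u = (SOME U. has_sob_integral m J u U)"

definition vec_sob_integral ::
  "nat \<Rightarrow> real set \<Rightarrow> (real \<Rightarrow> real ^ 'n \<Rightarrow> real ^ 'n) \<Rightarrow> real ^ 'n \<Rightarrow> real ^ 'n" where
  "vec_sob_integral m J v = (\<lambda>x. \<chi> j. sob_integral m J (\<lambda>t x. v t x $ j) x)"

definition relax_norm :: "real \<Rightarrow> nat \<Rightarrow> (real \<Rightarrow> real ^ 'n \<Rightarrow> real ^ 'n) \<Rightarrow> real" where
  "relax_norm T k v = (SUP t\<in>{0..T}. vec_sob_norm k (vec_sob_integral k {0..t} v))"

definition L2_sob :: "nat \<Rightarrow> real set \<Rightarrow> (real \<Rightarrow> real ^ 'n \<Rightarrow> real) set" where
  "L2_sob m J = {u. sob_measurable m J u \<and>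
     (\<integral>\<^sup>+ t. ennreal ((sob_norm m (u t))\<^sup>2) \<partial>lebesgue_on J) < \<infinity>}"

text \<open>\<open>w\<close> is the weak derivative of \<open>u\<close> on the open interval (0, \<open>T\<close>), with values in \<open>sobolev m\<close>.\<close>

definition is_time_deriv ::
  "nat \<Rightarrow> real \<Rightarrow> (real \<Rightarrow> real ^ 'n \<Rightarrow> real) \<Rightarrow> (real \<Rightarrow> real ^ 'n \<Rightarrow> real) \<Rightarrow> bool" where
  "is_time_deriv m T u w \<longleftrightarrow>
     (\<forall>\<eta> :: real \<Rightarrow> real. smooth \<eta> \<and> (\<exists>a b. 0 < a \<and> b < T \<and> (\<forall>t. t \<notin> {a..b} \<longrightarrow> \<eta> t = 0)) \<longrightarrow>
        (\<exists>U. has_sob_integral m {0..T} (\<lambda>t x. deriv \<eta> t * u t x) U \<and>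
             has_sob_integral m {0..T} (\<lambda>t x. \<eta> t * w t x) (\<lambda>x. - U x)))"

definition H1_sob :: "nat \<Rightarrow> real \<Rightarrow> (real \<Rightarrow> real ^ 'n \<Rightarrow> real) set" where
  "H1_sob m T = {u \<in> L2_sob m {0..T}. \<exists>w \<in> L2_sob m {0..T}. is_time_deriv m T u w}"

subsection \<open>The advection-diffusion equation\<close>

text \<open>
  In the class below every term of the equation is a square-integrable function of time with
  values in a Sobolev space, so the equation is an identity for almost every time and almost
  every point of the torus.
\<close>

definition is_solution ::
  "nat \<Rightarrow> real \<Rightarrow> (real \<Rightarrow> real ^ 'n \<Rightarrow> real ^ 'n) \<Rightarrow> (real ^ 'n \<Rightarrow> real) \<Rightarrow>
   (real \<Rightarrow> real ^ 'n \<Rightarrow> real) \<Rightarrow> bool" where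
  "is_solution k T v f \<phi> \<longleftrightarrow>
     \<phi> \<in> C_sob (k + 2) {0..T} \<inter> L2_sob (k + 3) {0..T} \<inter> H1_sob (k + 1) T \<and>
     (\<exists>w \<in> L2_sob (k + 1) {0..T}. is_time_deriv (k + 1) T \<phi> w \<and>
        (AE t in lebesgue_on {0..T}. AE x in torus.
           w t x + (\<Sum>j\<in>UNIV. v t x $ j * wderiv [j] (\<phi> t) x)
             - (\<Sum>j\<in>UNIV. wderiv [j, j] (\<phi> t) x) = 0)) \<and>
     (AE x in torus. \<phi> 0 x = f x)"

end

theory Submission
  imports Defs
begin

text \<open>
  On the side of Fourier coefficients the Sobolev norm of order \<open>m\<close> is a weighted \<open>l\<^sup>2\<close> norm, products are
  convolutions (and the weighted spaces are algebras for \<open>m > d / 2\<close>), and the equation is a system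
  of ordinary differential equations, one for each frequency.  For two solutions with velocities \<open>v\<^sub>1\<close>
  and \<open>v\<^sub>2\<close> let \<open>W\<close> be the time integral of \<open>v\<^sub>1 - v\<^sub>2\<close>.  Adding the divergence of \<open>W \<phi>\<^sub>2\<close> to \<open>\<phi>\<^sub>1 - \<phi>\<^sub>2\<close>
  replaces the source \<open>v\<^sub>1 - v\<^sub>2\<close> by \<open>W\<close>, at the price of one derivative.  The norms of \<open>W\<close> of order \<open>k + 2\<close>
  are bounded, those of order \<open>k\<close> are the relaxation norm, so interpolation at order \<open>k + 1\<close> produces
  its square root, and an energy estimate with Gronwall's argument concludes.
\<close>

section \<open>Weighted sequence spaces on the frequency lattice and their algebra structure\<close>

subsection \<open>Weights on the frequency lattice\<close>

text \<open>The solution class gives a time derivative only in L^2, with values in sets of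
  representatives. Both difficulties vanish one frequency at a time: a Fourier coefficient is a
  bounded functional, and for a fixed frequency the right-hand side is continuous in time, so each
  coefficient satisfies a classical differential equation on the closed interval. Energies are
  finite partial sums of squares, so no infinite sum of energies is ever differentiated.

  All bounds on coefficients are bounds on squares of norms. A bound of the squared difference that
  is linear in the relaxation norm is therefore the claimed square root.

  The correction by the time integral \<open>W\<close> brings in the time derivative of the second
  solution, which is controlled two orders below the solution; this is why data of order
  \<open>k + 2\<close> give a conclusion at order \<open>k\<close>. Membership of the solutions in
  their spaces provides only some bound \<open>M\<close>, not one in terms of \<open>R\<close>, so
  \<open>M\<close> must be removed before the constant is fixed. The condition
  \<open>k > d / 2\<close> enters through the summability of \<open>1 / weight k\<close>.\<close>

definition freq_sq :: "int ^ 'n \<Rightarrow> real" where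
  "freq_sq n = (\<Sum>j\<in>UNIV. (real_of_int (n $ j))\<^sup>2)"

text \<open>Comparable to (1 + |n|^2)^m. This form is chosen because it equals the sum of the
  squared symbols of all derivatives of order at most \<open>m\<close>, so that
  \<open>sob_norm\<close> translates without a constant of equivalence.\<close>

definition weight :: "nat \<Rightarrow> int ^ 'n \<Rightarrow> real" where
  "weight m n = (\<Sum>l\<le>m. freq_sq n ^ l)"

text \<open>\<open>Q\<close> plays the role of the square of a norm. Quantifying over finite sets
  avoids summability side conditions and turns every estimate into one about finite sums.\<close>

definition coeff_bound :: "nat \<Rightarrow> (int ^ 'n \<Rightarrow> complex) \<Rightarrow> real \<Rightarrow> bool" where
  "coeff_bound m a Q \<longleftrightarrow> (\<forall>F. finite F \<longrightarrow> (\<Sum>n\<in>F. weight m n * (cmod (a n))\<^sup>2) \<le> Q)"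

lemma freq_sq_nonneg: "freq_sq n \<ge> 0"
  unfolding freq_sq_def by (intro sum_nonneg) auto

lemma coord_le_freq_sq: "(real_of_int (n $ j))\<^sup>2 \<le> freq_sq n"
  unfolding freq_sq_def by (rule member_le_sum) auto

lemma weight_ge_1: "weight m n \<ge> 1"
proof -
  have "freq_sq n ^ 0 \<le> weight m n"
    unfolding weight_def by (intro member_le_sum) (auto simp: freq_sq_nonneg)
  then show ?thesis by simp
qed

lemma weight_pos: "weight m n > 0"
  using weight_ge_1[of m n] by linarith

lemma weight_nonneg: "weight m n \<ge> 0"
  using weight_ge_1[of m n] by linarith

lemma weight_mono: "m \<le> m' \<Longrightarrow> weight m n \<le> weight m' n"
  unfolding weight_def by (intro sum_mono2) (auto simp: freq_sq_nonneg)

lemma freq_sq_weight_le: "freq_sq n * weight m n \<le> weight (Suc m) n"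
proof -
  have "weight (Suc m) n = 1 + freq_sq n * weight m n"
    unfolding weight_def by (subst sum.atMost_Suc_shift) (simp add: sum_distrib_left)
  then show ?thesis by simp
qed

lemma coord_weight_le: "(real_of_int (n $ j))\<^sup>2 * weight m n \<le> weight (Suc m) n"
  by (rule order_trans[OF mult_right_mono[OF coord_le_freq_sq weight_nonneg] freq_sq_weight_le])

lemma freq_sq_ge_1: "n \<noteq> 0 \<Longrightarrow> freq_sq n \<ge> 1"
proof -
  assume "n \<noteq> 0"
  then obtain j where j: "n $ j \<noteq> 0" by (auto simp: vec_eq_iff)
  then have "1 \<le> \<bar>n $ j\<bar>" by linarith
  then have "1 \<le> (n $ j)\<^sup>2" using abs_le_square_iff[of 1 "n $ j"] by simp
  then have "1 \<le> (real_of_int (n $ j))\<^sup>2" by (metis of_int_1_le_iff of_int_power)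
  then show ?thesis using coord_le_freq_sq[of n j] by linarith
qed

lemma freq_sq_0 [simp]: "freq_sq 0 = 0"
  by (simp add: freq_sq_def)

lemma weight_0 [simp]: "weight m 0 = 1"
  by (simp add: weight_def power_0_left)

lemma freq_sq_power_le_weight: "freq_sq n ^ m \<le> weight m n"
  unfolding weight_def by (intro member_le_sum) (auto simp: freq_sq_nonneg)

text \<open>Away from the origin |n|^2 is at least 1, so a weight is dominated by its top power
  times the number of its terms, here \<open>m + 2\<close>. The top powers satisfy the inequality
  with equality.\<close>

lemma weight_interpolation:
  "(weight (Suc m) n)\<^sup>2 \<le> (real m + 2)\<^sup>2 * (weight m n * weight (m + 2) n)"
proof (cases "n = 0")
  case False
  define x where "x = freq_sq n"
  have x: "x \<ge> 1" unfolding x_def using False by (rule freq_sq_ge_1)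
  have "weight (Suc m) n \<le> (\<Sum>l\<le>Suc m. x ^ Suc m)"
    unfolding weight_def x_def[symmetric] using x by (intro sum_mono power_increasing) auto
  then have "weight (Suc m) n \<le> (real m + 2) * x ^ Suc m" by (simp add: add.commute)
  then have "(weight (Suc m) n)\<^sup>2 \<le> ((real m + 2) * x ^ Suc m)\<^sup>2"
    by (intro power_mono weight_nonneg)
  also have "\<dots> = (real m + 2)\<^sup>2 * (x ^ m * x ^ (m + 2))"
    by (simp add: power2_eq_square power_add algebra_simps)
  also have "\<dots> \<le> (real m + 2)\<^sup>2 * (weight m n * weight (m + 2) n)"
    unfolding x_def by (intro mult_left_mono mult_mono freq_sq_power_le_weight weight_nonneg)
      (auto simp: freq_sq_nonneg)
  finally show ?thesis .
qed (use power_mono[of 1 "real m + 2" 2] in auto)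

lemma freq_sq_triangle: "freq_sq n \<le> 2 * freq_sq p + 2 * freq_sq (n - p)"
proof -
  have "(real_of_int (n $ j))\<^sup>2 \<le> 2 * (real_of_int (p $ j))\<^sup>2 + 2 * (real_of_int ((n - p) $ j))\<^sup>2" for j
    using zero_le_power2[of "real_of_int (p $ j) - real_of_int ((n - p) $ j)"]
    by (simp add: power2_eq_square algebra_simps)
  then have "freq_sq n \<le> (\<Sum>j\<in>UNIV. 2 * (real_of_int (p $ j))\<^sup>2 + 2 * (real_of_int ((n - p) $ j))\<^sup>2)"
    unfolding freq_sq_def by (intro sum_mono)
  then show ?thesis by (simp add: freq_sq_def sum.distrib sum_distrib_left)
qed

text \<open>The counterpart of the Leibniz rule: the weight at the frequency \<open>n\<close> of a
  product is charged either to the frequency \<open>p\<close> of one factor or to the frequency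
  \<open>n - p\<close> of the other.\<close>

lemma weight_triangle: "weight m n \<le> 4 ^ m * (weight m p + weight m (n - p))"
proof -
  define x where "x = freq_sq p"
  define y where "y = freq_sq (n - p)"
  have xy: "x \<ge> 0" "y \<ge> 0" unfolding x_def y_def by (auto intro: freq_sq_nonneg)
  have *: "freq_sq n ^ l \<le> 4 ^ m * (x ^ l + y ^ l)" if "l \<le> m" for l
  proof -
    have "freq_sq n \<le> 4 * max x y"
      using freq_sq_triangle[of n p] unfolding x_def y_def by (auto simp: max_def)
    then have "freq_sq n ^ l \<le> (4 * max x y) ^ l" by (intro power_mono freq_sq_nonneg)
    also have "\<dots> = 4 ^ l * (max x y) ^ l" by (simp add: power_mult_distrib)
    also have "\<dots> \<le> 4 ^ m * (x ^ l + y ^ l)"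
      using xy that by (intro mult_mono power_increasing) (auto simp: max_def)
    finally show ?thesis .
  qed
  have "weight m n \<le> (\<Sum>l\<le>m. 4 ^ m * (x ^ l + y ^ l))"
    unfolding weight_def by (intro sum_mono *) auto
  then show ?thesis
    by (simp add: weight_def x_def y_def sum.distrib flip: sum_distrib_left)
qed

lemma sqrt_weight_triangle:
  "sqrt (weight m n) \<le> 2 ^ m * (sqrt (weight m p) + sqrt (weight m (n - p)))"
proof -
  have "sqrt (weight m n) \<le> sqrt (4 ^ m * (weight m p + weight m (n - p)))"
    by (intro real_sqrt_le_mono weight_triangle)
  also have "\<dots> = 2 ^ m * sqrt (weight m p + weight m (n - p))"
    by (simp add: real_sqrt_mult real_sqrt_power)
  also have "\<dots> \<le> 2 ^ m * (sqrt (weight m p) + sqrt (weight m (n - p)))"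
    by (intro mult_left_mono sqrt_add_le_add_sqrt weight_nonneg) auto
  finally show ?thesis .
qed

lemma sum_int_powr_bounded:
  fixes s :: real
  assumes "s > 1"
  shows "\<exists>S>0. \<forall>N. (\<Sum>z\<in>{- int N..int N}. (1 + \<bar>real_of_int z\<bar>) powr (- s)) \<le> S"
proof -
  define g where "g = (\<lambda>i::nat. (real (Suc i)) powr (- s))"
  have "summable (\<lambda>i::nat. real i powr (- s))"
    using assms by (subst summable_real_powr_iff) auto
  then have sg: "summable g"
    unfolding g_def by (subst summable_Suc_iff)
  have g0: "g i \<ge> 0" for i by (simp add: g_def)
  have S0: "suminf g \<ge> 0" using g0 by (intro suminf_nonneg sg) auto
  \<comment> \<open>Counting the frequency 0 twice only enlarges the bound; the final 1 makes it
    strictly positive.\<close>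
  have "(\<Sum>z\<in>{- int N..int N}. (1 + \<bar>real_of_int z\<bar>) powr (- s)) \<le> 2 * suminf g + 1" for N
  proof -
    have "{- int N..int N} \<subseteq> int ` {..N} \<union> (\<lambda>i. - int i) ` {..N}"
    proof
      fix z assume "z \<in> {- int N..int N}"
      then have "z = int (nat z) \<and> nat z \<le> N \<or> z = - int (nat (- z)) \<and> nat (- z) \<le> N"
        by auto
      then show "z \<in> int ` {..N} \<union> (\<lambda>i. - int i) ` {..N}" by blast
    qed
    then have "(\<Sum>z\<in>{- int N..int N}. (1 + \<bar>real_of_int z\<bar>) powr (- s))
        \<le> (\<Sum>z\<in>int ` {..N} \<union> (\<lambda>i. - int i) ` {..N}. (1 + \<bar>real_of_int z\<bar>) powr (- s))"
      by (intro sum_mono2) auto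
    also have "\<dots> \<le> (\<Sum>z\<in>int ` {..N}. (1 + \<bar>real_of_int z\<bar>) powr (- s))
        + (\<Sum>z\<in>(\<lambda>i. - int i) ` {..N}. (1 + \<bar>real_of_int z\<bar>) powr (- s))"
      by (subst sum_Un) (auto intro!: sum_nonneg)
    also have "\<dots> = (\<Sum>i\<le>N. g i) + (\<Sum>i\<le>N. g i)"
      by (subst (1 2) sum.reindex) (auto simp: inj_on_def g_def add.commute)
    also have "\<dots> \<le> 2 * suminf g + 1"
      using sum_le_suminf[OF sg, of "{..N}"] g0 by auto
    finally show ?thesis .
  qed
  then show ?thesis using S0 by (intro exI[of _ "2 * suminf g + 1"]) auto
qed

lemma sum_box_prod:
  fixes f :: "int \<Rightarrow> real"
  assumes "finite I"
  shows "(\<Sum>n\<in>{n :: int ^ 'n. \<forall>j. n $ j \<in> I}. \<Prod>j\<in>UNIV. f (n $ j)) = (\<Sum>z\<in>I. f z) ^ CARD('n)"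
proof -
  have "(\<Sum>z\<in>I. f z) ^ CARD('n) = (\<Prod>j\<in>(UNIV :: 'n set). \<Sum>z\<in>I. f z)" by simp
  also have "\<dots> = (\<Sum>g\<in>PiE UNIV (\<lambda>_. I). \<Prod>j\<in>(UNIV :: 'n set). f (g j))"
    using assms by (intro prod_sum_PiE) auto
  also have "\<dots> = (\<Sum>n\<in>{n :: int ^ 'n. \<forall>j. n $ j \<in> I}. \<Prod>j\<in>UNIV. f (n $ j))"
    by (rule sum.reindex_bij_witness[of _ "\<lambda>n. vec_nth n" "\<lambda>g. \<chi> j. g j"]) (auto simp: PiE_UNIV_domain)
  finally show ?thesis by simp
qed

text \<open>With \<open>s = 2 * k / d\<close> the product of the d one-dimensional factors
  \<open>(1 + |n_j|) powr s\<close> is at most (1 + |n|)^(2k), hence at most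
  \<open>4 ^ k * weight k n\<close>. The lattice sum is thus dominated by the d-th power of a
  one-dimensional series, which converges exactly because \<open>k > d / 2\<close> means
  \<open>s > 1\<close>.\<close>

lemma lattice_sum_bounded:
  assumes "real k > real CARD('n) / 2"
  shows "\<exists>S>0. \<forall>F. finite F \<longrightarrow> (\<Sum>n\<in>F. 1 / weight k (n :: int ^ 'n)) \<le> S"
proof -
  define d where "d = CARD('n)"
  have d: "d > 0" unfolding d_def by simp
  define s where "s = 2 * real k / real d"
  have s: "s > 1" using assms d unfolding s_def d_def by (simp add: field_simps)
  have k: "k \<ge> 1" using assms by (cases k) auto
  obtain S where S: "S > 0" "\<And>N. (\<Sum>z\<in>{- int N..int N}. (1 + \<bar>real_of_int z\<bar>) powr (- s)) \<le> S"
    using sum_int_powr_bounded[OF s] by blast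
  have pt: "1 / weight k n \<le> 4 ^ k * (\<Prod>j\<in>UNIV. (1 + \<bar>real_of_int (n $ j)\<bar>) powr (- s))" for n :: "int ^ 'n"
  proof -
    define x where "x = sqrt (freq_sq n)"
    have x0: "x \<ge> 0" by (simp add: x_def freq_sq_nonneg)
    have xj: "\<bar>real_of_int (n $ j)\<bar> \<le> x" for j
      unfolding x_def using coord_le_freq_sq[of n j] real_le_rsqrt by fastforce
    have "(\<Prod>j\<in>UNIV. (1 + \<bar>real_of_int (n $ j)\<bar>) powr s) \<le> (\<Prod>j\<in>(UNIV::'n set). (1 + x) powr s)"
      using xj s by (intro prod_mono conjI powr_mono2) auto
    also have "\<dots> = (1 + x) powr (s * real d)"
      using x0 by (simp add: d_def powr_realpow[symmetric] powr_powr)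
    also have "s * real d = real (2 * k)" using d by (simp add: s_def)
    also have "(1 + x) powr real (2 * k) = (1 + x) ^ (2 * k)"
      using x0 by (intro powr_realpow) auto
    also have "\<dots> = ((1 + x)\<^sup>2) ^ k" by (simp add: power_mult)
    also have "\<dots> \<le> 4 ^ k * weight k n"
    proof (cases "n = 0")
      case True
      then show ?thesis by (simp add: x_def)
    next
      case False
      then have "1 \<le> x" using freq_sq_ge_1[OF False] by (simp add: x_def)
      then have "(1 + x)\<^sup>2 \<le> (2 * x)\<^sup>2" by (intro power_mono) auto
      also have "\<dots> = 4 * freq_sq n" by (simp add: x_def power_mult_distrib freq_sq_nonneg)
      finally have "((1 + x)\<^sup>2) ^ k \<le> (4 * freq_sq n) ^ k" by (intro power_mono) auto
      also have "\<dots> = 4 ^ k * freq_sq n ^ k" by (simp add: power_mult_distrib)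
      also have "\<dots> \<le> 4 ^ k * weight k n" by (intro mult_left_mono freq_sq_power_le_weight) auto
      finally show ?thesis .
    qed
    finally have *: "(\<Prod>j\<in>UNIV. (1 + \<bar>real_of_int (n $ j)\<bar>) powr s) \<le> 4 ^ k * weight k n" .
    have pos: "0 < (\<Prod>j\<in>UNIV. (1 + \<bar>real_of_int (n $ j)\<bar>) powr s)"
      by (intro prod_pos) (auto intro!: powr_gt_zero[THEN iffD2] simp: add_nonneg_eq_0_iff)
    have "(\<Prod>j\<in>UNIV. (1 + \<bar>real_of_int (n $ j)\<bar>) powr (- s))
        = 1 / (\<Prod>j\<in>UNIV. (1 + \<bar>real_of_int (n $ j)\<bar>) powr s)"
      by (simp add: powr_minus_divide prod_dividef)
    then show ?thesis using * pos weight_pos[of k n] by (simp add: field_simps)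
  qed
  have "(\<Sum>n\<in>F. 1 / weight k n) \<le> 4 ^ k * S ^ d" if F: "finite F" for F :: "(int ^ 'n) set"
  proof -
    \<comment> \<open>Half the side of a box of frequencies containing \<open>F\<close>; inserting 0
      keeps the maximum defined when \<open>F\<close> is empty.\<close>
    define N where "N = nat (Max (insert 0 ((\<lambda>(n, j). \<bar>n $ j\<bar>) ` (F \<times> UNIV))))"
    have N: "n $ j \<in> {- int N..int N}" if "n \<in> F" for n j
    proof -
      have "\<bar>n $ j\<bar> \<le> Max (insert 0 ((\<lambda>(n, j). \<bar>n $ j\<bar>) ` (F \<times> UNIV)))"
        using F that by (intro Max_ge) (auto intro!: image_eqI[of _ _ "(n, j)"])
      then show ?thesis unfolding N_def by auto
    qed
    define I where "I = {- int N..int N}"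
    have fin: "finite {n :: int ^ 'n. \<forall>j. n $ j \<in> I}"
    proof (rule finite_subset)
      show "{n :: int ^ 'n. \<forall>j. n $ j \<in> I} \<subseteq> (\<lambda>g. \<chi> j. g j) ` (PiE UNIV (\<lambda>_. I))"
      proof
        fix n :: "int ^ 'n" assume n: "n \<in> {n. \<forall>j. n $ j \<in> I}"
        have "n = (\<chi> j. (vec_nth n) j)" by simp
        moreover have "vec_nth n \<in> PiE UNIV (\<lambda>_. I)" using n by (auto simp: PiE_UNIV_domain)
        ultimately show "n \<in> (\<lambda>g. \<chi> j. g j) ` (PiE UNIV (\<lambda>_. I))" by blast
      qed
      show "finite ((\<lambda>g. (\<chi> j. g j) :: int ^ 'n) ` (PiE UNIV (\<lambda>_. I)))"
        by (intro finite_imageI finite_PiE) (auto simp: I_def)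
    qed
    have "(\<Sum>n\<in>F. 1 / weight k n) \<le> (\<Sum>n\<in>F. 4 ^ k * (\<Prod>j\<in>UNIV. (1 + \<bar>real_of_int (n $ j)\<bar>) powr (- s)))"
      by (intro sum_mono pt)
    also have "\<dots> \<le> (\<Sum>n\<in>{n :: int ^ 'n. \<forall>j. n $ j \<in> I}. 4 ^ k * (\<Prod>j\<in>UNIV. (1 + \<bar>real_of_int (n $ j)\<bar>) powr (- s)))"
      using fin N unfolding I_def by (intro sum_mono2) (auto intro!: mult_nonneg_nonneg prod_nonneg)
    also have "\<dots> = 4 ^ k * (\<Sum>z\<in>I. (1 + \<bar>real_of_int z\<bar>) powr (- s)) ^ d"
      unfolding sum_distrib_left[symmetric] d_def
      by (subst sum_box_prod[of I "\<lambda>z. (1 + \<bar>real_of_int z\<bar>) powr (- s)"]) (auto simp: I_def)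
    also have "\<dots> \<le> 4 ^ k * S ^ d"
      using S(2)[of N] by (intro mult_left_mono power_mono) (auto simp: I_def intro!: sum_nonneg)
    finally show ?thesis .
  qed
  then show ?thesis using S(1) by (intro exI[of _ "4 ^ k * S ^ d"]) auto
qed

subsection \<open>Weighted bounds on Fourier coefficients\<close>

lemma coeff_boundI:
  "(\<And>F. finite F \<Longrightarrow> (\<Sum>n\<in>F. weight m n * (cmod (a n))\<^sup>2) \<le> Q) \<Longrightarrow> coeff_bound m a Q"
  unfolding coeff_bound_def by blast

lemma coeff_boundD:
  "coeff_bound m a Q \<Longrightarrow> finite F \<Longrightarrow> (\<Sum>n\<in>F. weight m n * (cmod (a n))\<^sup>2) \<le> Q"
  unfolding coeff_bound_def by blast

lemma coeff_bound_nonneg: "coeff_bound m a Q \<Longrightarrow> Q \<ge> 0"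
  using coeff_boundD[of m a Q "{}"] by simp

lemma coeff_bound_point: "coeff_bound m a Q \<Longrightarrow> weight m n * (cmod (a n))\<^sup>2 \<le> Q"
  using coeff_boundD[of m a Q "{n}"] by simp

lemma coeff_bound_mono:
  "coeff_bound m a Q \<Longrightarrow> m' \<le> m \<Longrightarrow> Q \<le> Q' \<Longrightarrow> coeff_bound m' a Q'"
  by (intro coeff_boundI, rule order_trans[OF _ order_trans[OF coeff_boundD]])
     (auto intro!: sum_mono mult_right_mono weight_mono)

lemma coeff_bound_le:
  fixes a b :: "int ^ 'n \<Rightarrow> complex"
  assumes "coeff_bound m b Q" and "c \<ge> 0"
    and "\<And>n. weight m' n * (cmod (a n))\<^sup>2 \<le> c * (weight m n * (cmod (b n))\<^sup>2)"
  shows "coeff_bound m' a (c * Q)"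
proof (rule coeff_boundI)
  fix F :: "(int ^ 'n) set" assume "finite F"
  have "(\<Sum>n\<in>F. weight m' n * (cmod (a n))\<^sup>2) \<le> (\<Sum>n\<in>F. c * (weight m n * (cmod (b n))\<^sup>2))"
    by (intro sum_mono assms)
  also have "\<dots> \<le> c * Q"
    unfolding sum_distrib_left[symmetric]
    by (intro mult_left_mono coeff_boundD[OF assms(1)] \<open>finite F\<close> assms)
  finally show "(\<Sum>n\<in>F. weight m' n * (cmod (a n))\<^sup>2) \<le> c * Q" .
qed

lemma cmod_sum_sq_le:
  assumes "finite I"
  shows "(cmod (\<Sum>i\<in>I. x i))\<^sup>2 \<le> real (card I) * (\<Sum>i\<in>I. (cmod (x i))\<^sup>2)"
proof -
  have "(cmod (\<Sum>i\<in>I. x i))\<^sup>2 \<le> (\<Sum>i\<in>I. cmod (x i))\<^sup>2"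
    by (intro power_mono norm_sum) auto
  also have "\<dots> = (\<Sum>i\<in>I. 1 * cmod (x i))\<^sup>2" by simp
  also have "\<dots> \<le> (\<Sum>i\<in>I. 1\<^sup>2) * (\<Sum>i\<in>I. (cmod (x i))\<^sup>2)"
    by (rule Cauchy_Schwarz_ineq_sum)
  finally show ?thesis by simp
qed

lemma coeff_bound_sum:
  fixes a :: "'i \<Rightarrow> int ^ 'n \<Rightarrow> complex"
  assumes I: "finite I" and a: "\<And>i. i \<in> I \<Longrightarrow> coeff_bound m (a i) (Q i)"
  shows "coeff_bound m (\<lambda>n. \<Sum>i\<in>I. a i n) (real (card I) * (\<Sum>i\<in>I. Q i))"
proof (rule coeff_boundI)
  fix F :: "(int ^ 'n) set" assume F: "finite F"
  have "(\<Sum>n\<in>F. weight m n * (cmod (\<Sum>i\<in>I. a i n))\<^sup>2)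
      \<le> (\<Sum>n\<in>F. weight m n * (real (card I) * (\<Sum>i\<in>I. (cmod (a i n))\<^sup>2)))"
    by (intro sum_mono mult_left_mono cmod_sum_sq_le I weight_nonneg)
  also have "\<dots> = real (card I) * (\<Sum>i\<in>I. \<Sum>n\<in>F. weight m n * (cmod (a i n))\<^sup>2)"
    by (subst sum.swap) (simp add: sum_distrib_left mult_ac)
  also have "\<dots> \<le> real (card I) * (\<Sum>i\<in>I. Q i)"
    by (intro mult_left_mono sum_mono coeff_boundD a F) auto
  finally show "(\<Sum>n\<in>F. weight m n * (cmod (\<Sum>i\<in>I. a i n))\<^sup>2) \<le> real (card I) * (\<Sum>i\<in>I. Q i)" .
qed

lemma coeff_bound_cmult: "coeff_bound m a Q \<Longrightarrow> coeff_bound m (\<lambda>n. c * a n) ((cmod c)\<^sup>2 * Q)"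
  by (rule coeff_bound_le) (auto simp: norm_mult power_mult_distrib)

lemma coeff_bound_uminus: "coeff_bound m a Q \<Longrightarrow> coeff_bound m (\<lambda>n. - a n) Q"
  by (simp add: coeff_bound_def)

text \<open>Squares of norms are not subadditive; the factor 2 is the number of summands in
  \<open>coeff_bound_sum\<close>, used here with the index type of booleans.\<close>

lemma coeff_bound_add:
  assumes "coeff_bound m a A" "coeff_bound m b B"
  shows "coeff_bound m (\<lambda>n. a n + b n) (2 * (A + B))"
  using coeff_bound_sum[of "UNIV :: bool set" m "\<lambda>i. if i then a else b" "\<lambda>i. if i then A else B"] assms
  by (simp add: UNIV_bool add_ac)

lemma coeff_bound_diff:
  assumes "coeff_bound m a A" "coeff_bound m b B"
  shows "coeff_bound m (\<lambda>n. a n - b n) (2 * (A + B))"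
  using coeff_bound_add[OF assms(1) coeff_bound_uminus[OF assms(2)]] by simp

text \<open>Multiplication by \<open>n $ j\<close> is a partial derivative up to the factor
  \<open>\<i>\<close>, so it costs one order.\<close>

lemma coeff_bound_coord:
  assumes "coeff_bound (Suc m) a A"
  shows "coeff_bound m (\<lambda>n. of_int (n $ j) * a n) A"
proof -
  have "coeff_bound m (\<lambda>n. of_int (n $ j) * a n) (1 * A)"
  proof (rule coeff_bound_le[OF assms])
    fix n
    have "weight m n * (cmod (of_int (n $ j) * a n))\<^sup>2
        = ((real_of_int (n $ j))\<^sup>2 * weight m n) * (cmod (a n))\<^sup>2"
      by (simp add: norm_mult power_mult_distrib)
    also have "\<dots> \<le> weight (Suc m) n * (cmod (a n))\<^sup>2"
      by (intro mult_right_mono coord_weight_le) auto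
    finally show "weight m n * (cmod (of_int (n $ j) * a n))\<^sup>2 \<le> 1 * (weight (Suc m) n * (cmod (a n))\<^sup>2)"
      by simp
  qed auto
  then show ?thesis by simp
qed

text \<open>Cauchy-Schwarz between the sequence weighted at order \<open>m\<close> and the same
  sequence weighted at order \<open>m + 2\<close>. Since \<open>A\<close> and \<open>B\<close> bound
  squares, keeping \<open>B\<close> fixed leaves the square root of a squared norm: this is the
  source of the exponent one half.\<close>

lemma coeff_bound_interpolation:
  fixes a :: "int ^ 'n \<Rightarrow> complex"
  assumes A: "coeff_bound m a A" and B: "coeff_bound (m + 2) a B"
  shows "coeff_bound (Suc m) a ((real m + 2) * sqrt (A * B))"
proof (rule coeff_boundI)
  fix F :: "(int ^ 'n) set" assume F: "finite F"
  have A0: "A \<ge> 0" and B0: "B \<ge> 0" using A B coeff_bound_nonneg by auto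
  have "(\<Sum>n\<in>F. weight (Suc m) n * (cmod (a n))\<^sup>2)
      \<le> (\<Sum>n\<in>F. (real m + 2) * ((sqrt (weight m n) * cmod (a n)) * (sqrt (weight (m + 2) n) * cmod (a n))))"
  proof (rule sum_mono)
    fix n :: "int ^ 'n"
    have "weight (Suc m) n \<le> sqrt ((real m + 2)\<^sup>2 * (weight m n * weight (m + 2) n))"
      by (rule real_le_rsqrt[OF weight_interpolation])
    then have "weight (Suc m) n \<le> (real m + 2) * (sqrt (weight m n) * sqrt (weight (m + 2) n))"
      by (simp add: real_sqrt_mult)
    from mult_right_mono[OF this, of "(cmod (a n))\<^sup>2"]
    show "weight (Suc m) n * (cmod (a n))\<^sup>2
        \<le> (real m + 2) * ((sqrt (weight m n) * cmod (a n)) * (sqrt (weight (m + 2) n) * cmod (a n)))"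
      by (simp add: power2_eq_square mult_ac)
  qed
  also have "\<dots> = (real m + 2) * (\<Sum>n\<in>F. (sqrt (weight m n) * cmod (a n)) * (sqrt (weight (m + 2) n) * cmod (a n)))"
    by (simp add: sum_distrib_left)
  also have "\<dots> \<le> (real m + 2) * sqrt (A * B)"
  proof (intro mult_left_mono real_le_rsqrt)
    have "(\<Sum>n\<in>F. (sqrt (weight m n) * cmod (a n)) * (sqrt (weight (m + 2) n) * cmod (a n)))\<^sup>2
       \<le> (\<Sum>n\<in>F. (sqrt (weight m n) * cmod (a n))\<^sup>2) * (\<Sum>n\<in>F. (sqrt (weight (m + 2) n) * cmod (a n))\<^sup>2)"
      by (rule Cauchy_Schwarz_ineq_sum)
    also have "\<dots> = (\<Sum>n\<in>F. weight m n * (cmod (a n))\<^sup>2) * (\<Sum>n\<in>F. weight (m + 2) n * (cmod (a n))\<^sup>2)"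
      by (simp add: power_mult_distrib weight_nonneg)
    also have "\<dots> \<le> A * B"
      using A0 by (intro mult_mono coeff_boundD[OF A F] coeff_boundD[OF B F])
        (auto intro!: sum_nonneg mult_nonneg_nonneg weight_nonneg)
    finally show "(\<Sum>n\<in>F. (sqrt (weight m n) * cmod (a n)) * (sqrt (weight (m + 2) n) * cmod (a n)))\<^sup>2 \<le> A * B" .
  qed auto
  finally show "(\<Sum>n\<in>F. weight (Suc m) n * (cmod (a n))\<^sup>2) \<le> (real m + 2) * sqrt (A * B)" .
qed

subsection \<open>Convolution\<close>

lemma has_sum_finite_sum:
  fixes f :: "'i \<Rightarrow> 'a \<Rightarrow> 'b :: topological_comm_monoid_add"
  assumes "finite I" "\<And>i. i \<in> I \<Longrightarrow> (f i has_sum S i) A"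
  shows "((\<lambda>x. \<Sum>i\<in>I. f i x) has_sum (\<Sum>i\<in>I. S i)) A"
  using assms by (induction I rule: finite_induct) (auto intro: has_sum_add)

definition conv :: "(int ^ 'n \<Rightarrow> complex) \<Rightarrow> (int ^ 'n \<Rightarrow> complex) \<Rightarrow> int ^ 'n \<Rightarrow> complex" where
  "conv a b n = (\<Sum>\<^sub>\<infinity>p. a p * b (n - p))"

lemma sum_shift_le:
  fixes f :: "int ^ 'n \<Rightarrow> real"
  assumes "\<And>F. finite F \<Longrightarrow> sum f F \<le> S" and "finite P"
  shows "(\<Sum>p\<in>P. f (n - p)) \<le> S" and "(\<Sum>p\<in>P. f (p - n)) \<le> S"
proof -
  have "(\<Sum>p\<in>P. f (n - p)) = sum f ((\<lambda>p. n - p) ` P)"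
    by (subst sum.reindex) (auto simp: inj_on_def)
  then show "(\<Sum>p\<in>P. f (n - p)) \<le> S" using assms by simp
  have "(\<Sum>p\<in>P. f (p - n)) = sum f ((\<lambda>p. p - n) ` P)"
    by (subst sum.reindex) (auto simp: inj_on_def)
  then show "(\<Sum>p\<in>P. f (p - n)) \<le> S" using assms by simp
qed

text \<open>Each factor is at most the root of its bound divided by its weight, and x y is at most
  x^2 + y^2. The resulting majorant depends on \<open>a\<close> and \<open>b\<close> only through
  \<open>A\<close> and \<open>B\<close>, which makes the convolution series converge uniformly in
  time.\<close>

lemma conv_term_bound:
  assumes "coeff_bound k a A" "coeff_bound k b B"
  shows "cmod (a p * b q) \<le> sqrt (A * B) * (1 / weight k p + 1 / weight k q)"
proof -
  define x where "x = sqrt (1 / weight k p)"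
  define y where "y = sqrt (1 / weight k q)"
  have A0: "A \<ge> 0" and B0: "B \<ge> 0" using assms coeff_bound_nonneg by auto
  have a: "cmod (a p) \<le> sqrt A * x"
    unfolding x_def using coeff_bound_point[OF assms(1), of p] weight_pos[of k p]
    by (subst real_sqrt_mult[symmetric]) (intro real_le_rsqrt, simp add: field_simps)
  have b: "cmod (b q) \<le> sqrt B * y"
    unfolding y_def using coeff_bound_point[OF assms(2), of q] weight_pos[of k q]
    by (subst real_sqrt_mult[symmetric]) (intro real_le_rsqrt, simp add: field_simps)
  have xy: "x * y \<le> x\<^sup>2 + y\<^sup>2"
    using sum_squares_bound[of x y] zero_le_power2[of x] zero_le_power2[of y] by linarith
  have x2: "x\<^sup>2 = 1 / weight k p" and y2: "y\<^sup>2 = 1 / weight k q"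
    unfolding x_def y_def using weight_nonneg by auto
  have "cmod (a p * b q) \<le> (sqrt A * x) * (sqrt B * y)"
    unfolding norm_mult using a b A0 by (intro mult_mono) (auto simp: x_def weight_nonneg)
  also have "\<dots> = sqrt (A * B) * (x * y)" by (simp add: real_sqrt_mult)
  also have "\<dots> \<le> sqrt (A * B) * (x\<^sup>2 + y\<^sup>2)" using xy A0 B0 by (intro mult_left_mono) auto
  finally show ?thesis by (simp add: x2 y2)
qed

lemma conv_majorant_summable:
  assumes "real k > real CARD('n) / 2"
  shows "(\<lambda>p. c * (1 / weight k p + 1 / weight k (n - p :: int ^ 'n))) summable_on UNIV"
proof -
  obtain S where S: "\<And>F. finite F \<Longrightarrow> (\<Sum>n\<in>F. 1 / weight k (n :: int ^ 'n)) \<le> S"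
    using lattice_sum_bounded[OF assms] by blast
  have "(\<lambda>p. 1 / weight k p + 1 / weight k (n - p)) summable_on UNIV"
  proof (rule nonneg_bdd_above_summable_on)
    show "bdd_above (sum (\<lambda>p. 1 / weight k p + 1 / weight k (n - p)) ` {F. F \<subseteq> UNIV \<and> finite F})"
    proof (rule bdd_aboveI2)
      fix F :: "(int ^ 'n) set" assume "F \<in> {F. F \<subseteq> UNIV \<and> finite F}"
      then have "(\<Sum>p\<in>F. 1 / weight k p) \<le> S" "(\<Sum>p\<in>F. 1 / weight k (n - p)) \<le> S"
        using S sum_shift_le(1)[where f = "\<lambda>p. 1 / weight k p"] by auto
      then show "(\<Sum>p\<in>F. 1 / weight k p + 1 / weight k (n - p)) \<le> S + S" by (simp add: sum.distrib)
    qed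
  qed (auto simp: weight_nonneg)
  then show ?thesis by (rule summable_on_cmult_right)
qed

lemma conv_summable:
  assumes "real k > real CARD('n) / 2" "coeff_bound k a A" "coeff_bound k b B"
  shows "(\<lambda>p. a p * b (n - p :: int ^ 'n)) summable_on UNIV"
  by (rule abs_summable_summable, rule Infinite_Sum.abs_summable_on_comparison_test'
        [OF conv_majorant_summable[OF assms(1), of "sqrt (A * B)" n]])
     (rule conv_term_bound[OF assms(2,3)])

lemma conv_add_right:
  assumes "real k > real CARD('n) / 2" "coeff_bound k a A" "coeff_bound k b B" "coeff_bound k c C"
  shows "conv a (\<lambda>n. b n + c n) (n :: int ^ 'n) = conv a b n + conv a c n"
  unfolding conv_def distrib_left
  by (intro infsum_add conv_summable[OF assms(1,2,3)] conv_summable[OF assms(1,2,4)])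

lemma conv_diff_right:
  assumes "real k > real CARD('n) / 2" "coeff_bound k a A" "coeff_bound k b B" "coeff_bound k c C"
  shows "conv a (\<lambda>n. b n - c n) (n :: int ^ 'n) = conv a b n - conv a c n"
  using conv_add_right[OF assms(1-3) coeff_bound_uminus[OF assms(4)]]
  by (simp add: conv_def infsum_uminus)

lemma conv_diff_left:
  assumes "real k > real CARD('n) / 2" "coeff_bound k a A" "coeff_bound k b B" "coeff_bound k c C"
  shows "conv (\<lambda>n. a n - b n) c (n :: int ^ 'n) = conv a c n - conv b c n"
  proof -
  have "conv (\<lambda>n. a n + - b n) c n = conv a c n + conv (\<lambda>n. - b n) c n"
    unfolding conv_def distrib_right
    by (intro infsum_add conv_summable[OF assms(1,2,4)]
        conv_summable[OF assms(1) coeff_bound_uminus[OF assms(3)] assms(4)])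
  then show ?thesis by (simp add: conv_def infsum_uminus)
qed

text \<open>For a divergence-free field the convolution may be written in conservative form: the factor
  \<open>n - p\<close> on the second argument turns into \<open>n\<close>.\<close>

lemma conv_divergence_free:
  fixes q :: "'n::finite \<Rightarrow> int ^ 'n \<Rightarrow> complex"
  assumes k: "real k > real CARD('n) / 2" and q: "\<And>j. coeff_bound k (q j) A"
    and b: "coeff_bound (Suc k) b B"
    and div: "\<And>p. (\<Sum>j\<in>UNIV. of_int (p $ j) * q j p) = 0"
  shows "(\<Sum>j\<in>UNIV. conv (q j) (\<lambda>m. of_int (m $ j) * b m) n)
    = (\<Sum>j\<in>UNIV. of_int (n $ j) * conv (q j) b n)"
proof -
  have b': "coeff_bound k b B" by (rule coeff_bound_mono[OF b]) auto
  have "(\<Sum>j\<in>UNIV. conv (q j) (\<lambda>m. of_int (m $ j) * b m) n)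
      = (\<Sum>\<^sub>\<infinity>p. \<Sum>j\<in>UNIV. q j p * (of_int ((n - p) $ j) * b (n - p)))"
    unfolding conv_def
    by (rule infsumI[symmetric], rule has_sum_finite_sum)
      (simp, rule has_sum_infsum, rule conv_summable[OF k q coeff_bound_coord[OF b]])
  also have "\<dots> = (\<Sum>\<^sub>\<infinity>p. \<Sum>j\<in>UNIV. of_int (n $ j) * (q j p * b (n - p)))"
  proof (rule infsum_cong)
    fix p
    have "(\<Sum>j\<in>UNIV. q j p * (of_int ((n - p) $ j) * b (n - p)))
       = (\<Sum>j\<in>UNIV. of_int (n $ j) * (q j p * b (n - p))) - (\<Sum>j\<in>UNIV. of_int (p $ j) * q j p) * b (n - p)"
      unfolding sum_distrib_right sum_subtractf[symmetric]
      by (intro sum.cong refl) (simp add: algebra_simps)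
    then show "(\<Sum>j\<in>UNIV. q j p * (of_int ((n - p) $ j) * b (n - p)))
       = (\<Sum>j\<in>UNIV. of_int (n $ j) * (q j p * b (n - p)))"
      using div[of p] by simp
  qed
  also have "\<dots> = (\<Sum>j\<in>UNIV. \<Sum>\<^sub>\<infinity>p. of_int (n $ j) * (q j p * b (n - p)))"
    by (rule infsumI, rule has_sum_finite_sum)
      (simp, intro has_sum_infsum summable_on_cmult_right conv_summable[OF k q b'])
  also have "\<dots> = (\<Sum>j\<in>UNIV. of_int (n $ j) * conv (q j) b n)"
    unfolding conv_def by (intro sum.cong refl infsum_cmult_right conv_summable[OF k q b'])
  finally show ?thesis .
qed

text \<open>Sobolev embedding into absolutely convergent Fourier series: Cauchy-Schwarz after
  inserting the weight and its inverse.\<close>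

lemma coeff_bound_l1:
  fixes a :: "int ^ 'n \<Rightarrow> complex"
  assumes S: "\<And>F. finite F \<Longrightarrow> (\<Sum>n\<in>F. 1 / weight m (n :: int ^ 'n)) \<le> S"
    and a: "coeff_bound m a A" and F: "finite F"
  shows "(\<Sum>n\<in>F. cmod (a n)) \<le> sqrt (S * A)"
proof (rule real_le_rsqrt)
  have S0: "S \<ge> 0" using S[of "{}"] by simp
  have w: "weight m n \<noteq> 0" for n :: "int ^ 'n" using weight_pos[of m n] by simp
  have "(\<Sum>n\<in>F. cmod (a n)) = (\<Sum>n\<in>F. sqrt (1 / weight m n) * (sqrt (weight m n) * cmod (a n)))"
    by (intro sum.cong refl) (simp add: real_sqrt_divide w)
  then have "(\<Sum>n\<in>F. cmod (a n))\<^sup>2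
      \<le> (\<Sum>n\<in>F. (sqrt (1 / weight m n))\<^sup>2) * (\<Sum>n\<in>F. (sqrt (weight m n) * cmod (a n))\<^sup>2)"
    using Cauchy_Schwarz_ineq_sum[of "\<lambda>n. sqrt (1 / weight m n)" "\<lambda>n. sqrt (weight m n) * cmod (a n)" F]
    by simp
  also have "\<dots> = (\<Sum>n\<in>F. 1 / weight m n) * (\<Sum>n\<in>F. weight m n * (cmod (a n))\<^sup>2)"
    by (simp add: power_mult_distrib weight_nonneg)
  also have "\<dots> \<le> S * A"
    using S0 by (intro mult_mono S coeff_boundD[OF a] F)
      (auto intro!: sum_nonneg mult_nonneg_nonneg weight_nonneg)
  finally show "(\<Sum>n\<in>F. cmod (a n))\<^sup>2 \<le> S * A" .
qed

text \<open>Young's inequality for the convolution of l^1 with l^2, on finite sets. The index map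
  \<open>s\<close> stands for the shift, so that translation invariance enters only through the
  hypothesis on \<open>\<beta>\<close>.\<close>

lemma finite_young:
  fixes \<alpha> \<beta> :: "'a \<Rightarrow> real" and s :: "'b \<Rightarrow> 'a \<Rightarrow> 'a"
  assumes "finite P" "\<And>p. \<alpha> p \<ge> 0" "L \<ge> 0"
    and l1: "(\<Sum>p\<in>P. \<alpha> p) \<le> L" and l2: "\<And>p. (\<Sum>n\<in>F. (\<beta> (s n p))\<^sup>2) \<le> B"
  shows "(\<Sum>n\<in>F. (\<Sum>p\<in>P. \<alpha> p * \<beta> (s n p))\<^sup>2) \<le> L\<^sup>2 * B"
proof -
  have B0: "B \<ge> 0" using l2[of undefined] by (rule order_trans[rotated]) (auto intro!: sum_nonneg)
  have "(\<Sum>p\<in>P. \<alpha> p * \<beta> (s n p))\<^sup>2 \<le> L * (\<Sum>p\<in>P. \<alpha> p * (\<beta> (s n p))\<^sup>2)" for n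
  proof -
    \<comment> \<open>Half of the weight \<open>\<alpha>\<close> is kept outside, so that
      Cauchy-Schwarz costs one factor \<open>L\<close> and leaves \<open>\<beta>\<close> squared
      under the weight \<open>\<alpha>\<close>.\<close>
    have "(\<Sum>p\<in>P. \<alpha> p * \<beta> (s n p))\<^sup>2 = (\<Sum>p\<in>P. sqrt (\<alpha> p) * (sqrt (\<alpha> p) * \<beta> (s n p)))\<^sup>2"
      using assms(2) by (simp add: mult.assoc[symmetric])
    also have "\<dots> \<le> (\<Sum>p\<in>P. (sqrt (\<alpha> p))\<^sup>2) * (\<Sum>p\<in>P. (sqrt (\<alpha> p) * \<beta> (s n p))\<^sup>2)"
      by (rule Cauchy_Schwarz_ineq_sum)
    also have "\<dots> = (\<Sum>p\<in>P. \<alpha> p) * (\<Sum>p\<in>P. \<alpha> p * (\<beta> (s n p))\<^sup>2)"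
      using assms(2) by (simp add: power_mult_distrib)
    also have "\<dots> \<le> L * (\<Sum>p\<in>P. \<alpha> p * (\<beta> (s n p))\<^sup>2)"
      using assms(2) by (intro mult_right_mono l1 sum_nonneg) auto
    finally show ?thesis .
  qed
  then have "(\<Sum>n\<in>F. (\<Sum>p\<in>P. \<alpha> p * \<beta> (s n p))\<^sup>2) \<le> (\<Sum>n\<in>F. L * (\<Sum>p\<in>P. \<alpha> p * (\<beta> (s n p))\<^sup>2))"
    by (intro sum_mono)
  also have "\<dots> = L * (\<Sum>p\<in>P. \<alpha> p * (\<Sum>n\<in>F. (\<beta> (s n p))\<^sup>2))"
    by (simp add: sum_distrib_left) (subst sum.swap, simp)
  also have "\<dots> \<le> L * (\<Sum>p\<in>P. \<alpha> p * B)"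
    using assms by (intro mult_left_mono sum_mono) auto
  also have "\<dots> = L * ((\<Sum>p\<in>P. \<alpha> p) * B)" by (simp add: sum_distrib_right)
  also have "\<dots> \<le> L * (L * B)" using l1 B0 \<open>L \<ge> 0\<close> by (intro mult_left_mono mult_right_mono) auto
  finally show ?thesis by (simp add: power2_eq_square mult_ac)
qed

text \<open>After \<open>sqrt_weight_triangle\<close> the weighted convolution splits into two
  convolutions in which only one factor carries the weight. The other factor is in l^1 by
  \<open>coeff_bound_l1\<close>, and Young's inequality applies to each. This is done for finite
  truncations of the inner sum, whose bound does not depend on the truncation.\<close>

lemma conv_coeff_bound:
  assumes k: "real m > real CARD('n) / 2"
  shows "\<exists>C>0. \<forall>(a :: int ^ 'n \<Rightarrow> complex) b A B.
    coeff_bound m a A \<longrightarrow> coeff_bound m b B \<longrightarrow> coeff_bound m (conv a b) (C * A * B)"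
proof -
  obtain S where S: "S > 0" "\<And>F. finite F \<Longrightarrow> (\<Sum>n\<in>F. 1 / weight m (n :: int ^ 'n)) \<le> S"
    using lattice_sum_bounded[OF k] by blast
  have main: "coeff_bound m (conv a b) (4 ^ (m + 1) * S * A * B)"
    if a: "coeff_bound m a A" and b: "coeff_bound m b B" for a b :: "int ^ 'n \<Rightarrow> complex" and A B
  proof (rule coeff_boundI)
    fix F :: "(int ^ 'n) set" assume F: "finite F"
    have A0: "A \<ge> 0" and B0: "B \<ge> 0" using a b coeff_bound_nonneg by auto
    have two: "((2::real) ^ m)\<^sup>2 = 4 ^ m" by (simp add: power2_eq_square flip: power_mult_distrib)
    have fin: "(\<Sum>n\<in>F. weight m n * (cmod (\<Sum>p\<in>P. a p * b (n - p)))\<^sup>2) \<le> 4 ^ (m + 1) * S * A * B"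
      if P: "finite P" for P
    proof -
      define X where "X n = (\<Sum>p\<in>P. cmod (a p) * (sqrt (weight m (n - p)) * cmod (b (n - p))))" for n
      \<comment> \<open>The part with the weight on \<open>a\<close>, reindexed by
        \<open>q = n - p\<close> so that the l^1 factor \<open>b\<close> has the summation index as
        its argument. The union makes the index set independent of \<open>n\<close>, and the
        conditional removes the values of \<open>q\<close> that do not come from
        \<open>P\<close>.\<close>
      define Y where "Y n = (\<Sum>q\<in>(\<Union>n\<in>F. (\<lambda>p. n - p) ` P).
          cmod (b q) * (if n - q \<in> P then sqrt (weight m (n - q)) * cmod (a (n - q)) else 0))" for n
      have fY: "finite (\<Union>n\<in>F. (\<lambda>p. n - p) ` P)" using F P by auto
      have Yeq: "Y n = (\<Sum>p\<in>P. (sqrt (weight m p) * cmod (a p)) * cmod (b (n - p)))" if n: "n \<in> F" for n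
      proof -
        have "(\<Sum>p\<in>P. (sqrt (weight m p) * cmod (a p)) * cmod (b (n - p)))
          = (\<Sum>q\<in>(\<lambda>p. n - p) ` P. cmod (b q) * (if n - q \<in> P then sqrt (weight m (n - q)) * cmod (a (n - q)) else 0))"
          by (subst sum.reindex) (auto simp: inj_on_def intro!: sum.cong)
        also have "\<dots> = Y n"
          unfolding Y_def
        proof (rule sum.mono_neutral_left[OF fY])
          have "n - q \<notin> P" if "q \<notin> (\<lambda>p. n - p) ` P" for q
            using that by (metis diff_diff_eq2 add_diff_cancel_left' imageI)
          then show "\<forall>q\<in>(\<Union>n\<in>F. (\<lambda>p. n - p) ` P) - (\<lambda>p. n - p) ` P.
              cmod (b q) * (if n - q \<in> P then sqrt (weight m (n - q)) * cmod (a (n - q)) else 0) = 0"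
            by simp
        qed (use n in blast)
        finally show ?thesis by simp
      qed
      have X: "(\<Sum>n\<in>F. (X n)\<^sup>2) \<le> (sqrt (S * A))\<^sup>2 * B"
        unfolding X_def
      proof (rule finite_young[where s = "\<lambda>n p. n - p" and \<beta> = "\<lambda>q. sqrt (weight m q) * cmod (b q)"])
        show "(\<Sum>p\<in>P. cmod (a p)) \<le> sqrt (S * A)" by (rule coeff_bound_l1[OF S(2) a P])
        show "(\<Sum>n\<in>F. (sqrt (weight m (n - p)) * cmod (b (n - p)))\<^sup>2) \<le> B" for p
          using sum_shift_le(2)[OF coeff_boundD[OF b] F, where n = p]
          by (simp add: power_mult_distrib weight_nonneg)
      qed (use P S A0 in auto)
      have Y: "(\<Sum>n\<in>F. (Y n)\<^sup>2) \<le> (sqrt (S * B))\<^sup>2 * A"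
        unfolding Y_def
      proof (rule finite_young[where s = "\<lambda>n q. n - q"
            and \<beta> = "\<lambda>p. if p \<in> P then sqrt (weight m p) * cmod (a p) else 0"])
        show "(\<Sum>p\<in>(\<Union>n\<in>F. (\<lambda>p. n - p) ` P). cmod (b p)) \<le> sqrt (S * B)"
          by (rule coeff_bound_l1[OF S(2) b fY])
        show "(\<Sum>n\<in>F. (if n - p \<in> P then sqrt (weight m (n - p)) * cmod (a (n - p)) else 0)\<^sup>2) \<le> A" for p
        proof -
          have "(\<Sum>n\<in>F. (if n - p \<in> P then sqrt (weight m (n - p)) * cmod (a (n - p)) else 0)\<^sup>2)
            \<le> (\<Sum>n\<in>F. weight m (n - p) * (cmod (a (n - p)))\<^sup>2)"
            by (intro sum_mono) (auto simp: power_mult_distrib weight_nonneg)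
          also have "\<dots> \<le> A" by (rule sum_shift_le(2)[OF coeff_boundD[OF a] F, where n = p])
          finally show ?thesis .
        qed
      qed (use fY S B0 in auto)
      have pt: "weight m n * (cmod (\<Sum>p\<in>P. a p * b (n - p)))\<^sup>2 \<le> 4 ^ m * (2 * (X n)\<^sup>2 + 2 * (Y n)\<^sup>2)"
        if n: "n \<in> F" for n
      proof -
        have "sqrt (weight m n) * cmod (\<Sum>p\<in>P. a p * b (n - p))
          \<le> sqrt (weight m n) * (\<Sum>p\<in>P. cmod (a p) * cmod (b (n - p)))"
          by (intro mult_left_mono order_trans[OF norm_sum]) (auto simp: norm_mult weight_nonneg)
        also have "\<dots> = (\<Sum>p\<in>P. sqrt (weight m n) * (cmod (a p) * cmod (b (n - p))))"
          by (simp add: sum_distrib_left)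
        also have "\<dots> \<le> (\<Sum>p\<in>P. (2 ^ m * (sqrt (weight m p) + sqrt (weight m (n - p)))) * (cmod (a p) * cmod (b (n - p))))"
          by (intro sum_mono mult_right_mono sqrt_weight_triangle) auto
        also have "\<dots> = 2 ^ m * (X n + Y n)"
          unfolding Yeq[OF n] X_def by (simp add: sum_distrib_left sum.distrib[symmetric] algebra_simps)
        finally have "(sqrt (weight m n) * cmod (\<Sum>p\<in>P. a p * b (n - p)))\<^sup>2 \<le> (2 ^ m * (X n + Y n))\<^sup>2"
          by (intro power_mono) (auto simp: weight_nonneg)
        also have "\<dots> = 4 ^ m * (X n + Y n)\<^sup>2" by (simp add: power_mult_distrib two)
        also have "\<dots> \<le> 4 ^ m * (2 * (X n)\<^sup>2 + 2 * (Y n)\<^sup>2)"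
          using zero_le_power2[of "X n - Y n"] by (intro mult_left_mono) (auto simp: power2_eq_square algebra_simps)
        finally show ?thesis by (simp add: power_mult_distrib weight_nonneg)
      qed
      have "(\<Sum>n\<in>F. weight m n * (cmod (\<Sum>p\<in>P. a p * b (n - p)))\<^sup>2) \<le> (\<Sum>n\<in>F. 4 ^ m * (2 * (X n)\<^sup>2 + 2 * (Y n)\<^sup>2))"
        by (intro sum_mono pt)
      also have "\<dots> = 4 ^ m * (2 * (\<Sum>n\<in>F. (X n)\<^sup>2) + 2 * (\<Sum>n\<in>F. (Y n)\<^sup>2))"
        by (simp add: sum.distrib flip: sum_distrib_left)
      also have "\<dots> \<le> 4 ^ m * (2 * ((sqrt (S * A))\<^sup>2 * B) + 2 * ((sqrt (S * B))\<^sup>2 * A))"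
        using X Y by (intro mult_left_mono add_mono) auto
      also have "\<dots> = 4 ^ (m + 1) * S * A * B"
        using S(1) A0 B0 by (simp add: algebra_simps)
      finally show ?thesis .
    qed
    \<comment> \<open>The outer sum is finite, so the limit over the truncations \<open>P\<close>
      may be taken inside it.\<close>
    have "((\<lambda>P. \<Sum>n\<in>F. weight m n * (cmod (\<Sum>p\<in>P. a p * b (n - p)))\<^sup>2)
        \<longlongrightarrow> (\<Sum>n\<in>F. weight m n * (cmod (conv a b n))\<^sup>2)) (finite_subsets_at_top UNIV)"
      unfolding conv_def by (intro tendsto_intros infsum_tendsto conv_summable[OF k a b])
    then show "(\<Sum>n\<in>F. weight m n * (cmod (conv a b n))\<^sup>2) \<le> 4 ^ (m + 1) * S * A * B"
      by (rule tendsto_upperbound[OF _ eventually_finite_subsets_at_top_weakI[OF fin]]) auto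
  qed
  then show ?thesis using S(1) by (intro exI[of _ "4 ^ (m + 1) * S"]) auto
qed

section \<open>Calculus in time and energy estimates for coefficient sequences\<close>

subsection \<open>Time-dependent Fourier coefficients\<close>

lemma conv_continuous_on:
  fixes a b :: "real \<Rightarrow> int ^ 'n \<Rightarrow> complex"
  assumes k: "real k > real CARD('n) / 2"
    and a: "\<And>t. t \<in> S \<Longrightarrow> coeff_bound k (a t) A" and b: "\<And>t. t \<in> S \<Longrightarrow> coeff_bound k (b t) B"
    and ca: "\<And>n. continuous_on S (\<lambda>t. a t n)" and cb: "\<And>n. continuous_on S (\<lambda>t. b t n)"
  shows "continuous_on S (\<lambda>t. conv (a t) (b t) n)"
  unfolding conv_def
proof (rule uniform_limit_theorem)
  show "uniform_limit S (\<lambda>P t. \<Sum>p\<in>P. a t p * b t (n - p)) (\<lambda>t. \<Sum>\<^sub>\<infinity>p. a t p * b t (n - p))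
      (finite_subsets_at_top UNIV)"
    by (rule Weierstrass_m_test_general[OF _ conv_majorant_summable[OF k, of "sqrt (A * B)" n]])
       (rule conv_term_bound[OF a b])
  show "\<forall>\<^sub>F P in finite_subsets_at_top UNIV. continuous_on S (\<lambda>t. \<Sum>p\<in>P. a t p * b t (n - p))"
    by (intro always_eventually allI continuous_intros ca cb)
qed simp

lemma has_vector_derivative_infsum:
  fixes f f' :: "'i \<Rightarrow> real \<Rightarrow> complex"
  assumes S: "convex S" and M: "M summable_on UNIV"
    and f: "\<And>p t. t \<in> S \<Longrightarrow> cmod (f p t) \<le> M p" and f': "\<And>p t. t \<in> S \<Longrightarrow> cmod (f' p t) \<le> M p"
    and der: "\<And>p t. t \<in> S \<Longrightarrow> (f p has_vector_derivative f' p t) (at t within S)"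
    and t: "t \<in> S"
  shows "((\<lambda>t. \<Sum>\<^sub>\<infinity>p. f p t) has_vector_derivative (\<Sum>\<^sub>\<infinity>p. f' p t)) (at t within S)"
proof -
  have u: "uniform_limit S (\<lambda>P t. \<Sum>p\<in>P. f p t) (\<lambda>t. \<Sum>\<^sub>\<infinity>p. f p t) (finite_subsets_at_top UNIV)"
    by (rule Weierstrass_m_test_general[OF f M])
  have u': "uniform_limit S (\<lambda>P t. \<Sum>p\<in>P. f' p t) (\<lambda>t. \<Sum>\<^sub>\<infinity>p. f' p t) (finite_subsets_at_top UNIV)"
    by (rule Weierstrass_m_test_general[OF f' M])
  \<comment> \<open>Termwise differentiation is applied along a sequence, so a sequence of finite
    sets is extracted from the net of all finite sets, on which the sums of \<open>f\<close> and
    those of \<open>f'\<close> converge uniformly at the same time.\<close>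
  have "\<exists>P. \<forall>t\<in>S. dist (\<Sum>p\<in>P. f p t) (\<Sum>\<^sub>\<infinity>p. f p t) < inverse (real (Suc N))
      \<and> dist (\<Sum>p\<in>P. f' p t) (\<Sum>\<^sub>\<infinity>p. f' p t) < inverse (real (Suc N))" for N
  proof -
    have "\<forall>\<^sub>F P in finite_subsets_at_top UNIV.
        (\<forall>t\<in>S. dist (\<Sum>p\<in>P. f p t) (\<Sum>\<^sub>\<infinity>p. f p t) < inverse (real (Suc N))) \<and>
        (\<forall>t\<in>S. dist (\<Sum>p\<in>P. f' p t) (\<Sum>\<^sub>\<infinity>p. f' p t) < inverse (real (Suc N)))"
      by (intro eventually_conj uniform_limitD[OF u] uniform_limitD[OF u']) simp_all
    from eventually_happens'[OF finite_subsets_at_top_neq_bot this]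
    obtain P where "(\<forall>t\<in>S. dist (\<Sum>p\<in>P. f p t) (\<Sum>\<^sub>\<infinity>p. f p t) < inverse (real (Suc N))) \<and>
        (\<forall>t\<in>S. dist (\<Sum>p\<in>P. f' p t) (\<Sum>\<^sub>\<infinity>p. f' p t) < inverse (real (Suc N)))" ..
    then show ?thesis by (intro exI[of _ P]) (simp only: ball_conj_distrib)
  qed
  then obtain P where P: "\<And>N t. t \<in> S \<Longrightarrow> dist (\<Sum>p\<in>P N. f p t) (\<Sum>\<^sub>\<infinity>p. f p t) < inverse (real (Suc N))"
      "\<And>N t. t \<in> S \<Longrightarrow> dist (\<Sum>p\<in>P N. f' p t) (\<Sum>\<^sub>\<infinity>p. f' p t) < inverse (real (Suc N))"
    by metis
  have lim: "(\<lambda>N. \<Sum>p\<in>P N. f p s) \<longlonglongrightarrow> (\<Sum>\<^sub>\<infinity>p. f p s)" if "s \<in> S" for s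
    unfolding tendsto_dist_iff[of _ "\<Sum>\<^sub>\<infinity>p. f p s"]
    by (rule tendsto_sandwich[OF _ _ tendsto_const LIMSEQ_inverse_real_of_nat])
       (auto intro!: always_eventually less_imp_le[OF P(1)[OF that]] simp del: of_nat_Suc)
  have "\<exists>g. \<forall>x\<in>S. (\<lambda>N. \<Sum>p\<in>P N. f p x) \<longlonglongrightarrow> g x \<and>
      (g has_derivative (\<lambda>h. h *\<^sub>R (\<Sum>\<^sub>\<infinity>p. f' p x))) (at x within S)"
  proof (rule has_derivative_sequence[where f = "\<lambda>N t. \<Sum>p\<in>P N. f p t" and l = "\<Sum>\<^sub>\<infinity>p. f p t"
        and f' = "\<lambda>N x h. h *\<^sub>R (\<Sum>p\<in>P N. f' p x)", OF S _ _ t lim[OF t]])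
    show "((\<lambda>x. \<Sum>p\<in>P N. f p x) has_derivative (\<lambda>h. h *\<^sub>R (\<Sum>p\<in>P N. f' p x))) (at x within S)"
      if "x \<in> S" for N x
      using has_vector_derivative_sum[of "P N" f "\<lambda>p. f' p x" "at x within S"] der[OF that]
      by (simp add: has_vector_derivative_def)
    fix e :: real assume "e > 0"
    then obtain N0 where N0: "inverse (real (Suc N0)) < e" using reals_Archimedean by blast
    have "norm (h *\<^sub>R (\<Sum>p\<in>P N. f' p x) - h *\<^sub>R (\<Sum>\<^sub>\<infinity>p. f' p x)) \<le> e * norm h"
      if "N \<ge> N0" "x \<in> S" for N x h
    proof -
      have "inverse (real (Suc N)) \<le> inverse (real (Suc N0))" using that by (intro le_imp_inverse_le) auto
      then have "norm ((\<Sum>p\<in>P N. f' p x) - (\<Sum>\<^sub>\<infinity>p. f' p x)) \<le> e"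
        using P(2)[OF that(2), of N] N0 unfolding dist_norm by linarith
      then have "\<bar>h\<bar> * norm ((\<Sum>p\<in>P N. f' p x) - (\<Sum>\<^sub>\<infinity>p. f' p x)) \<le> \<bar>h\<bar> * e"
        by (intro mult_left_mono) auto
      then show ?thesis by (simp add: scaleR_diff_right[symmetric] mult.commute)
    qed
    then show "\<forall>\<^sub>F N in sequentially. \<forall>x\<in>S. \<forall>h.
        norm (h *\<^sub>R (\<Sum>p\<in>P N. f' p x) - h *\<^sub>R (\<Sum>\<^sub>\<infinity>p. f' p x)) \<le> e * norm h"
      by (auto simp: eventually_sequentially)
  qed
  then obtain g where g: "\<And>x. x \<in> S \<Longrightarrow> (\<lambda>N. \<Sum>p\<in>P N. f p x) \<longlonglongrightarrow> g x"
      "\<And>x. x \<in> S \<Longrightarrow> (g has_derivative (\<lambda>h. h *\<^sub>R (\<Sum>\<^sub>\<infinity>p. f' p x))) (at x within S)"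
    by blast
  have "g x = (\<Sum>\<^sub>\<infinity>p. f p x)" if "x \<in> S" for x
    using LIMSEQ_unique[OF g(1) lim] that by blast
  then show ?thesis
    unfolding has_vector_derivative_def using has_derivative_transform[OF t _ g(2)[OF t]] by simp
qed

lemma conv_has_vector_derivative:
  fixes a b a' b' :: "real \<Rightarrow> int ^ 'n \<Rightarrow> complex"
  assumes k: "real k > real CARD('n) / 2" and S: "convex S" and t: "t \<in> S"
    and a: "\<And>t. t \<in> S \<Longrightarrow> coeff_bound k (a t) A" and b: "\<And>t. t \<in> S \<Longrightarrow> coeff_bound k (b t) B"
    and a': "\<And>t. t \<in> S \<Longrightarrow> coeff_bound k (a' t) A'" and b': "\<And>t. t \<in> S \<Longrightarrow> coeff_bound k (b' t) B'"
    and da: "\<And>t n. t \<in> S \<Longrightarrow> ((\<lambda>t. a t n) has_vector_derivative a' t n) (at t within S)"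
    and db: "\<And>t n. t \<in> S \<Longrightarrow> ((\<lambda>t. b t n) has_vector_derivative b' t n) (at t within S)"
  shows "((\<lambda>t. conv (a t) (b t) n) has_vector_derivative conv (a' t) (b t) n + conv (a t) (b' t) n)
    (at t within S)"
proof -
  \<comment> \<open>One constant for two majorants: the first summand serves the series, the other
    two its termwise derivative by the product rule.\<close>
  define c where "c = sqrt (A * B) + (sqrt (A' * B) + sqrt (A * B'))"
  have nn: "A \<ge> 0" "A' \<ge> 0" "B \<ge> 0" "B' \<ge> 0" using a b a' b' t coeff_bound_nonneg by blast+
  define e where "e p = 1 / weight k p + 1 / weight k (n - p)" for p
  have e0: "e p \<ge> 0" for p by (simp add: e_def weight_nonneg)
  have "((\<lambda>t. \<Sum>\<^sub>\<infinity>p. a t p * b t (n - p)) has_vector_derivative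
      (\<Sum>\<^sub>\<infinity>p. a' t p * b t (n - p) + a t p * b' t (n - p))) (at t within S)"
  proof (rule has_vector_derivative_infsum[OF S _ _ _ _ t])
    show "(\<lambda>p. c * e p) summable_on UNIV"
      unfolding e_def by (rule conv_majorant_summable[OF k])
    show "cmod (a s p * b s (n - p)) \<le> c * e p" if "s \<in> S" for p s
    proof -
      have "cmod (a s p * b s (n - p)) \<le> sqrt (A * B) * e p"
        unfolding e_def by (rule conv_term_bound[OF a[OF that] b[OF that]])
      also have "\<dots> \<le> c * e p" using e0 nn unfolding c_def by (intro mult_right_mono) auto
      finally show ?thesis .
    qed
    show "cmod (a' s p * b s (n - p) + a s p * b' s (n - p)) \<le> c * e p" if "s \<in> S" for p s
    proof -
      have "cmod (a' s p * b s (n - p)) \<le> sqrt (A' * B) * e p"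
        unfolding e_def by (rule conv_term_bound[OF a'[OF that] b[OF that]])
      moreover have "cmod (a s p * b' s (n - p)) \<le> sqrt (A * B') * e p"
        unfolding e_def by (rule conv_term_bound[OF a[OF that] b'[OF that]])
      moreover have "0 \<le> sqrt (A * B) * e p" using e0 nn by auto
      ultimately show ?thesis unfolding c_def distrib_right
        using norm_triangle_ineq[of "a' s p * b s (n - p)" "a s p * b' s (n - p)"] by linarith
    qed
    show "((\<lambda>t. a t p * b t (n - p)) has_vector_derivative
        a' s p * b s (n - p) + a s p * b' s (n - p)) (at s within S)" if "s \<in> S" for p s
      using has_vector_derivative_mult[OF da[OF that] db[OF that]] by (simp add: add.commute)
  qed
  moreover have "(\<Sum>\<^sub>\<infinity>p. a' t p * b t (n - p) + a t p * b' t (n - p))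
      = conv (a' t) (b t) n + conv (a t) (b' t) n"
    unfolding conv_def
    by (intro infsum_add conv_summable[OF k a'[OF t] b[OF t]] conv_summable[OF k a[OF t] b'[OF t]])
  ultimately show ?thesis unfolding conv_def by simp
qed

text \<open>A replacement for Minkowski's integral inequality. With \<open>X\<close> the weighted
  square sum of the integrals \<open>W\<close>, pairing \<open>W\<close> with its own integrand and
  Young's inequality with parameter \<open>t\<close> give
  \<open>X \<le> X / 2 + t\<^sup>2 * Q / 2\<close>, and half of \<open>X\<close> is absorbed. The
  parameter is a divisor, hence the separate case \<open>t = 0\<close>.\<close>

lemma coeff_bound_integral:
  fixes w :: "int ^ 'n \<Rightarrow> real \<Rightarrow> complex"
  assumes t: "0 \<le> t" and w: "\<And>n. w n integrable_on {0..t}"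
    and Q: "\<And>s. s \<in> {0..t} \<Longrightarrow> coeff_bound m (\<lambda>n. w n s) Q"
  shows "coeff_bound m (\<lambda>n. integral {0..t} (w n)) (t\<^sup>2 * Q)"
proof (cases "t = 0")
  case False
  then have t: "t > 0" using t by simp
  define W where "W n = integral {0..t} (w n)" for n
  have hw: "(w n has_integral W n) {0..t}" for n unfolding W_def using w by blast
  show ?thesis unfolding W_def[symmetric]
  proof (rule coeff_boundI)
    fix F :: "(int ^ 'n) set" assume F: "finite F"
    define X where "X = (\<Sum>n\<in>F. weight m n * (cmod (W n))\<^sup>2)"
    have i1: "((\<lambda>s. \<Sum>n\<in>F. weight m n * (W n \<bullet> w n s)) has_integral (\<Sum>n\<in>F. weight m n * (W n \<bullet> W n))) {0..t}"
      by (intro has_integral_sum has_integral_mult_right F)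
        (use has_integral_linear[OF hw bounded_linear_inner_right] in \<open>auto simp: o_def\<close>)
    have i2: "((\<lambda>s. X / (2 * t) + t * Q / 2) has_integral (X / 2 + t\<^sup>2 * Q / 2)) {0..t}"
      by (rule has_integral_eq_rhs[OF has_integral_const_real])
        (use t in \<open>simp add: field_simps power2_eq_square\<close>)
    have "(\<Sum>n\<in>F. weight m n * (W n \<bullet> W n)) \<le> X / 2 + t\<^sup>2 * Q / 2"
    proof (rule has_integral_le[OF i1 i2])
      fix s assume s: "s \<in> {0..t}"
      have pt: "W n \<bullet> w n s \<le> (cmod (W n))\<^sup>2 / (2 * t) + t * (cmod (w n s))\<^sup>2 / 2" for n
      proof -
        have "2 * t * (W n \<bullet> w n s) \<le> 2 * (cmod (W n) * (t * cmod (w n s)))"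
          using norm_cauchy_schwarz[of "W n" "w n s"] t by (simp add: mult_ac)
        also have "\<dots> \<le> (cmod (W n))\<^sup>2 + (t * cmod (w n s))\<^sup>2"
          using sum_squares_bound[of "cmod (W n)" "t * cmod (w n s)"] by simp
        finally show ?thesis using t by (simp add: field_simps power2_eq_square)
      qed
      have "(\<Sum>n\<in>F. weight m n * (W n \<bullet> w n s))
          \<le> (\<Sum>n\<in>F. weight m n * ((cmod (W n))\<^sup>2 / (2 * t) + t * (cmod (w n s))\<^sup>2 / 2))"
        by (intro sum_mono mult_left_mono pt weight_nonneg)
      also have "\<dots> = X / (2 * t) + t / 2 * (\<Sum>n\<in>F. weight m n * (cmod (w n s))\<^sup>2)"
        unfolding X_def by (simp add: sum_divide_distrib sum_distrib_left flip: sum.distrib)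
          (simp add: algebra_simps)
      also have "\<dots> \<le> X / (2 * t) + t * Q / 2"
        using mult_left_mono[OF coeff_boundD[OF Q[OF s] F], of "t / 2"] t by simp
      finally show "(\<Sum>n\<in>F. weight m n * (W n \<bullet> w n s)) \<le> X / (2 * t) + t * Q / 2" .
    qed
    then have "X \<le> X / 2 + t\<^sup>2 * Q / 2" by (simp add: X_def power2_norm_eq_inner)
    then show "(\<Sum>n\<in>F. weight m n * (cmod (W n))\<^sup>2) \<le> t\<^sup>2 * Q" by (simp add: X_def)
  qed
qed (auto simp: coeff_bound_def)

subsection \<open>Energy estimate for the heat equation in divergence form\<close>

text \<open>The dissipation absorbs the derivative in front of the source term, so that only its order
  zero norm enters.\<close>

lemma parabolic_estimate:
  fixes E :: "real \<Rightarrow> int ^ 'n::finite \<Rightarrow> complex" and h :: "'n \<Rightarrow> real \<Rightarrow> int ^ 'n \<Rightarrow> complex"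
  assumes der: "\<And>t n. t \<in> {0..T} \<Longrightarrow> ((\<lambda>t. E t n) has_vector_derivative
      (- of_real (freq_sq n) * E t n + \<i> * (\<Sum>j\<in>UNIV. of_int (n $ j) * h j t n))) (at t within {0..T})"
    and L: "L > 0"
    and hb: "\<And>t F. t \<in> {0..T} \<Longrightarrow> finite F \<Longrightarrow>
      (\<Sum>n\<in>F. weight m n * (\<Sum>j\<in>UNIV. (cmod (h j t n))\<^sup>2)) \<le> A * exp (L * t) + B"
    and A: "A \<ge> 0" and E0: "coeff_bound m (E 0) Q" and t: "t \<in> {0..T}"
  shows "coeff_bound m (E t) (Q + A / (2 * L) * exp (L * t) + B * t / 2)"
proof (rule coeff_boundI)
  fix F :: "(int ^ 'n) set" assume F: "finite F"
  define E' where "E' s n = - of_real (freq_sq n) * E s n + \<i> * (\<Sum>j\<in>UNIV. of_int (n $ j) * h j s n)" for s n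
  \<comment> \<open>The energy minus a primitive of half the assumed bound on the source. The
    estimate amounts to \<open>f\<close> being nonincreasing.\<close>
  define f where "f s = (\<Sum>n\<in>F. weight m n * (E s n \<bullet> E s n)) - A / (2 * L) * exp (L * s) - B * s / 2" for s
  define f' where "f' s = (\<Sum>n\<in>F. weight m n * (2 * (E s n \<bullet> E' s n))) - A / (2 * L) * (exp (L * s) * L) - B / 2" for s
  have dE: "((\<lambda>t. E t n) has_vector_derivative E' s n) (at s within {0..T})" if "s \<in> {0..T}" for s n
    unfolding E'_def by (rule der[OF that])
  have dEE: "((\<lambda>t. E t n \<bullet> E t n) has_real_derivative 2 * (E s n \<bullet> E' s n)) (at s within {0..T})"
    if "s \<in> {0..T}" for s n
  proof -
    have d: "((\<lambda>t. E t n) has_derivative (\<lambda>x. x *\<^sub>R E' s n)) (at s within {0..T})"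
      using dE[OF that, of n] by (simp add: has_vector_derivative_def)
    show ?thesis unfolding has_field_derivative_def
      by (rule has_derivative_eq_rhs[OF has_derivative_inner[OF d d]]) (auto simp: inner_commute)
  qed
  have df: "(f has_real_derivative f' s) (at s within {0..T})" if "s \<in> {0..T}" for s
    unfolding f_def f'_def using that
    by (auto intro!: derivative_eq_intros dEE simp: mult_ac)
  have pt: "2 * (E s n \<bullet> E' s n) \<le> (\<Sum>j\<in>UNIV. (cmod (h j s n))\<^sup>2) / 2" for s n
  proof -
    define H where "H = (\<Sum>j\<in>UNIV. (cmod (h j s n))\<^sup>2)"
    have H0: "H \<ge> 0" unfolding H_def by (intro sum_nonneg) auto
    define u where "u = sqrt (freq_sq n) * cmod (E s n)"
    define y where "y = (\<Sum>j\<in>UNIV. of_int (n $ j) * h j s n)"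
    have "cmod y \<le> (\<Sum>j\<in>UNIV. \<bar>real_of_int (n $ j)\<bar> * cmod (h j s n))"
      unfolding y_def by (rule order_trans[OF norm_sum]) (simp add: norm_mult)
    also have "\<dots> \<le> sqrt (freq_sq n * H)"
    proof (rule real_le_rsqrt)
      show "(\<Sum>j\<in>UNIV. \<bar>real_of_int (n $ j)\<bar> * cmod (h j s n))\<^sup>2 \<le> freq_sq n * H"
        using Cauchy_Schwarz_ineq_sum[of "\<lambda>j. \<bar>real_of_int (n $ j)\<bar>" "\<lambda>j. cmod (h j s n)" UNIV]
        by (simp add: H_def freq_sq_def)
    qed
    finally have y: "cmod y \<le> sqrt (freq_sq n) * sqrt H" by (simp add: real_sqrt_mult)
    have "E s n \<bullet> E' s n = - freq_sq n * (cmod (E s n))\<^sup>2 + E s n \<bullet> (\<i> * y)"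
      unfolding E'_def y_def[symmetric]
      by (simp add: inner_diff_right power2_norm_eq_inner scaleR_conv_of_real[symmetric])
    also have "E s n \<bullet> (\<i> * y) \<le> cmod (E s n) * cmod y"
      using norm_cauchy_schwarz[of "E s n" "\<i> * y"] by (simp add: norm_mult)
    also have "cmod (E s n) * cmod y \<le> cmod (E s n) * (sqrt (freq_sq n) * sqrt H)"
      using y by (intro mult_left_mono) auto
    finally have "E s n \<bullet> E' s n \<le> - u\<^sup>2 + u * sqrt H"
      by (simp add: u_def power_mult_distrib freq_sq_nonneg mult_ac)
    \<comment> \<open>Young's inequality with the constants for which the dissipation, twice
      \<open>u\<^sup>2\<close>, is used up completely, leaving half of \<open>H\<close>.\<close>
    moreover have "4 * (u * sqrt H) \<le> 4 * u\<^sup>2 + H"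
      using zero_le_power2[of "2 * u - sqrt H"] H0 by (simp add: power2_diff power_mult_distrib)
    ultimately show ?thesis unfolding H_def[symmetric] by linarith
  qed
  have f'0: "f' s \<le> 0" if s: "s \<in> {0..T}" for s
  proof -
    have "(\<Sum>n\<in>F. weight m n * (2 * (E s n \<bullet> E' s n)))
        \<le> (\<Sum>n\<in>F. weight m n * ((\<Sum>j\<in>UNIV. (cmod (h j s n))\<^sup>2) / 2))"
      by (intro sum_mono mult_left_mono pt weight_nonneg)
    also have "\<dots> = (\<Sum>n\<in>F. weight m n * (\<Sum>j\<in>UNIV. (cmod (h j s n))\<^sup>2)) / 2"
      unfolding sum_divide_distrib[of _ F] by (intro sum.cong refl) simp
    also have "\<dots> \<le> (A * exp (L * s) + B) / 2" using hb[OF s F] by simp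
    finally show ?thesis unfolding f'_def using L by (simp add: field_simps)
  qed
  have "f t \<le> f 0"
  proof (rule DERIV_nonpos_imp_decreasing_open[of 0 t f])
    show "0 \<le> t" using t by simp
    fix s assume s: "0 < s" "s < t"
    then have "(f has_real_derivative f' s) (at s)"
      using df[of s] t at_within_Icc_at[of 0 s T] by auto
    then show "\<exists>y. (f has_real_derivative y) (at s) \<and> y \<le> 0"
      using s f'0[of s] t by force
  next
    have "continuous_on {0..T} f"
      unfolding continuous_on_eq_continuous_within using DERIV_continuous[OF df] by blast
    then show "continuous_on {0..t} f" using t by (auto elim: continuous_on_subset)
  qed
  moreover have "f 0 \<le> Q"
  proof -
    have "f 0 = (\<Sum>n\<in>F. weight m n * (cmod (E 0 n))\<^sup>2) - A / (2 * L)"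
      by (simp add: f_def power2_norm_eq_inner)
    moreover have "0 \<le> A / (2 * L)" using A L by simp
    ultimately show ?thesis using coeff_boundD[OF E0 F] by linarith
  qed
  ultimately show "(\<Sum>n\<in>F. weight m n * (cmod (E t n))\<^sup>2) \<le> Q + A / (2 * L) * exp (L * t) + B * t / 2"
    by (simp add: f_def power2_norm_eq_inner)
qed

text \<open>A Gronwall argument: with respect to the norm \<open>sup\<^sub>t exp (- 2 A t) |D t|\<^sup>2\<close> the estimate above
  is a contraction, so iterating it removes the a priori bound \<open>M\<close> from the conclusion.\<close>

lemma parabolic_gronwall:
  fixes D E :: "real \<Rightarrow> int ^ 'n::finite \<Rightarrow> complex" and h :: "'n \<Rightarrow> real \<Rightarrow> int ^ 'n \<Rightarrow> complex"
  assumes der: "\<And>t n. t \<in> {0..T} \<Longrightarrow> ((\<lambda>t. E t n) has_vector_derivative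
      (- of_real (freq_sq n) * E t n + \<i> * (\<Sum>j\<in>UNIV. of_int (n $ j) * h j t n))) (at t within {0..T})"
    and A: "A > 0" and B: "B \<ge> 0" and G: "G \<ge> 0"
    and hb: "\<And>t Q j. t \<in> {0..T} \<Longrightarrow> coeff_bound m (D t) Q \<Longrightarrow>
      coeff_bound m (h j t) ((A * Q + B) / real CARD('n))"
    and ED: "\<And>t Q. t \<in> {0..T} \<Longrightarrow> coeff_bound m (E t) Q \<Longrightarrow> coeff_bound m (D t) (2 * Q + G)"
    and E0: "coeff_bound m (E 0) Q" and M: "\<And>t. t \<in> {0..T} \<Longrightarrow> coeff_bound m (D t) M" and t: "t \<in> {0..T}"
  shows "coeff_bound m (D t) (2 * (2 * Q + B * T + G) * exp (2 * A * t))"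
proof -
  define K where "K = 2 * Q + B * T + G"
  have K: "K \<ge> 0" using coeff_bound_nonneg[OF E0] B G t by (simp add: K_def)
  \<comment> \<open>The rate \<open>2 * A\<close> in the exponential turns the source
    \<open>A * N\<close> into \<open>N / 4\<close> in the estimate for \<open>E\<close>; passing
    from \<open>E\<close> to \<open>D\<close> doubles it to \<open>N / 2\<close>, so one pass still
    halves \<open>N\<close>.\<close>
  have step: "coeff_bound m (D t) ((N / 2 + K) * exp (2 * A * t))"
    if N: "\<And>t. t \<in> {0..T} \<Longrightarrow> coeff_bound m (D t) (N * exp (2 * A * t))" and N0: "N \<ge> 0"
      and t: "t \<in> {0..T}" for N t
  proof -
    have "(\<Sum>n\<in>F. weight m n * (\<Sum>j\<in>UNIV. (cmod (h j s n))\<^sup>2)) \<le> (A * N) * exp (2 * A * s) + B"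
      if s: "s \<in> {0..T}" and F: "finite F" for s F
    proof -
      have "(\<Sum>n\<in>F. weight m n * (\<Sum>j\<in>UNIV. (cmod (h j s n))\<^sup>2))
          = (\<Sum>j\<in>UNIV. \<Sum>n\<in>F. weight m n * (cmod (h j s n))\<^sup>2)"
        by (subst sum.swap) (simp add: sum_distrib_left)
      also have "\<dots> \<le> (\<Sum>j\<in>(UNIV :: 'n set). (A * (N * exp (2 * A * s)) + B) / real CARD('n))"
        by (intro sum_mono coeff_boundD[OF hb[OF s N[OF s]] F])
      finally show ?thesis by (simp add: mult_ac)
    qed
    from parabolic_estimate[OF der _ this _ E0 t] A N0
    have "coeff_bound m (E t) (Q + A * N / (2 * (2 * A)) * exp (2 * A * t) + B * t / 2)" by simp
    from ED[OF t this] have "coeff_bound m (D t) (N / 2 * exp (2 * A * t) + (2 * Q + B * t + G))"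
      using A by (simp add: algebra_simps)
    moreover have "2 * Q + B * t + G \<le> K * exp (2 * A * t)"
    proof -
      have "2 * Q + B * t + G \<le> K * 1" using B t by (simp add: K_def mult_left_mono)
      also have "\<dots> \<le> K * exp (2 * A * t)" using K A t by (intro mult_left_mono) auto
      finally show ?thesis .
    qed
    ultimately show ?thesis by (elim coeff_bound_mono) (auto simp: algebra_simps)
  qed
  have M0: "M \<ge> 0" using M[OF t] coeff_bound_nonneg by blast
  \<comment> \<open>\<open>2 * K\<close> is the fixed point of the map from \<open>N\<close> to
    \<open>N / 2 + K\<close>, and the distance to it is halved at each pass.\<close>
  have iter: "\<forall>t\<in>{0..T}. coeff_bound m (D t) ((M / 2 ^ i + 2 * K) * exp (2 * A * t))" for i
  proof (induction i)
    case 0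
    show ?case
    proof
      fix t assume t: "t \<in> {0..T}"
      have "M * 1 \<le> (M + 2 * K) * exp (2 * A * t)" using M0 K A t by (intro mult_mono) auto
      then show "coeff_bound m (D t) ((M / 2 ^ 0 + 2 * K) * exp (2 * A * t))"
        using coeff_bound_mono[OF M[OF t], of m] by simp
    qed
  next
    case (Suc i)
    have "(M / 2 ^ i + 2 * K) / 2 + K = M / 2 ^ Suc i + 2 * K" by (simp add: field_simps)
    moreover have "M / 2 ^ i + 2 * K \<ge> 0" using M0 K by simp
    ultimately show ?case using step[of "M / 2 ^ i + 2 * K"] Suc by metis
  qed
  show ?thesis unfolding K_def[symmetric]
  proof (rule coeff_boundI)
    fix F :: "(int ^ 'n) set" assume F: "finite F"
    have l: "(\<lambda>i. (M / 2 ^ i + 2 * K) * exp (2 * A * t)) \<longlonglongrightarrow> (0 + 2 * K) * exp (2 * A * t)"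
      by (intro tendsto_intros LIMSEQ_divide_realpow_zero) auto
    have "(\<Sum>n\<in>F. weight m n * (cmod (D t n))\<^sup>2) \<le> (0 + 2 * K) * exp (2 * A * t)"
      by (rule LIMSEQ_le_const[OF l]) (use iter t coeff_boundD[OF _ F] in blast)
    then show "(\<Sum>n\<in>F. weight m n * (cmod (D t n))\<^sup>2) \<le> 2 * K * exp (2 * A * t)" by simp
  qed
qed

subsection \<open>Stability of the Fourier coefficients\<close>

text \<open>The Gronwall argument with \<open>D = E = p\<close> and no additional source. It
  exchanges the uncontrolled bound \<open>M\<close> for one in terms of \<open>R\<close>; the
  algebra property gives the source, which is linear in the bound on \<open>p\<close>.\<close>

lemma coeff_advection_bound:
  fixes p :: "real \<Rightarrow> int ^ 'n::finite \<Rightarrow> complex" and q :: "'n \<Rightarrow> real \<Rightarrow> int ^ 'n \<Rightarrow> complex"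
  assumes C: "C > 0" "\<And>a b A B. coeff_bound m a A \<Longrightarrow> coeff_bound m b B \<Longrightarrow>
      coeff_bound m (conv a (b :: int ^ 'n \<Rightarrow> complex)) (C * A * B)"
    and R: "R > 0"
    and q: "\<And>t j. t \<in> {0..T} \<Longrightarrow> coeff_bound m (q j t) (R\<^sup>2)"
    and p: "\<And>t. t \<in> {0..T} \<Longrightarrow> coeff_bound m (p t) M" and p0: "coeff_bound m (p 0) (R\<^sup>2)"
    and der: "\<And>t n. t \<in> {0..T} \<Longrightarrow> ((\<lambda>t. p t n) has_vector_derivative
      (- of_real (freq_sq n) * p t n - \<i> * (\<Sum>j\<in>UNIV. of_int (n $ j) * conv (q j t) (p t) n)))
      (at t within {0..T})"
    and t: "t \<in> {0..T}"
  shows "coeff_bound m (p t) (4 * R\<^sup>2 * exp (2 * (real CARD('n) * C * R\<^sup>2) * T))"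
proof -
  define d where "d = real CARD('n)"
  have d: "d > 0" by (simp add: d_def)
  have "coeff_bound m (p t) (2 * (2 * R\<^sup>2 + 0 * T + 0) * exp (2 * (d * C * R\<^sup>2) * t))"
  proof (rule parabolic_gronwall[where E = p and M = M and h = "\<lambda>j t n. - conv (q j t) (p t) n"])
    show "((\<lambda>t. p t n) has_vector_derivative
        - of_real (freq_sq n) * p t n + \<i> * (\<Sum>j\<in>UNIV. of_int (n $ j) * - conv (q j t) (p t) n))
        (at t within {0..T})" if "t \<in> {0..T}" for t n
      using der[OF that, of n] by (simp add: sum_negf)
    show "coeff_bound m (\<lambda>n. - conv (q j t) (p t) n) ((d * C * R\<^sup>2 * Q + 0) / real CARD('n))"
      if "t \<in> {0..T}" "coeff_bound m (p t) Q" for t Q j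
      using coeff_bound_uminus[OF C(2)[OF q[OF that(1)] that(2)]] d by (simp add: d_def mult.assoc)
    show "coeff_bound m (p t) (2 * Q + 0)" if "coeff_bound m (p t) Q" for t Q
      using that coeff_bound_nonneg[OF that] by (auto elim: coeff_bound_mono)
  qed (use C R d p p0 t in auto)
  then show ?thesis
    by (rule coeff_bound_mono) (use C R d t in \<open>auto simp: d_def\<close>)
qed

definition coeff_velocity :: "nat \<Rightarrow> real \<Rightarrow> real \<Rightarrow> ('n::finite \<Rightarrow> real \<Rightarrow> int ^ 'n \<Rightarrow> complex) \<Rightarrow> bool" where
  "coeff_velocity k T R q \<longleftrightarrow> (\<forall>t\<in>{0..T}. \<forall>j. coeff_bound (k + 2) (q j t) (R\<^sup>2)) \<and>
    (\<forall>j n. continuous_on {0..T} (\<lambda>t. q j t n)) \<and>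
    (\<forall>t\<in>{0..T}. \<forall>n. (\<Sum>j\<in>UNIV. of_int (n $ j) * q j t n) = 0)"

text \<open>The advection term is in conservative form, so it has the shape of the sources of
  \<open>parabolic_estimate\<close> and no derivative falls on \<open>p\<close>.\<close>

definition coeff_solution ::
  "real \<Rightarrow> ('n::finite \<Rightarrow> real \<Rightarrow> int ^ 'n \<Rightarrow> complex) \<Rightarrow> (real \<Rightarrow> int ^ 'n \<Rightarrow> complex) \<Rightarrow> bool" where
  "coeff_solution T q p \<longleftrightarrow> (\<forall>t\<in>{0..T}. \<forall>n. ((\<lambda>t. p t n) has_vector_derivative
    (- of_real (freq_sq n) * p t n - \<i> * (\<Sum>j\<in>UNIV. of_int (n $ j) * conv (q j t) (p t) n)))
    (at t within {0..T}))"

text \<open>With \<open>D = p1 - p2\<close>, \<open>w = q1 - q2\<close> and \<open>W = \<integral> w\<close>, the equation for \<open>D\<close> contains the divergence of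
  \<open>w p2\<close>, which is not small in \<open>W\<close>.  Since \<open>w p2 = (W p2)' - W p2'\<close>, the function
  \<open>E = D + div (W p2)\<close> solves an equation whose sources contain \<open>W\<close> only, up to the term \<open>\<Delta> div (W p2)\<close>.
  After one derivative is absorbed by the dissipation, the latter costs the norm of \<open>W\<close> of order \<open>k + 1\<close>, and
  interpolation between the orders \<open>k\<close> and \<open>k + 2\<close> yields the exponent one half.\<close>

theorem coeff_stability:
  assumes k: "real k > real CARD('n::finite) / 2" and T: "T > 0" and R: "R > 0"
  shows "\<exists>C>0. \<forall>p1 p2 (q1 :: 'n \<Rightarrow> real \<Rightarrow> int ^ 'n \<Rightarrow> complex) q2 M \<delta>.
    coeff_velocity k T R q1 \<longrightarrow> coeff_velocity k T R q2 \<longrightarrow>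
    coeff_solution T q1 p1 \<longrightarrow> coeff_solution T q2 p2 \<longrightarrow>
    (\<forall>t\<in>{0..T}. coeff_bound (k + 2) (p1 t) M) \<longrightarrow> (\<forall>t\<in>{0..T}. coeff_bound (k + 2) (p2 t) M) \<longrightarrow>
    coeff_bound (k + 2) (p2 0) (R\<^sup>2) \<longrightarrow> p1 0 = p2 0 \<longrightarrow> \<delta> \<ge> 0 \<longrightarrow>
    (\<forall>t\<in>{0..T}. \<forall>j. coeff_bound k (\<lambda>n. integral {0..t} (\<lambda>s. q1 j s n - q2 j s n)) (\<delta>\<^sup>2)) \<longrightarrow>
    (\<forall>t\<in>{0..T}. coeff_bound k (\<lambda>n. p1 t n - p2 t n) (C * \<delta>))"
proof -
  have k1: "real (Suc k) > real CARD('n) / 2" and k2: "real (k + 2) > real CARD('n) / 2" using k by auto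
  obtain C0 where C0: "C0 > 0" "\<And>(a :: int ^ 'n \<Rightarrow> complex) b A B.
    coeff_bound k a A \<Longrightarrow> coeff_bound k b B \<Longrightarrow> coeff_bound k (conv a b) (C0 * A * B)"
    using conv_coeff_bound[OF k] by blast
  obtain C1 where C1: "C1 > 0" "\<And>(a :: int ^ 'n \<Rightarrow> complex) b A B.
    coeff_bound (Suc k) a A \<Longrightarrow> coeff_bound (Suc k) b B \<Longrightarrow> coeff_bound (Suc k) (conv a b) (C1 * A * B)"
    using conv_coeff_bound[OF k1] by blast
  obtain C2 where C2: "C2 > 0" "\<And>(a :: int ^ 'n \<Rightarrow> complex) b A B.
    coeff_bound (k + 2) a A \<Longrightarrow> coeff_bound (k + 2) b B \<Longrightarrow> coeff_bound (k + 2) (conv a b) (C2 * A * B)"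
    using conv_coeff_bound[OF k2] by blast
  define d where "d = real CARD('n)"
  have d: "d > 0" by (simp add: d_def)
  \<comment> \<open>\<open>P\<close> will bound the second solution at order \<open>k + 2\<close>,
    by \<open>coeff_advection_bound\<close>, and \<open>P'\<close> its time derivative at order
    \<open>k\<close>, two orders being lost to the Laplacian.\<close>
  define P where "P = 4 * R\<^sup>2 * exp (2 * (d * C2 * R\<^sup>2) * T)"
  have P: "P > 0" using R by (simp add: P_def)
  define P' where "P' = 2 * (P + d * (d * (C2 * R\<^sup>2 * P)))"
  have P': "P' > 0" using P d C2 R by (auto simp: P'_def intro!: add_pos_pos mult_pos_pos)
  define g where "g = d * (d * (C1 * (real k + 2) * P))"
  have g: "g > 0" using P d C1 by (simp add: g_def)
  \<comment> \<open>\<open>A\<close> and \<open>b\<close> collect the coefficients of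
    \<open>Q\<close> and of \<open>\<omega>\<close> in the estimate of the source \<open>h\<close>;
    the factor \<open>d\<close> compensates the division by the dimension in
    \<open>parabolic_gronwall\<close>.\<close>
  define A where "A = 4 * d * C0 * R\<^sup>2"
  have A: "A > 0" using d C0 R by (simp add: A_def)
  define b where "b = d * (4 * g + 2 * C0 * P')"
  have b: "b > 0" unfolding b_def using d g C0 P' by (intro mult_pos_pos add_pos_pos) auto
  \<comment> \<open>The Gronwall bound for initial value 0 at time \<open>T\<close>, with
    \<open>\<omega> = 2 * R * T * \<delta>\<close> inserted.\<close>
  define C where "C = 2 * (b * T + 2 * g) * exp (2 * A * T) * (2 * R * T)"
  have C: "C > 0" unfolding C_def using b T g R by (intro mult_pos_pos add_pos_pos) auto
  have main: "coeff_bound k (\<lambda>n. p1 t n - p2 t n) (C * \<delta>)"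
    if q1: "\<And>t j. t \<in> {0..T} \<Longrightarrow> coeff_bound (k + 2) (q1 j t) (R\<^sup>2)"
      and q2: "\<And>t j. t \<in> {0..T} \<Longrightarrow> coeff_bound (k + 2) (q2 j t) (R\<^sup>2)"
      and cq1: "\<And>j n. continuous_on {0..T} (\<lambda>t. q1 j t n)"
      and cq2: "\<And>j n. continuous_on {0..T} (\<lambda>t. q2 j t n)"
      and div1: "\<And>t n. t \<in> {0..T} \<Longrightarrow> (\<Sum>j\<in>UNIV. of_int (n $ j) * q1 j t n) = 0"
      and div2: "\<And>t n. t \<in> {0..T} \<Longrightarrow> (\<Sum>j\<in>UNIV. of_int (n $ j) * q2 j t n) = 0"
      and p1: "\<And>t. t \<in> {0..T} \<Longrightarrow> coeff_bound (k + 2) (p1 t) M"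
      and p2: "\<And>t. t \<in> {0..T} \<Longrightarrow> coeff_bound (k + 2) (p2 t) M"
      and p20: "coeff_bound (k + 2) (p2 0) (R\<^sup>2)" and p120: "p1 0 = p2 0"
      and dp1: "\<And>t n. t \<in> {0..T} \<Longrightarrow> ((\<lambda>t. p1 t n) has_vector_derivative
        (- of_real (freq_sq n) * p1 t n - \<i> * (\<Sum>j\<in>UNIV. of_int (n $ j) * conv (q1 j t) (p1 t) n)))
        (at t within {0..T})"
      and dp2: "\<And>t n. t \<in> {0..T} \<Longrightarrow> ((\<lambda>t. p2 t n) has_vector_derivative
        (- of_real (freq_sq n) * p2 t n - \<i> * (\<Sum>j\<in>UNIV. of_int (n $ j) * conv (q2 j t) (p2 t) n)))
        (at t within {0..T})"
      and \<delta>: "\<delta> \<ge> 0"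
      and W\<delta>: "\<And>t j. t \<in> {0..T} \<Longrightarrow>
        coeff_bound k (\<lambda>n. integral {0..t} (\<lambda>s. q1 j s n - q2 j s n)) (\<delta>\<^sup>2)"
      and t: "t \<in> {0..T}"
    for p1 p2 :: "real \<Rightarrow> int ^ 'n \<Rightarrow> complex" and q1 q2 :: "'n \<Rightarrow> real \<Rightarrow> int ^ 'n \<Rightarrow> complex" and M \<delta> t
  proof -
    define w where "w j t n = q1 j t n - q2 j t n" for j t n
    define W where "W j t n = integral {0..t} (\<lambda>s. w j s n)" for j t n
    \<comment> \<open>The geometric mean of the two bounds on squares of \<open>W\<close>:
      \<open>\<delta>\<^sup>2\<close> at order \<open>k\<close> and
      \<open>(2 * R * T)\<^sup>2\<close> at order \<open>k + 2\<close>. It is linear in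
      \<open>\<delta>\<close>.\<close>
    define \<omega> where "\<omega> = 2 * R * T * \<delta>"
    have \<omega>: "\<omega> \<ge> 0" using R T \<delta> by (simp add: \<omega>_def)
    have cw: "continuous_on {0..T} (\<lambda>t. w j t n)" for j n
      unfolding w_def by (intro continuous_intros cq1 cq2)
    have w: "coeff_bound (k + 2) (w j t) (4 * R\<^sup>2)" if "t \<in> {0..T}" for j t
      using coeff_bound_diff[OF q1[OF that] q2[OF that], of j j] by (simp add: w_def[abs_def])
    have W2: "coeff_bound (k + 2) (W j t) (4 * R\<^sup>2 * T\<^sup>2)" if t: "t \<in> {0..T}" for j t
    proof -
      have "coeff_bound (k + 2) (\<lambda>n. integral {0..t} (\<lambda>s. w j s n)) (t\<^sup>2 * (4 * R\<^sup>2))"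
        using t w by (intro coeff_bound_integral integrable_continuous_real continuous_on_subset[OF cw]) auto
      then show ?thesis unfolding W_def[abs_def]
        using t by (elim coeff_bound_mono) (auto simp: mult.commute intro!: mult_left_mono power_mono)
    qed
    have W0: "coeff_bound k (W j t) (\<delta>\<^sup>2)" if t: "t \<in> {0..T}" for j t
      using W\<delta>[OF t, of j] by (simp add: W_def[abs_def] w_def)
    \<comment> \<open>Nothing says that \<open>\<delta>\<close> is small. For
      \<open>\<delta>\<close> above \<open>2 * R * T\<close> the bound of order \<open>k + 2\<close>
      is already below \<open>\<omega>\<close>.\<close>
    have Wk: "coeff_bound k (W j t) \<omega>" if t: "t \<in> {0..T}" for j t
    proof (cases "\<delta> \<le> 2 * R * T")
      case True
      have "\<delta>\<^sup>2 \<le> \<omega>" unfolding \<omega>_def power2_eq_square using \<delta> True by (intro mult_right_mono)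
      then show ?thesis by (intro coeff_bound_mono[OF W0[OF t]]) auto
    next
      case False
      have "4 * R\<^sup>2 * T\<^sup>2 = 2 * R * T * (2 * R * T)" by (simp add: power2_eq_square)
      also have "\<dots> \<le> \<omega>" unfolding \<omega>_def using False R T by (intro mult_left_mono) auto
      finally show ?thesis by (intro coeff_bound_mono[OF W2[OF t]]) auto
    qed
    have W1: "coeff_bound (Suc k) (W j t) ((real k + 2) * \<omega>)" if t: "t \<in> {0..T}" for j t
    proof -
      have "sqrt (\<delta>\<^sup>2 * (4 * R\<^sup>2 * T\<^sup>2)) = \<omega>"
        using R T \<delta> by (simp add: \<omega>_def real_sqrt_mult)
      then show ?thesis using coeff_bound_interpolation[OF W0[OF t] W2[OF t]] by simp
    qed
    have divW: "(\<Sum>j\<in>UNIV. of_int (n $ j) * W j t n) = 0" if t: "t \<in> {0..T}" for t n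
    proof -
      have int: "(\<lambda>s. w j s n) integrable_on {0..t}" for j
        using t by (intro integrable_continuous_real continuous_on_subset[OF cw]) auto
      have "(\<Sum>j\<in>UNIV. of_int (n $ j) * W j t n) = integral {0..t} (\<lambda>s. \<Sum>j\<in>UNIV. of_int (n $ j) * w j s n)"
        unfolding W_def by (subst integral_sum) (auto intro!: integrable_on_mult_right int)
      also have "\<dots> = integral {0..t} (\<lambda>s. 0)"
      proof (rule integral_cong)
        fix s assume "s \<in> {0..t}"
        then have s: "s \<in> {0..T}" using t by auto
        show "(\<Sum>j\<in>UNIV. of_int (n $ j) * w j s n) = 0"
          using div1[OF s, of n] div2[OF s, of n] by (simp add: w_def right_diff_distrib sum_subtractf)
      qed
      finally show ?thesis by simp
    qed
    have dW: "((\<lambda>t. W j t n) has_vector_derivative w j t n) (at t within {0..T})" if "t \<in> {0..T}" for j t n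
      unfolding W_def by (rule integral_has_vector_derivative[OF cw that])
    have pP: "coeff_bound (k + 2) (p2 t) P" if "t \<in> {0..T}" for t
      unfolding P_def d_def
      by (rule coeff_advection_bound[OF C2 R q2 p2 p20 dp2 that])
    define p' where "p' t n = - of_real (freq_sq n) * p2 t n
        - \<i> * (\<Sum>j\<in>UNIV. of_int (n $ j) * conv (q2 j t) (p2 t) n)" for t n
    have dp2': "((\<lambda>t. p2 t n) has_vector_derivative p' t n) (at t within {0..T})" if "t \<in> {0..T}" for t n
      unfolding p'_def by (rule dp2[OF that])
    have p': "coeff_bound k (p' t) P'" if t: "t \<in> {0..T}" for t
    proof -
      have "coeff_bound k (\<lambda>n. - of_real (freq_sq n) * p2 t n) (1 * P)"
      proof (rule coeff_bound_le[OF pP[OF t]])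
        fix n :: "int ^ 'n"
        have "weight k n * (freq_sq n)\<^sup>2 \<le> freq_sq n * weight (Suc k) n"
          using mult_left_mono[OF freq_sq_weight_le[of n k] freq_sq_nonneg[of n]]
          by (simp add: power2_eq_square mult_ac)
        also have "\<dots> \<le> weight (k + 2) n" using freq_sq_weight_le[of n "Suc k"] by simp
        finally show "weight k n * (cmod (- of_real (freq_sq n) * p2 t n))\<^sup>2
            \<le> 1 * (weight (k + 2) n * (cmod (p2 t n))\<^sup>2)"
          using mult_right_mono[of "weight k n * (freq_sq n)\<^sup>2" "weight (k + 2) n" "(cmod (p2 t n))\<^sup>2"]
          by (simp add: norm_mult power_mult_distrib mult_ac)
      qed auto
      moreover have "coeff_bound k (\<lambda>n. \<i> * (\<Sum>j\<in>UNIV. of_int (n $ j) * conv (q2 j t) (p2 t) n))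
          ((cmod \<i>)\<^sup>2 * (real (card (UNIV :: 'n set)) * (\<Sum>j\<in>(UNIV :: 'n set). C2 * R\<^sup>2 * P)))"
        by (intro coeff_bound_cmult coeff_bound_sum coeff_bound_coord finite_class.finite_UNIV
            coeff_bound_mono[OF C2(2)[OF q2[OF t] pP[OF t]]]) auto
      ultimately show ?thesis
        using coeff_bound_diff[of k _ "1 * P"] by (auto simp: p'_def[abs_def] P'_def d_def)
    qed
    define G where "G t n = (\<Sum>j\<in>UNIV. of_int (n $ j) * conv (W j t) (p2 t) n)" for t n
    have G1: "coeff_bound (Suc k) (G t) (g * \<omega>)" if t: "t \<in> {0..T}" for t
    proof -
      \<comment> \<open>Since \<open>W\<close> is divergence-free, the derivative can be moved onto
        \<open>p2\<close>, which is bounded at order \<open>k + 2\<close>. Hence order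
        \<open>k + 1\<close> of \<open>W\<close> suffices; in conservative form order
        \<open>k + 2\<close> would be needed, where \<open>W\<close> is bounded but not
        small.\<close>
      have "G t = (\<lambda>n. \<Sum>j\<in>UNIV. conv (W j t) (\<lambda>m. of_int (m $ j) * p2 t m) n)"
        unfolding G_def[abs_def]
        by (rule ext, rule conv_divergence_free[OF k Wk[OF t] coeff_bound_mono[OF pP[OF t]] divW[OF t], symmetric]) auto
      moreover have "coeff_bound (Suc k) (\<lambda>n. \<Sum>j\<in>UNIV. conv (W j t) (\<lambda>m. of_int (m $ j) * p2 t m) n)
          (real (card (UNIV :: 'n set)) * (\<Sum>j\<in>(UNIV :: 'n set). C1 * ((real k + 2) * \<omega>) * P))"
        using pP[OF t] by (intro coeff_bound_sum C1(2) W1[OF t] coeff_bound_coord) auto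
      ultimately show ?thesis by (simp add: g_def d_def mult_ac)
    qed
    have G0: "coeff_bound k (G t) (g * \<omega>)" if t: "t \<in> {0..T}" for t
      by (rule coeff_bound_mono[OF G1[OF t]]) auto
    define D where "D t n = p1 t n - p2 t n" for t n
    define E where "E t n = D t n + \<i> * G t n" for t n
    \<comment> \<open>The first term undoes the Laplacian of the correction contained in
      \<open>E\<close>, the second is the advection of the difference, the third is what remains of
      the time derivative of the correction.\<close>
    define h where "h j t n = of_int (n $ j) * G t n - conv (q1 j t) (D t) n + conv (W j t) (p' t) n" for j t n
    have q1k: "coeff_bound k (q1 j t) (R\<^sup>2)" and q2k: "coeff_bound k (q2 j t) (R\<^sup>2)"
      and wk: "coeff_bound k (w j t) (4 * R\<^sup>2)"
      and p1k: "coeff_bound k (p1 t) M" and p2k: "coeff_bound k (p2 t) P" if t: "t \<in> {0..T}" for j t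
      using coeff_bound_mono[OF q1[OF t, of j], of k] coeff_bound_mono[OF q2[OF t, of j], of k]
        coeff_bound_mono[OF w[OF t, of j], of k] coeff_bound_mono[OF p1[OF t], of k]
        coeff_bound_mono[OF pP[OF t], of k] by auto
    have Dk: "coeff_bound k (D t) (2 * (M + P))" if t: "t \<in> {0..T}" for t
      unfolding D_def[abs_def] by (rule coeff_bound_diff[OF p1k[OF t] p2k[OF t]])
    have dE: "((\<lambda>t. E t n) has_vector_derivative
        (- of_real (freq_sq n) * E t n + \<i> * (\<Sum>j\<in>UNIV. of_int (n $ j) * h j t n))) (at t within {0..T})"
      if t: "t \<in> {0..T}" for t n
    proof -
      have dc: "((\<lambda>t. conv (W j t) (p2 t) n) has_vector_derivative
          conv (w j t) (p2 t) n + conv (W j t) (p' t) n) (at t within {0..T})" for j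
        by (rule conv_has_vector_derivative[OF k _ t Wk p2k wk p' dW dp2']) auto
      have cv: "conv (q1 j t) (p1 t) n - conv (q2 j t) (p2 t) n = conv (q1 j t) (D t) n + conv (w j t) (p2 t) n" for j
        unfolding D_def[abs_def] w_def[abs_def]
        using conv_diff_right[OF k q1k[OF t] p1k[OF t] p2k[OF t]]
          conv_diff_left[OF k q1k[OF t] q2k[OF t] p2k[OF t]] by simp
      have "((\<lambda>t. E t n) has_vector_derivative
          ((- of_real (freq_sq n) * p1 t n - \<i> * (\<Sum>j\<in>UNIV. of_int (n $ j) * conv (q1 j t) (p1 t) n)) - p' t n)
          + \<i> * (\<Sum>j\<in>UNIV. of_int (n $ j) * (conv (w j t) (p2 t) n + conv (W j t) (p' t) n)))
          (at t within {0..T})"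
        unfolding E_def D_def G_def
        by (intro has_vector_derivative_add has_vector_derivative_diff dp1[OF t] dp2'[OF t]
            has_vector_derivative_mult_right has_vector_derivative_sum dc)
      \<comment> \<open>The terms with \<open>conv (w j t) (p2 t)\<close> cancel: one comes from the
        difference of the two equations, the other from the derivative of \<open>W\<close> inside
        \<open>G\<close>.\<close>
      moreover have "((- of_real (freq_sq n) * p1 t n - \<i> * (\<Sum>j\<in>UNIV. of_int (n $ j) * conv (q1 j t) (p1 t) n)) - p' t n)
          + \<i> * (\<Sum>j\<in>UNIV. of_int (n $ j) * (conv (w j t) (p2 t) n + conv (W j t) (p' t) n))
          = - of_real (freq_sq n) * E t n + \<i> * (\<Sum>j\<in>UNIV. of_int (n $ j) * h j t n)"
      proof -
        have fG: "of_real (freq_sq n) * G t n = (\<Sum>j\<in>UNIV. of_int (n $ j) * (of_int (n $ j) * G t n))"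
          by (simp add: freq_sq_def sum_distrib_right power2_eq_square mult.assoc)
        have "(\<Sum>j\<in>UNIV. of_int (n $ j) * h j t n) = of_real (freq_sq n) * G t n
            - (\<Sum>j\<in>UNIV. of_int (n $ j) * conv (q1 j t) (D t) n) + (\<Sum>j\<in>UNIV. of_int (n $ j) * conv (W j t) (p' t) n)"
          unfolding fG h_def by (simp add: ring_distribs sum.distrib sum_subtractf)
        moreover have "(\<Sum>j\<in>UNIV. of_int (n $ j) * conv (q1 j t) (p1 t) n)
            = (\<Sum>j\<in>UNIV. of_int (n $ j) * conv (q2 j t) (p2 t) n)
            + (\<Sum>j\<in>UNIV. of_int (n $ j) * conv (q1 j t) (D t) n) + (\<Sum>j\<in>UNIV. of_int (n $ j) * conv (w j t) (p2 t) n)"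
        proof -
          have "conv (q1 j t) (p1 t) n
              = conv (q2 j t) (p2 t) n + conv (q1 j t) (D t) n + conv (w j t) (p2 t) n" for j
            using cv[of j] by (simp add: algebra_simps)
          then show ?thesis by (simp only: ring_distribs sum.distrib)
        qed
        ultimately show ?thesis
          by (simp add: p'_def E_def D_def ring_distribs sum.distrib)
      qed
      ultimately show ?thesis by simp
    qed
    have hb: "coeff_bound k (h j t) ((A * Q + b * \<omega>) / real CARD('n))"
      if t: "t \<in> {0..T}" and Q: "coeff_bound k (D t) Q" for t Q j
    proof -
      have "coeff_bound k (\<lambda>n. of_int (n $ j) * G t n - conv (q1 j t) (D t) n + conv (W j t) (p' t) n)
          (2 * (2 * (g * \<omega> + C0 * R\<^sup>2 * Q) + C0 * \<omega> * P'))"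
        by (intro coeff_bound_add coeff_bound_diff coeff_bound_coord G1[OF t] C0(2) q1k[OF t] Q Wk[OF t] p'[OF t])
      moreover have "2 * (2 * (g * \<omega> + C0 * R\<^sup>2 * Q) + C0 * \<omega> * P') = (A * Q + b * \<omega>) / real CARD('n)"
        using d by (simp add: A_def b_def d_def field_simps)
      ultimately show ?thesis by (simp add: h_def[abs_def])
    qed
    have ED: "coeff_bound k (D t) (2 * Q + 2 * (g * \<omega>))" if t: "t \<in> {0..T}" and Q: "coeff_bound k (E t) Q" for t Q
    proof -
      have "coeff_bound k (\<lambda>n. E t n - \<i> * G t n) (2 * (Q + (cmod \<i>)\<^sup>2 * (g * \<omega>)))"
        by (intro coeff_bound_diff Q coeff_bound_cmult G0[OF t])
      then show ?thesis by (simp add: E_def)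
    qed
    have E0: "coeff_bound k (E 0) 0"
    proof -
      have "W j 0 = (\<lambda>n. 0)" for j by (auto simp: W_def)
      then have "E 0 = (\<lambda>n. 0)" by (auto simp: E_def D_def G_def conv_def p120)
      then show ?thesis by (simp add: coeff_bound_def)
    qed
    \<comment> \<open>\<open>E\<close> vanishes at time 0, because the solutions agree there and
      \<open>W\<close> is an integral over a point; every remaining contribution is a multiple of
      \<open>\<omega>\<close>.\<close>
    have "coeff_bound k (D t) (2 * (2 * 0 + b * \<omega> * T + 2 * (g * \<omega>)) * exp (2 * A * t))"
      by (rule parabolic_gronwall[OF dE A _ _ hb ED E0 Dk t]) (use b g \<omega> in auto)
    then show ?thesis unfolding D_def[abs_def]
    proof (rule coeff_bound_mono)
      have "2 * (2 * 0 + b * \<omega> * T + 2 * (g * \<omega>)) * exp (2 * A * t)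
          \<le> 2 * (2 * 0 + b * \<omega> * T + 2 * (g * \<omega>)) * exp (2 * A * T)"
        using A t T b g \<omega> by (intro mult_left_mono) auto
      also have "\<dots> = C * \<delta>" by (simp add: C_def \<omega>_def algebra_simps)
      finally show "2 * (2 * 0 + b * \<omega> * T + 2 * (g * \<omega>)) * exp (2 * A * t) \<le> C * \<delta>" .
    qed auto
  qed
  show ?thesis
  proof (intro exI[of _ C] conjI C allI impI ballI, goal_cases)
    case (1 p1 p2 q1 q2 M \<delta> t)
    note h = 1[unfolded coeff_velocity_def coeff_solution_def]
    show ?case by (rule main[of q1 q2 p1 M p2 \<delta> t]) (use h in blast)+
  qed
qed

section \<open>Fourier analysis of integrable and square-integrable functions on the torus\<close>

subsection \<open>Characters of the torus and Fourier coefficients\<close>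

definition character :: "int ^ 'n \<Rightarrow> real ^ 'n \<Rightarrow> complex" where
  "character n x = cis (\<Sum>j\<in>UNIV. of_int (n $ j) * x $ j)"

abbreviation torus_volume :: "'n::finite itself \<Rightarrow> real" where
  "torus_volume _ \<equiv> (2 * pi) ^ CARD('n)"

text \<open>This normalisation gives characters Kronecker deltas as coefficients and products the
  unscaled \<open>conv\<close>; the price is a factor \<open>torus_volume\<close> in Parseval's
  identity.\<close>

definition fcoeff :: "(real ^ 'n \<Rightarrow> complex) \<Rightarrow> int ^ 'n \<Rightarrow> complex" where
  "fcoeff f n = (LINT x|torus. f x * character (- n) x) / of_real (torus_volume TYPE('n))"

definition L2_complex :: "(real ^ 'n \<Rightarrow> complex) set" where
  "L2_complex = {f. f \<in> borel_measurable torus \<and> integrable torus (\<lambda>x. (cmod (f x))\<^sup>2)}"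

lemma character_0 [simp]: "character 0 x = 1"
  by (simp add: character_def)

lemma norm_character [simp]: "cmod (character n x) = 1"
  by (simp add: character_def)

lemma character_add: "character (n + m) x = character n x * character m x"
  by (simp add: character_def cis_mult sum.distrib ring_distribs)

lemma character_minus: "character (- n) x = cnj (character n x)"
  by (simp add: character_def cis_cnj sum_negf)

lemma continuous_on_character [continuous_intros]: "continuous_on S (character n)"
  unfolding character_def[abs_def] cis_conv_exp by (intro continuous_intros)

lemma space_torus: "space torus = cbox 0 (\<chi> i. 2 * pi)"
  by (simp add: torus_def)

lemma continuous_borel_measurable_torus:
  fixes f :: "real ^ 'n \<Rightarrow> 'b::euclidean_space"
  assumes "continuous_on UNIV f"
  shows "f \<in> borel_measurable torus"
  unfolding torus_def
  by (rule continuous_imp_measurable_on_sets_lebesgue[OF continuous_on_subset[OF assms]]) auto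

lemma character_measurable [measurable]: "character n \<in> borel_measurable torus"
  by (intro continuous_borel_measurable_torus continuous_intros)

lemma finite_measure_torus: "finite_measure torus"
  unfolding torus_def by (rule finite_measure_lebesgue_on) (rule lmeasurable_cbox)

lemma integrable_torus_bounded:
  fixes f :: "real ^ 'n \<Rightarrow> 'b::{banach, second_countable_topology}"
  assumes "f \<in> borel_measurable torus" and "\<And>x. norm (f x) \<le> B"
  shows "integrable torus f"
  by (rule finite_measure.integrable_const_bound[OF finite_measure_torus _ assms(1), of B]) (simp add: assms)

lemma integrable_torus_character: "integrable torus (character n)"
  by (rule integrable_torus_bounded[of _ 1]) auto

lemma integrable_mult_character:
  assumes "integrable torus f"
  shows "integrable torus (\<lambda>x. f x * character n x)"
  using assms by (rule Bochner_Integration.integrable_bound) (use assms in \<open>auto simp: norm_mult\<close>)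

lemma integrable_cis_mult: "integrable lborel (\<lambda>t::real. indicator {0..2 * pi} t *\<^sub>R cis (of_int m * t))"
  unfolding cis_conv_exp by (intro borel_integrable_compact continuous_intros) auto

lemma integral_cis_mult:
  "(LINT t|lborel. indicator {0..2 * pi} t *\<^sub>R cis (of_int m * t)) = (if m = 0 then of_real (2 * pi) else 0)"
proof -
  define F where "F t = (if m = 0 then of_real t else cis (of_int m * t) / (\<i> * of_int m))" for t :: real
  have "((\<lambda>t. cis (of_int m * t)) has_integral (F (2 * pi) - F 0)) {0..2 * pi}"
  proof (rule fundamental_theorem_of_calculus)
    fix t assume "t \<in> {0..2 * pi}"
    show "(F has_vector_derivative cis (of_int m * t)) (at t within {0..2 * pi})"
    proof (cases "m = 0")
      case True
      then show ?thesis by (auto simp: F_def[abs_def] intro!: derivative_eq_intros)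
    next
      case False
      have c: "cis (of_int m * s) = exp (s *\<^sub>R (\<i> * of_int m))" for s
        by (simp add: cis_conv_exp scaleR_conv_of_real mult_ac)
      have "((\<lambda>t. exp (t *\<^sub>R (\<i> * of_int m)) / (\<i> * of_int m)) has_vector_derivative
          exp (t *\<^sub>R (\<i> * of_int m)) * (\<i> * of_int m) / (\<i> * of_int m)) (at t within {0..2 * pi})"
        by (intro has_vector_derivative_divide exp_scaleR_has_vector_derivative_right)
      then show ?thesis using False by (simp add: F_def[abs_def] c)
    qed
  qed auto
  then have hi: "integral {0..2 * pi} (\<lambda>t. cis (of_int m * t)) = F (2 * pi) - F 0" by (rule integral_unique)
  have "cis (of_int m * (2 * pi)) = 1"
    by (metis cis_multiple_2pi Ints_of_int mult.commute mult.left_commute)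
  then have "F (2 * pi) - F 0 = (if m = 0 then of_real (2 * pi) else 0)" by (simp add: F_def)
  moreover have "set_integrable lborel {0..2 * pi} (\<lambda>t. cis (of_int m * t))"
    using integrable_cis_mult by (simp add: set_integrable_def)
  ultimately show ?thesis
    using set_borel_integral_eq_integral(2)[of "{0..2 * pi}" "\<lambda>t. cis (of_int m * t)"] hi
    by (simp add: set_lebesgue_integral_def)
qed

text \<open>A character and the indicator of the cube both factorize over the coordinates, so the
  product structure of Lebesgue measure reduces the integral to one-dimensional ones.\<close>

lemma integral_character:
  "(LINT x|torus. character n (x :: real ^ 'n)) = (if n = 0 then of_real (torus_volume TYPE('n)) else 0)"
proof -
  interpret product_sigma_finite "\<lambda>b :: real ^ 'n. lborel :: real measure"
    by unfold_locales
  \<comment> \<open>The product measure is indexed by basis vectors, not by coordinates; the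
    description operator recovers the coordinate from its axis vector.\<close>
  define f where "f b t = indicator {0..2 * pi} t *\<^sub>R cis (of_int (n $ (THE j. b = axis j 1)) * t)"
    for b :: "real ^ 'n" and t :: real
  have Bas: "(Basis :: (real ^ 'n) set) = (\<lambda>j. axis j 1) ` UNIV"
    by (auto simp: Basis_vec_def)
  have inj: "inj (\<lambda>j. axis j (1::real) :: real ^ 'n)" by (auto simp: inj_on_def axis_eq_axis)
  have the: "(THE j'. axis j (1::real) = (axis j' 1 :: real ^ 'n)) = j" for j
    by (auto simp: axis_eq_axis)
  define g where "g x = indicator (cbox 0 (\<chi> i. 2 * pi)) x *\<^sub>R character n x" for x :: "real ^ 'n"
  have prodg: "g x = (\<Prod>b\<in>Basis. f b (x \<bullet> b))" for x
  proof -
    have "(\<Prod>b\<in>Basis. f b (x \<bullet> b)) = (\<Prod>j\<in>UNIV. indicator {0..2 * pi} (x $ j) *\<^sub>R cis (of_int (n $ j) * x $ j))"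
      unfolding Bas by (subst prod.reindex[OF inj]) (simp add: f_def the inner_axis)
    also have "\<dots> = (\<Prod>j\<in>UNIV. indicator {0..2 * pi} (x $ j)) *\<^sub>R (\<Prod>j\<in>UNIV. cis (of_int (n $ j) * x $ j))"
      by (simp add: scaleR_conv_of_real prod.distrib)
    also have "(\<Prod>j\<in>UNIV. cis (of_int (n $ j) * x $ j)) = character n x"
    proof -
      have "(\<Prod>j\<in>A. cis (of_int (n $ j) * x $ j)) = cis (\<Sum>j\<in>A. of_int (n $ j) * x $ j)" if "finite A" for A
        using that by (induction A rule: finite_induct) (auto simp: cis_mult)
      then show ?thesis by (simp add: character_def)
    qed
    also have "(\<Prod>j\<in>UNIV. indicator {0..2 * pi} (x $ j)) = (indicator (cbox 0 (\<chi> i. 2 * pi)) x :: real)"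
    proof (cases "\<forall>j. x $ j \<in> {0..2 * pi}")
      case True
      then show ?thesis by (simp add: mem_box_cart)
    next
      case False
      then obtain j where j: "x $ j \<notin> {0..2 * pi}" by blast
      then have "(\<Prod>j\<in>UNIV. indicator {0..2 * pi} (x $ j)) = (0 :: real)"
        by (intro prod_zero bexI[of _ j]) auto
      moreover have "x \<notin> cbox 0 (\<chi> i. 2 * pi)" using j by (auto simp: mem_box_cart)
      ultimately show ?thesis by simp
    qed
    finally show ?thesis by (simp add: g_def)
  qed
  have gm: "g \<in> borel_measurable borel"
    unfolding g_def by (intro borel_measurable_scaleR borel_measurable_continuous_onI continuous_intros borel_measurable_indicator) auto
  have "(LINT x|torus. character n x) = (LINT x|lebesgue. g x)"
    unfolding torus_def g_def by (subst integral_restrict_space) auto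
  also have "\<dots> = (LINT x|lborel. g x)" using gm by (intro integral_completion) auto
  also have "\<dots> = (LINT h|(\<Pi>\<^sub>M b\<in>Basis. lborel). g (\<Sum>b\<in>Basis. h b *\<^sub>R b))"
    by (subst lborel_eq, subst integral_distr) (use gm in auto)
  also have "\<dots> = (LINT h|(\<Pi>\<^sub>M b\<in>Basis. lborel). (\<Prod>b\<in>Basis. f b (h b)))"
    unfolding prodg
    by (intro Bochner_Integration.integral_cong refl prod.cong)
       (simp add: inner_sum_left inner_Basis if_distrib cong: if_cong)
  also have "\<dots> = (\<Prod>b\<in>Basis. (LINT t|lborel. f b t))"
    by (rule product_integral_prod) (auto simp: f_def integrable_cis_mult)
  also have "\<dots> = (\<Prod>j\<in>UNIV. if n $ j = 0 then of_real (2 * pi) else 0)"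
  proof -
    have "(LINT t|lborel. f (axis j 1) t) = (if n $ j = 0 then of_real (2 * pi) else 0)" for j
      unfolding f_def the by (rule integral_cis_mult)
    then show ?thesis unfolding Bas by (subst prod.reindex[OF inj]) (simp cong: if_cong)
  qed
  also have "\<dots> = (if n = 0 then of_real (torus_volume TYPE('n)) else 0)"
    by (auto simp: vec_eq_iff intro!: prod_zero)
  finally show ?thesis .
qed

lemma fcoeff_character: "fcoeff (character m) n = (if n = m then 1 else 0)"
  by (auto simp: fcoeff_def integral_character simp flip: character_add)

lemma fcoeff_add: "integrable torus f \<Longrightarrow> integrable torus g \<Longrightarrow> fcoeff (\<lambda>x. f x + g x) n = fcoeff f n + fcoeff g n"
  by (simp add: fcoeff_def distrib_right add_divide_distrib integrable_mult_character)

lemma fcoeff_cmult: "fcoeff (\<lambda>x. c * f x) n = c * fcoeff f n"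
  by (simp add: fcoeff_def mult.assoc)

lemma fcoeff_uminus: "fcoeff (\<lambda>x. - f x) n = - fcoeff f n"
  using fcoeff_cmult[of "-1" f n] by simp

lemma fcoeff_diff: "integrable torus f \<Longrightarrow> integrable torus g \<Longrightarrow> fcoeff (\<lambda>x. f x - g x) n = fcoeff f n - fcoeff g n"
  using fcoeff_add[of f "\<lambda>x. - g x" n] by (simp add: fcoeff_uminus)

lemma fcoeff_sum:
  "(\<And>i. i \<in> I \<Longrightarrow> integrable torus (f i)) \<Longrightarrow> fcoeff (\<lambda>x. \<Sum>i\<in>I. f i x) n = (\<Sum>i\<in>I. fcoeff (f i) n)"
  by (simp add: fcoeff_def sum_distrib_right sum_divide_distrib integrable_mult_character)

lemma fcoeff_mult_character: "fcoeff (\<lambda>x. f x * character m x) n = fcoeff f (n - m)"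
  by (simp add: fcoeff_def mult.assoc add.commute flip: character_add)

lemma fcoeff_cong_AE:
  assumes "AE x in torus. f x = g x" and "f \<in> borel_measurable torus" "g \<in> borel_measurable torus"
  shows "fcoeff f n = fcoeff g n"
  unfolding fcoeff_def using assms
  by (intro arg_cong2[where f = "(/)"] integral_cong_AE) auto

subsection \<open>A function with vanishing Fourier coefficients vanishes\<close>

text \<open>Maps the torus onto a compact subset of \<open>complex ^ 'n\<close>, on which
  polynomials become trigonometric polynomials. This is the setting in which Stone-Weierstrass is
  applied.\<close>

definition cis_vec :: "real ^ 'n \<Rightarrow> complex ^ 'n" where
  "cis_vec x = (\<chi> i. cis (x $ i))"

definition fcoeff_null :: "(real ^ 'n \<Rightarrow> complex) \<Rightarrow> bool" where
  "fcoeff_null f \<longleftrightarrow> integrable torus f \<and> (\<forall>n. fcoeff f n = 0)"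

lemma fcoeff_null_add: "fcoeff_null f \<Longrightarrow> fcoeff_null g \<Longrightarrow> fcoeff_null (\<lambda>x. f x + g x)"
  by (auto simp: fcoeff_null_def fcoeff_add)

lemma fcoeff_null_cmult: "fcoeff_null f \<Longrightarrow> fcoeff_null (\<lambda>x. c * f x)"
  by (auto simp: fcoeff_null_def fcoeff_cmult)

lemma fcoeff_null_sum: "(\<And>i. i \<in> I \<Longrightarrow> fcoeff_null (f i)) \<Longrightarrow> fcoeff_null (\<lambda>x. \<Sum>i\<in>I. f i x)"
  by (auto simp: fcoeff_null_def fcoeff_sum)

lemma fcoeff_null_character: "fcoeff_null f \<Longrightarrow> fcoeff_null (\<lambda>x. f x * character m x)"
  by (auto simp: fcoeff_null_def fcoeff_mult_character integrable_mult_character)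

lemma character_axis: "character (axis i m) x = cis (of_int m * x $ i)"
proof -
  have "(\<Sum>j\<in>UNIV. of_int (axis i m $ j) * x $ j) = (\<Sum>j\<in>UNIV. if j = i then of_int m * x $ i else 0)"
    by (rule sum.cong) (auto simp: axis_def)
  then show ?thesis by (simp add: character_def)
qed

text \<open>Multiplication by a character only shifts coefficients, so it preserves
  \<open>fcoeff_null\<close>; a linear function of \<open>cis_vec x\<close> is a combination of
  characters of the axes and their inverses. Keeping \<open>f\<close> arbitrary lets the product
  case apply its two hypotheses in succession.\<close>

lemma fcoeff_null_polynomial:
  fixes h :: "complex ^ 'n \<Rightarrow> real"
  assumes "real_polynomial_function h" and "fcoeff_null f"
  shows "fcoeff_null (\<lambda>x. of_real (h (cis_vec x)) * f x)"
  using assms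
proof (induction arbitrary: f rule: real_polynomial_function.induct)
  case (linear h)
  have f: "fcoeff_null f" by (rule linear.prems)
  from linear.hyps interpret bounded_linear h by simp
  \<comment> \<open>\<open>\<alpha>\<close> and \<open>\<beta>\<close> are the coefficients of
    \<open>cis (x $ i)\<close> and \<open>cis (- (x $ i))\<close> when cosine and sine are written
    by Euler's formulas.\<close>
  define \<alpha> where "\<alpha> i = of_real (h (axis i 1)) / 2 + of_real (h (axis i \<i>)) / (2 * \<i>)" for i :: 'n
  define \<beta> where "\<beta> i = of_real (h (axis i 1)) / 2 - of_real (h (axis i \<i>)) / (2 * \<i>)" for i :: 'n
  have "of_real (h (cis_vec x)) * f x
      = (\<Sum>i\<in>UNIV. \<alpha> i * (f x * character (axis i 1) x) + \<beta> i * (f x * character (axis i (-1)) x))" for x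
  proof -
    have "cis_vec x = (\<Sum>i\<in>UNIV. cos (x $ i) *\<^sub>R axis i 1 + sin (x $ i) *\<^sub>R axis i \<i>)"
      by (auto simp: vec_eq_iff cis_vec_def axis_def complex_eq_iff if_distrib cong: if_cong
          simp flip: sum_distrib_left)
    then have "h (cis_vec x) = (\<Sum>i\<in>UNIV. cos (x $ i) * h (axis i 1) + sin (x $ i) * h (axis i \<i>))"
      by (simp add: sum add scale)
    then have "of_real (h (cis_vec x)) * f x
        = (\<Sum>i\<in>UNIV. (of_real (cos (x $ i)) * of_real (h (axis i 1)) + of_real (sin (x $ i)) * of_real (h (axis i \<i>))) * f x)"
      by (simp add: sum_distrib_right)
    also have "\<dots> = (\<Sum>i\<in>UNIV. \<alpha> i * (f x * character (axis i 1) x) + \<beta> i * (f x * character (axis i (-1)) x))"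
    proof (rule sum.cong)
      fix i
      have c: "of_real (cos (x $ i)) = (cis (x $ i) + cis (- (x $ i))) / 2"
        and s: "of_real (sin (x $ i)) = (cis (x $ i) - cis (- (x $ i))) / (2 * \<i>)"
        by (auto simp: complex_eq_iff)
      show "(of_real (cos (x $ i)) * of_real (h (axis i 1)) + of_real (sin (x $ i)) * of_real (h (axis i \<i>))) * f x
        = \<alpha> i * (f x * character (axis i 1) x) + \<beta> i * (f x * character (axis i (-1)) x)"
        unfolding c s \<alpha>_def \<beta>_def by (simp add: character_axis algebra_simps add_divide_distrib diff_divide_distrib)
    qed simp
    finally show ?thesis .
  qed
  then show ?case
    by (simp only:) (intro fcoeff_null_sum fcoeff_null_add fcoeff_null_cmult fcoeff_null_character f)
next
  case (const c)
  then show ?case by (rule fcoeff_null_cmult)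
next
  case (add g h)
  then show ?case using fcoeff_null_add[OF add.IH] by (simp add: distrib_right)
next
  case (mult g h)
  show ?case using mult.IH(1)[OF mult.IH(2)[OF mult.prems]] by (simp add: mult.assoc)
qed

lemma continuous_on_cis_vec: "continuous_on S cis_vec"
  unfolding cis_vec_def[abs_def] cis_conv_exp by (intro continuous_intros)

text \<open>Stone-Weierstrass on the compact image of the cube: replacing \<open>g\<close> by a
  polynomial changes the integral by at most \<open>e\<close> times the L^1 norm of
  \<open>f\<close>, and for a polynomial the integral is the coefficient at 0 of an
  \<open>fcoeff_null\<close> function, up to the volume.\<close>

lemma fcoeff_null_continuous:
  fixes g :: "complex ^ 'n \<Rightarrow> real"
  assumes g: "continuous_on UNIV g" and f: "fcoeff_null f"
  shows "(LINT x|torus. of_real (g (cis_vec x)) * f x) = 0"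
proof -
  define X where "X = cis_vec ` cbox (0 :: real ^ 'n) (\<chi> i. 2 * pi)"
  have X: "compact X" unfolding X_def by (intro compact_continuous_image continuous_on_cis_vec compact_cbox)
  have fi: "integrable torus f" using f by (simp add: fcoeff_null_def)
  have gm: "(\<lambda>x. complex_of_real (g (cis_vec x))) \<in> borel_measurable torus"
    by (rule continuous_borel_measurable_torus[OF continuous_on_of_real[OF continuous_on_compose2[OF g continuous_on_cis_vec]]]) auto
  define I where "I = (LINT x|torus. cmod (f x))"
  have I0: "I \<ge> 0" unfolding I_def by simp
  obtain b where b: "\<And>z. z \<in> X \<Longrightarrow> \<bar>g z\<bar> \<le> b"
    using compact_imp_bounded[OF compact_continuous_image[OF continuous_on_subset[OF g] X]]
    by (auto simp: bounded_iff)
  have gfi: "integrable torus (\<lambda>x. of_real (g (cis_vec x)) * f x)"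
  proof (rule Bochner_Integration.integrable_bound)
    show "integrable torus (\<lambda>x. b * cmod (f x))" using fi by simp
    show "(\<lambda>x. of_real (g (cis_vec x)) * f x) \<in> borel_measurable torus"
      using gm fi by (intro borel_measurable_times) auto
    have "\<bar>g (cis_vec x)\<bar> * cmod (f x) \<le> \<bar>b * cmod (f x)\<bar>" if "x \<in> space torus" for x
      using b[of "cis_vec x"] that
      by (intro order_trans[OF mult_right_mono abs_ge_self]) (auto simp: X_def space_torus)
    then show "AE x in torus. norm (of_real (g (cis_vec x)) * f x) \<le> norm (b * cmod (f x))"
      by (simp add: norm_mult)
  qed
  have small: "cmod (LINT x|torus. of_real (g (cis_vec x)) * f x) \<le> e * I" if e: "e > 0" for e
  proof -
    obtain p where p: "real_polynomial_function p" "\<And>z. z \<in> X \<Longrightarrow> \<bar>g z - p z\<bar> < e"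
      using Stone_Weierstrass_real_polynomial_function[OF X continuous_on_subset[OF g] e] by auto
    have pn: "fcoeff_null (\<lambda>x. of_real (p (cis_vec x)) * f x)"
      by (rule fcoeff_null_polynomial[OF p(1) f])
    then have pfi: "integrable torus (\<lambda>x. of_real (p (cis_vec x)) * f x)" by (simp add: fcoeff_null_def)
    have "fcoeff (\<lambda>x. of_real (p (cis_vec x)) * f x) 0 = 0" using pn by (simp add: fcoeff_null_def)
    then have "(LINT x|torus. of_real (p (cis_vec x)) * f x) = 0" by (simp add: fcoeff_def)
    then have "(LINT x|torus. of_real (g (cis_vec x)) * f x)
        = (LINT x|torus. of_real (g (cis_vec x)) * f x - of_real (p (cis_vec x)) * f x)"
      using gfi pfi by simp
    also have "cmod \<dots> \<le> (LINT x|torus. e * cmod (f x))"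
    proof (rule order_trans[OF integral_norm_bound integral_mono])
      fix x :: "real ^ 'n" assume "x \<in> space torus"
      then have "\<bar>g (cis_vec x) - p (cis_vec x)\<bar> \<le> e"
        using p(2)[of "cis_vec x"] by (force simp: X_def space_torus)
      then show "norm (of_real (g (cis_vec x)) * f x - of_real (p (cis_vec x)) * f x) \<le> e * cmod (f x)"
        by (simp add: norm_mult mult_right_mono flip: left_diff_distrib of_real_diff)
    qed (use gfi pfi fi in auto)
    finally show ?thesis by (simp add: I_def)
  qed
  have "cmod (LINT x|torus. of_real (g (cis_vec x)) * f x) \<le> 0 + e" if "e > 0" for e
  proof -
    \<comment> \<open>Adding 1 covers the case that \<open>I\<close> is zero.\<close>
    have "cmod (LINT x|torus. of_real (g (cis_vec x)) * f x) \<le> e / (I + 1) * I"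
      using that I0 by (intro small) auto
    also have "\<dots> \<le> e" using that I0 by (simp add: field_simps)
    finally show ?thesis by simp
  qed
  then have "cmod (LINT x|torus. of_real (g (cis_vec x)) * f x) \<le> 0" by (rule field_le_epsilon)
  then show ?thesis by simp
qed

text \<open>Opposite faces of the cube have the same image, so injectivity is taken on the interior;
  its complement in the cube is null by \<open>AE_torus_interior\<close>.\<close>

lemma cis_vec_inj:
  assumes "x \<in> box 0 (\<chi> i. 2 * pi)" "y \<in> box 0 (\<chi> i. 2 * pi)" "cis_vec x = cis_vec y"
  shows "x = y"
proof (simp add: vec_eq_iff, rule allI)
  fix i
  have "cis (x $ i) = cis (y $ i)" using assms(3) by (simp add: cis_vec_def vec_eq_iff)
  then have "sin (x $ i) = sin (y $ i) \<and> cos (x $ i) = cos (y $ i)" by (simp add: complex_eq_iff)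
  then obtain n :: int where n: "x $ i = y $ i + 2 * pi * n"
    using sin_cos_eq_iff[of "x $ i" "y $ i"] by (auto elim: Ints_cases)
  have xy: "0 < x $ i" "x $ i < 2 * pi" "0 < y $ i" "y $ i < 2 * pi"
    using assms by (auto simp: mem_box_cart)
  have "\<not> n \<ge> 1"
  proof
    assume "n \<ge> 1"
    then have "2 * pi * 1 \<le> 2 * pi * real_of_int n" by (intro mult_left_mono) auto
    then show False using n xy by linarith
  qed
  moreover have "\<not> n \<le> - 1"
  proof
    assume "n \<le> - 1"
    then have "2 * pi * real_of_int n \<le> 2 * pi * (- 1)" by (intro mult_left_mono) auto
    then show False using n xy by linarith
  qed
  ultimately have "n = 0" by linarith
  then show "x $ i = y $ i" using n by simp
qed

lemma AE_torus_interior: "AE x in torus. (x :: real ^ 'n) \<in> box 0 (\<chi> i. 2 * pi)"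
proof -
  have "negligible (cbox 0 (\<chi> i. 2 * pi) - box 0 (\<chi> i. 2 * pi) :: (real ^ 'n) set)"
    by (rule negligible_frontier_interval)
  then have "AE x in lebesgue. x \<notin> (cbox 0 (\<chi> i. 2 * pi) - box 0 (\<chi> i. 2 * pi) :: (real ^ 'n) set)"
    unfolding negligible_iff_null_sets by (rule AE_not_in)
  then have "AE x in lebesgue. x \<in> (cbox 0 (\<chi> i. 2 * pi) :: (real ^ 'n) set) \<longrightarrow> x \<in> box 0 (\<chi> i. 2 * pi)"
    by eventually_elim auto
  then show ?thesis unfolding torus_def
    by (rule AE_restrict_space_iff[THEN iffD2, rotated]) auto
qed

lemma indicator_measurable_torus:
  "K \<in> sets lebesgue \<Longrightarrow> (indicator K :: real ^ 'n \<Rightarrow> real) \<in> borel_measurable torus"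
  unfolding torus_def by (rule measurable_restrict_space1, rule borel_measurable_indicator)

text \<open>The indicator of \<open>K\<close> is an almost everywhere limit of continuous functions
  of \<open>cis_vec x\<close>, namely tents of slope \<open>m\<close> in the distance to the image
  of \<open>K\<close>. They tend to 0 off \<open>K\<close> because \<open>cis_vec\<close> is
  injective on the interior and that image is closed.\<close>

lemma fcoeff_null_compact:
  assumes f: "fcoeff_null f" and K: "compact K" "K \<subseteq> box 0 (\<chi> i. 2 * pi)"
  shows "(LINT x|torus. of_real (indicator K x) * f (x :: real ^ 'n)) = 0"
proof (cases "K = {}")
  case False
  define Y where "Y = cis_vec ` K"
  have "compact Y" unfolding Y_def by (intro compact_continuous_image continuous_on_cis_vec K)
  then have Y: "closed Y" "Y \<noteq> {}" using False by (auto simp: Y_def compact_imp_closed)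
  define g where "g m z = max 0 (1 - real m * infdist z Y)" for m z
  have g: "continuous_on UNIV (g m)" for m
    unfolding g_def by (intro continuous_intros)
  have fi: "integrable torus f" using f by (simp add: fcoeff_null_def)
  have Km: "K \<in> sets lebesgue" using fmeasurableD[OF lmeasurable_compact[OF K(1)]] .
  have "(\<lambda>m. LINT x|torus. of_real (g m (cis_vec x)) * f x)
      \<longlonglongrightarrow> (LINT x|torus. of_real (indicator K x) * f x)"
  proof (rule integral_dominated_convergence[where w = "\<lambda>x. cmod (f x)"])
    show "(\<lambda>x. of_real (indicator K x) * f x) \<in> borel_measurable torus"
      using fi by (intro borel_measurable_times measurable_compose[OF indicator_measurable_torus[OF Km]]) auto
    show "(\<lambda>x. of_real (g m (cis_vec x)) * f x) \<in> borel_measurable torus" for m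
      using fi by (intro borel_measurable_times continuous_borel_measurable_torus[OF continuous_on_of_real
        [OF continuous_on_compose2[OF g continuous_on_cis_vec]]]) auto
    show "integrable torus (\<lambda>x. cmod (f x))" using fi by simp
    show "AE x in torus. (\<lambda>m. of_real (g m (cis_vec x)) * f x) \<longlonglongrightarrow> of_real (indicator K x) * f x"
      using AE_torus_interior
    proof (rule AE_mp, intro AE_I2 impI)
      fix x :: "real ^ 'n" assume x: "x \<in> box 0 (\<chi> i. 2 * pi)"
      have "(\<lambda>m. g m (cis_vec x)) \<longlonglongrightarrow> indicator K x"
      proof (cases "x \<in> K")
        case True
        then have "g m (cis_vec x) = 1" for m by (simp add: g_def Y_def infdist_zero)
        then show ?thesis using True by simp
      next
        case False
        then have "cis_vec x \<notin> Y" using cis_vec_inj[OF x] K(2) by (auto simp: Y_def)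
        then have pos: "infdist (cis_vec x) Y > 0" using Y infdist_pos_not_in_closed by blast
        then obtain M :: nat where M: "1 < real M * infdist (cis_vec x) Y"
          using ex_less_of_nat_mult by blast
        have "g m (cis_vec x) = 0" if "m \<ge> M" for m
        proof -
          have "real M * infdist (cis_vec x) Y \<le> real m * infdist (cis_vec x) Y"
            using that pos by (intro mult_right_mono) auto
          then show ?thesis using M by (simp add: g_def)
        qed
        then show ?thesis using False
          by (intro tendsto_eventually) (auto simp: eventually_sequentially)
      qed
      then show "(\<lambda>m. of_real (g m (cis_vec x)) * f x) \<longlonglongrightarrow> of_real (indicator K x) * f x"
        by (intro tendsto_intros)
    qed
    have "\<bar>g m z\<bar> \<le> 1" for m z by (auto simp: g_def infdist_nonneg)
    then have "\<bar>g m z\<bar> * cmod (f x) \<le> 1 * cmod (f x)" for m z x by (intro mult_right_mono) auto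
    then show "AE x in torus. norm (of_real (g m (cis_vec x)) * f x) \<le> cmod (f x)" for m
      by (simp add: norm_mult)
  qed
  moreover have "(LINT x|torus. of_real (g m (cis_vec x)) * f x) = 0" for m
    by (rule fcoeff_null_continuous[OF g f])
  ultimately show ?thesis by (simp add: LIMSEQ_const_iff)
qed simp

text \<open>Inner regularity: the set where \<open>u\<close> is positive is exhausted by compact
  sets up to measure \<open>e\<close>. On each of them a positive function has integral 0, so the
  compact set is null.\<close>

lemma AE_torus_nonpos:
  fixes u :: "real ^ 'n \<Rightarrow> real"
  assumes u: "integrable torus u"
    and K: "\<And>K. compact K \<Longrightarrow> K \<subseteq> box 0 (\<chi> i. 2 * pi) \<Longrightarrow> (LINT x|torus. indicator K x * u x) = 0"
  shows "AE x in torus. u x \<le> 0"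
proof -
  define A where "A = {x \<in> space torus. 0 < u x} \<inter> box 0 (\<chi> i. 2 * pi)"
  have "{x \<in> space torus. 0 < u x} \<in> sets torus" using u by measurable
  then have "{x \<in> space torus. 0 < u x} \<in> sets lebesgue"
    unfolding torus_def by (subst (asm) sets_restrict_space_iff) auto
  then have A: "A \<in> sets lebesgue" unfolding A_def by (intro sets.Int) auto
  have "emeasure lebesgue A < ennreal e" if e: "e > 0" for e
  proof -
    obtain K where K': "closed K" "K \<subseteq> A" "A - K \<in> lmeasurable" "emeasure lebesgue (A - K) < ennreal e"
      using sets_lebesgue_inner_closed[OF A e] by blast
    have Kbox: "K \<subseteq> box 0 (\<chi> i. 2 * pi)" using K'(2) by (auto simp: A_def)
    then have Kc: "compact K"
      using K'(1) bounded_subset[OF bounded_box] by (auto simp: compact_eq_bounded_closed)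
    have Km: "K \<in> sets lebesgue" using fmeasurableD[OF lmeasurable_compact[OF Kc]] .
    have int: "integrable torus (\<lambda>x. indicator K x * u x)"
    proof (rule Bochner_Integration.integrable_bound[OF u])
      show "(\<lambda>x. indicator K x * u x) \<in> borel_measurable torus"
        using u indicator_measurable_torus[OF Km] by (intro borel_measurable_times) auto
    qed (auto simp: indicator_def)
    have pos: "0 \<le> indicator K x * u x" for x using K'(2) by (auto simp: indicator_def A_def)
    have "AE x in torus. indicator K x * u x = 0"
      using integral_nonneg_eq_0_iff_AE[OF int] K[OF Kc Kbox] pos by simp
    then have "AE x in lebesgue. x \<in> cbox 0 (\<chi> i. 2 * pi) \<longrightarrow> indicator K x * u x = 0"
      unfolding torus_def by (subst (asm) AE_restrict_space_iff) auto
    then have "AE x in lebesgue. x \<notin> K"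
      by (rule AE_mp) (use K'(2) in \<open>auto simp: A_def space_torus indicator_def intro!: AE_I2\<close>)
    then have "K \<in> null_sets lebesgue" using AE_iff_null_sets[OF Km] by simp
    then have "emeasure lebesgue K = 0" by auto
    then have "emeasure lebesgue A = emeasure lebesgue (A - K)"
      using emeasure_Diff_null_set[OF \<open>K \<in> null_sets lebesgue\<close> A] by simp
    then show ?thesis using K'(4) by simp
  qed
  then have "emeasure lebesgue A \<le> 0 + ennreal e" if "e > 0" for e
    using that by (simp add: less_imp_le)
  then have "emeasure lebesgue A \<le> 0" by (rule ennreal_le_epsilon)
  then have "A \<in> null_sets lebesgue" using A by auto
  then have "AE x in lebesgue. x \<notin> A" by (rule AE_not_in)
  then have "AE x in torus. x \<notin> A" unfolding torus_def by (subst AE_restrict_space_iff) auto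
  with AE_torus_interior show ?thesis
    by eventually_elim (use box_subset_cbox in \<open>force simp: A_def space_torus\<close>)
qed

theorem fcoeff_null_imp_AE_zero:
  assumes f: "fcoeff_null (f :: real ^ 'n \<Rightarrow> complex)"
  shows "AE x in torus. f x = 0"
proof -
  have fi: "integrable torus f" using f by (simp add: fcoeff_null_def)
  have L: "AE x in torus. L (f x) \<le> 0" if L: "bounded_linear L" for L :: "complex \<Rightarrow> real"
  proof (rule AE_torus_nonpos)
    interpret bounded_linear L by (rule L)
    show "integrable torus (\<lambda>x. L (f x))" by (rule integrable_bounded_linear[OF L fi])
    fix K :: "(real ^ 'n) set" assume K: "compact K" "K \<subseteq> box 0 (\<chi> i. 2 * pi)"
    have Km: "K \<in> sets lebesgue" using fmeasurableD[OF lmeasurable_compact[OF K(1)]] .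
    have "integrable torus (\<lambda>x. of_real (indicator K x) * f x)"
    proof (rule Bochner_Integration.integrable_bound[OF fi])
      show "(\<lambda>x. of_real (indicator K x) * f x) \<in> borel_measurable torus"
        using fi by (intro borel_measurable_times measurable_compose[OF indicator_measurable_torus[OF Km]]) auto
    qed (auto simp: indicator_def)
    then have "(LINT x|torus. L (of_real (indicator K x) * f x)) = L (LINT x|torus. of_real (indicator K x) * f x)"
      by (rule integral_bounded_linear[OF L])
    then show "(LINT x|torus. indicator K x * L (f x)) = 0"
      using fcoeff_null_compact[OF f K] by (simp add: zero scale flip: scaleR_conv_of_real)
  qed
  have "AE x in torus. Re (f x) \<le> 0" "AE x in torus. - Re (f x) \<le> 0"
    "AE x in torus. Im (f x) \<le> 0" "AE x in torus. - Im (f x) \<le> 0"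
    by (rule L[OF bounded_linear_Re] L[OF bounded_linear_minus[OF bounded_linear_Re]]
        L[OF bounded_linear_Im] L[OF bounded_linear_minus[OF bounded_linear_Im]])+
  then show ?thesis by eventually_elim (auto simp: complex_eq_iff)
qed

subsection \<open>Square-integrable functions: Riesz-Fischer and Parseval\<close>

lemma L2_complex_integrable_mult:
  assumes "f \<in> L2_complex" "g \<in> L2_complex"
  shows "integrable torus (\<lambda>x. f x * g x)"
proof (rule Bochner_Integration.integrable_bound)
  show "integrable torus (\<lambda>x. (cmod (f x))\<^sup>2 + (cmod (g x))\<^sup>2)"
    using assms by (auto simp: L2_complex_def)
  show "(\<lambda>x. f x * g x) \<in> borel_measurable torus" using assms by (auto simp: L2_complex_def)
  have "cmod (f x) * cmod (g x) \<le> (cmod (f x))\<^sup>2 + (cmod (g x))\<^sup>2" for x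
    using sum_squares_bound[of "cmod (f x)" "cmod (g x)"] mult_nonneg_nonneg[of "cmod (f x)" "cmod (g x)"]
    by (simp del: mult_nonneg_nonneg)
  then show "AE x in torus. norm (f x * g x) \<le> norm ((cmod (f x))\<^sup>2 + (cmod (g x))\<^sup>2)"
    by (simp add: norm_mult)
qed

lemma L2_complex_bounded:
  assumes "f \<in> borel_measurable torus" and "\<And>x. cmod (f x) \<le> B"
  shows "f \<in> L2_complex"
  unfolding L2_complex_def
proof (intro CollectI conjI assms(1) integrable_torus_bounded)
  show "(\<lambda>x. (cmod (f x))\<^sup>2) \<in> borel_measurable torus" using assms(1) by measurable
  show "norm ((cmod (f x))\<^sup>2) \<le> B\<^sup>2" for x using assms(2)[of x] by (simp add: power_mono)
qed

lemma L2_complex_integrable: "f \<in> L2_complex \<Longrightarrow> integrable torus f"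
  using L2_complex_integrable_mult[of f "\<lambda>_. 1"] L2_complex_bounded[of "\<lambda>_. 1" 1] by simp

lemma L2_complex_add:
  assumes "f \<in> L2_complex" "g \<in> L2_complex"
  shows "(\<lambda>x. f x + g x) \<in> L2_complex"
proof -
  have "integrable torus (\<lambda>x. (cmod (f x + g x))\<^sup>2)"
  proof (rule Bochner_Integration.integrable_bound)
    show "integrable torus (\<lambda>x. 2 * ((cmod (f x))\<^sup>2 + (cmod (g x))\<^sup>2))"
      using assms by (auto simp: L2_complex_def)
    show "(\<lambda>x. (cmod (f x + g x))\<^sup>2) \<in> borel_measurable torus" using assms by (auto simp: L2_complex_def)
    have "(cmod (f x + g x))\<^sup>2 \<le> 2 * ((cmod (f x))\<^sup>2 + (cmod (g x))\<^sup>2)" for x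
      using power_mono[OF norm_triangle_ineq[of "f x" "g x"], of 2] sum_squares_bound[of "cmod (f x)" "cmod (g x)"]
      by (simp add: power2_sum)
    then show "AE x in torus. norm ((cmod (f x + g x))\<^sup>2) \<le> norm (2 * ((cmod (f x))\<^sup>2 + (cmod (g x))\<^sup>2))"
      by simp
  qed
  then show ?thesis using assms by (auto simp: L2_complex_def)
qed

lemma L2_complex_cmult: "f \<in> L2_complex \<Longrightarrow> (\<lambda>x. c * f x) \<in> L2_complex"
  by (auto simp: L2_complex_def norm_mult power_mult_distrib)

lemma L2_complex_diff:
  assumes "f \<in> L2_complex" "g \<in> L2_complex"
  shows "(\<lambda>x. f x - g x) \<in> L2_complex"
  using L2_complex_add[OF assms(1) L2_complex_cmult[OF assms(2), of "-1"]]
  by (simp only: mult_minus1 add_uminus_conv_diff)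

lemma L2_complex_cnj:
  assumes "f \<in> L2_complex"
  shows "(\<lambda>x. cnj (f x)) \<in> L2_complex"
proof -
  have "cnj \<in> borel_measurable borel"
    by (intro borel_measurable_continuous_onI continuous_intros)
  moreover have "f \<in> borel_measurable torus" using assms by (simp add: L2_complex_def)
  ultimately have "(\<lambda>x. cnj (f x)) \<in> borel_measurable torus" by (rule measurable_compose[rotated])
  then show ?thesis using assms by (auto simp: L2_complex_def)
qed

lemma L2_complex_mult_character: "f \<in> L2_complex \<Longrightarrow> (\<lambda>x. f x * character n x) \<in> L2_complex"
  by (auto simp: L2_complex_def norm_mult power_mult_distrib)

definition trig_sum :: "(int ^ 'n \<Rightarrow> complex) \<Rightarrow> (int ^ 'n) set \<Rightarrow> real ^ 'n \<Rightarrow> complex" where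
  "trig_sum a F x = (\<Sum>n\<in>F. a n * character n x)"

lemma continuous_on_trig_sum: "continuous_on S (trig_sum a F)"
  unfolding trig_sum_def[abs_def] by (intro continuous_intros)

lemma L2_complex_trig_sum: "trig_sum a F \<in> L2_complex"
  by (rule L2_complex_bounded[where B = "\<Sum>n\<in>F. cmod (a n)"])
     (auto intro!: continuous_borel_measurable_torus continuous_on_trig_sum order_trans[OF norm_sum]
       simp: trig_sum_def norm_mult)

lemma fcoeff_trig_sum:
  assumes "finite F"
  shows "fcoeff (trig_sum a F) n = (if n \<in> F then a n else 0)"
proof -
  have "fcoeff (trig_sum a F) n = (\<Sum>m\<in>F. a m * (if n = m then 1 else 0))"
    unfolding trig_sum_def[abs_def]
    by (subst fcoeff_sum) (auto simp: fcoeff_cmult fcoeff_character integrable_torus_character cong: if_cong)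
  also have "\<dots> = (\<Sum>m\<in>F. if n = m then a n else 0)" by (rule sum.cong) auto
  finally show ?thesis using assms by simp
qed

lemma integral_mult_cnj_trig_sum:
  assumes "(f :: real ^ 'n \<Rightarrow> complex) \<in> L2_complex"
  shows "(LINT x|torus. f x * cnj (trig_sum a F x)) = of_real (torus_volume TYPE('n)) * (\<Sum>n\<in>F. cnj (a n) * fcoeff f n)"
proof -
  have "(LINT x|torus. f x * cnj (trig_sum a F x)) = (LINT x|torus. (\<Sum>n\<in>F. cnj (a n) * (f x * character (- n) x)))"
    by (simp add: trig_sum_def character_minus sum_distrib_left mult_ac)
  also have "\<dots> = (\<Sum>n\<in>F. cnj (a n) * (LINT x|torus. f x * character (- n) x))"
    using integrable_mult_character[OF L2_complex_integrable[OF assms]] by simp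
  finally show ?thesis by (simp add: fcoeff_def sum_distrib_left)
qed

text \<open>Pythagoras: the Fourier partial sum is the orthogonal projection onto the span of the
  characters in \<open>F\<close>. Bessel's inequality and the norm of a trigonometric polynomial
  both follow.\<close>

lemma integral_norm_diff_trig_sum:
  fixes f :: "real ^ 'n \<Rightarrow> complex"
  assumes f: "f \<in> L2_complex" and F: "finite F"
  shows "(LINT x|torus. (cmod (f x - trig_sum (fcoeff f) F x))\<^sup>2)
    = (LINT x|torus. (cmod (f x))\<^sup>2) - torus_volume TYPE('n) * (\<Sum>n\<in>F. (cmod (fcoeff f n))\<^sup>2)"
proof -
  let ?S = "trig_sum (fcoeff f) F" and ?V = "torus_volume TYPE('n)"
  have S: "?S \<in> L2_complex" by (rule L2_complex_trig_sum)
  note fS = L2_complex_diff[OF f S]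
  have norm_sq: "complex_of_real (LINT x|torus. (cmod (g x))\<^sup>2) = (LINT x|torus. g x * cnj (g x))" for g :: "real ^ 'n \<Rightarrow> complex"
    by (simp only: complex_norm_square flip: integral_complex_of_real)
  have eq: "?V * (\<Sum>n\<in>F. (cmod (fcoeff f n))\<^sup>2) = of_real ?V * (\<Sum>n\<in>F. cnj (fcoeff f n) * fcoeff f n)"
    by (simp add: complex_norm_square mult.commute del: of_real_power flip: of_real_power)
  have "(LINT x|torus. (f x - ?S x) * cnj (f x - ?S x))
      = (LINT x|torus. f x * cnj (f x) - cnj (?S x * cnj (f x)) - f x * cnj (f x) + f x * cnj (f x) - ?S x * cnj (f x) + ?S x * cnj (?S x))"
    by (intro Bochner_Integration.integral_cong) (auto simp: algebra_simps)
  also have "\<dots> = (LINT x|torus. f x * cnj (f x)) - (LINT x|torus. f x * cnj (?S x))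
      - cnj (LINT x|torus. f x * cnj (?S x)) + (LINT x|torus. ?S x * cnj (?S x))"
  proof -
    have i: "integrable torus (\<lambda>x. f x * cnj (f x))" "integrable torus (\<lambda>x. f x * cnj (?S x))"
      "integrable torus (\<lambda>x. ?S x * cnj (f x))" "integrable torus (\<lambda>x. ?S x * cnj (?S x))"
      using L2_complex_integrable_mult f S L2_complex_cnj by blast+
    have c: "cnj (LINT x|torus. f x * cnj (?S x)) = (LINT x|torus. ?S x * cnj (f x))"
      by (simp add: mult.commute flip: Bochner_Integration.integral_cnj)
    show ?thesis unfolding c using i by (simp add: mult.commute)
  qed
  also have "(LINT x|torus. f x * cnj (?S x)) = of_real ?V * (\<Sum>n\<in>F. cnj (fcoeff f n) * fcoeff f n)"
    by (rule integral_mult_cnj_trig_sum[OF f])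
  also have "(LINT x|torus. ?S x * cnj (?S x)) = of_real ?V * (\<Sum>n\<in>F. cnj (fcoeff f n) * fcoeff f n)"
    by (subst integral_mult_cnj_trig_sum[OF S]) (simp add: fcoeff_trig_sum[OF F])
  finally have "complex_of_real (LINT x|torus. (cmod (f x - ?S x))\<^sup>2)
      = complex_of_real ((LINT x|torus. (cmod (f x))\<^sup>2) - ?V * (\<Sum>n\<in>F. (cmod (fcoeff f n))\<^sup>2))"
    unfolding norm_sq of_real_diff eq[symmetric] by simp
  then show ?thesis unfolding of_real_eq_iff .
qed

lemma bessel:
  assumes "(f :: real ^ 'n \<Rightarrow> complex) \<in> L2_complex" "finite F"
  shows "torus_volume TYPE('n) * (\<Sum>n\<in>F. (cmod (fcoeff f n))\<^sup>2) \<le> (LINT x|torus. (cmod (f x))\<^sup>2)"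
proof -
  have "0 \<le> (LINT x|torus. (cmod (f x - trig_sum (fcoeff f) F x))\<^sup>2)" by simp
  then show ?thesis unfolding integral_norm_diff_trig_sum[OF assms] by simp
qed

lemma integral_norm_trig_sum:
  assumes "finite F"
  shows "(LINT x|torus. (cmod (trig_sum a F (x :: real ^ 'n)))\<^sup>2) = torus_volume TYPE('n) * (\<Sum>n\<in>F. (cmod (a n))\<^sup>2)"
proof -
  have "trig_sum (fcoeff (trig_sum a F)) F = trig_sum a F"
    by (auto simp: trig_sum_def[of _ F] fcoeff_trig_sum[OF assms] intro!: sum.cong)
  then show ?thesis
    using integral_norm_diff_trig_sum[OF L2_complex_trig_sum assms, of a F] by (simp add: fcoeff_trig_sum[OF assms])
qed

lemma character_periodic: "character n (x + (2 * pi) *\<^sub>R axis i 1) = character n x"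
proof -
  have "(\<Sum>j\<in>UNIV. of_int (n $ j) * (x + (2 * pi) *\<^sub>R axis i 1) $ j)
      = (\<Sum>j\<in>UNIV. of_int (n $ j) * x $ j) + (\<Sum>j\<in>UNIV. if j = i then of_int (n $ i) * (2 * pi) else 0)"
    unfolding sum.distrib[symmetric] by (rule sum.cong) (auto simp: axis_def ring_distribs)
  moreover have "cis (of_int (n $ i) * (2 * pi)) = 1"
    by (metis cis_multiple_2pi Ints_of_int mult.commute mult.left_commute)
  ultimately show ?thesis by (simp add: character_def flip: cis_mult)
qed

text \<open>The geometric rate is what \<open>riesz_fischer\<close> needs: increments of size
  \<open>(1 / 4) ^ k\<close> in squared L^2 norm have L^1 norms of order \<open>(1 / 2) ^ k\<close>,
  which are summable.\<close>

lemma exhausting_finite_sets: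
  fixes a :: "'i \<Rightarrow> real"
  assumes a: "a summable_on UNIV" and a0: "\<And>n. a n \<ge> 0"
  obtains F :: "nat \<Rightarrow> 'i set" where "\<And>k. finite (F k)" "\<And>k l. k \<le> l \<Longrightarrow> F k \<subseteq> F l"
    "\<And>k H. finite H \<Longrightarrow> H \<inter> F k = {} \<Longrightarrow> sum a H \<le> (1 / 4) ^ k"
proof -
  have "\<exists>F. finite F \<and> infsum a UNIV - sum a F < (1 / 4) ^ k" for k :: nat
  proof -
    have "(sum a \<longlongrightarrow> infsum a UNIV) (finite_subsets_at_top UNIV)" by (rule infsum_tendsto[OF a])
    then have "\<forall>\<^sub>F F in finite_subsets_at_top UNIV. infsum a UNIV - (1 / 4) ^ k < sum a F"
      by (rule order_tendstoD) simp
    then obtain F where "finite F" "infsum a UNIV - (1 / 4) ^ k < sum a F"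
      unfolding eventually_finite_subsets_at_top by blast
    then show ?thesis by (intro exI[of _ F]) auto
  qed
  then obtain F where F: "\<And>k. finite (F k)" "\<And>k. infsum a UNIV - sum a (F k) < (1 / 4) ^ k" by metis
  show thesis
  proof (rule that[of "\<lambda>k. \<Union>i\<le>k. F i"])
    show "finite (\<Union>i\<le>k. F i)" for k using F by auto
    show "(\<Union>i\<le>k. F i) \<subseteq> (\<Union>i\<le>l. F i)" if "k \<le> l" for k l using that by (intro UN_mono) auto
    show "sum a H \<le> (1 / 4) ^ k" if H: "finite H" "H \<inter> (\<Union>i\<le>k. F i) = {}" for k H
    proof -
      have "H \<inter> F k = {}" using H(2) by blast
      then have "sum a H + sum a (F k) = sum a (H \<union> F k)" using H(1) F(1) by (simp add: sum.union_disjoint)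
      also have "\<dots> \<le> infsum a UNIV" using H(1) F(1) a0 by (intro finite_sum_le_infsum a) auto
      finally show ?thesis using F(2)[of k] by linarith
    qed
  qed
qed

lemma trig_sum_diff:
  assumes "finite F" "G \<subseteq> F"
  shows "trig_sum a F x - trig_sum a G x = trig_sum a (F - G) x"
  using assms by (simp add: trig_sum_def sum_diff)

text \<open>The limit is built pointwise from a rapidly convergent sequence of partial sums, not as
  an abstract element of L^2, because a representative on the whole space is needed that is Borel
  measurable and periodic at every point.\<close>

theorem riesz_fischer:
  fixes a :: "int ^ 'n \<Rightarrow> complex"
  assumes a: "(\<lambda>n. (cmod (a n))\<^sup>2) summable_on UNIV"
  obtains g where "g \<in> borel_measurable borel" "\<And>x i. g (x + (2 * pi) *\<^sub>R axis i 1) = g x"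
    "g \<in> L2_complex" "fcoeff g = a"
    "(LINT x|torus. (cmod (g x))\<^sup>2) \<le> torus_volume TYPE('n) * (\<Sum>\<^sub>\<infinity>n. (cmod (a n))\<^sup>2)"
proof -
  define V where "V = torus_volume TYPE('n)"
  have V: "V > 0" by (simp add: V_def)
  obtain F where F: "\<And>k::nat. finite (F k)" "\<And>k l. k \<le> l \<Longrightarrow> F k \<subseteq> F l"
    "\<And>k H. finite H \<Longrightarrow> H \<inter> F k = {} \<Longrightarrow> (\<Sum>n\<in>H. (cmod (a n))\<^sup>2) \<le> (1 / 4) ^ k"
    using exhausting_finite_sets[OF a] by auto
  define S where "S k = trig_sum a (F k)" for k
  have SL2: "S k \<in> L2_complex" for k unfolding S_def by (rule L2_complex_trig_sum)
  have Sm: "S k \<in> borel_measurable torus" for k using SL2 by (simp add: L2_complex_def)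
  have dS: "(LINT x|torus. (cmod (S l x - S k x))\<^sup>2) \<le> V * (1 / 4) ^ k" if "k \<le> l" for k l
  proof -
    have "(LINT x|torus. (cmod (S l x - S k x))\<^sup>2) = V * (\<Sum>n\<in>F l - F k. (cmod (a n))\<^sup>2)"
      unfolding S_def trig_sum_diff[OF F(1) F(2)[OF that]] V_def by (rule integral_norm_trig_sum) (simp add: F)
    also have "\<dots> \<le> V * (1 / 4) ^ k" using V F(1) by (intro mult_left_mono F(3)) auto
    finally show ?thesis .
  qed
  have dSi: "integrable torus (\<lambda>x. (cmod (S l x - S k x))\<^sup>2)" for k l
    using L2_complex_diff[OF SL2 SL2, of l k] by (simp add: L2_complex_def)
  \<comment> \<open>From L^2 to L^1 on a space of finite measure, by
    \<open>2 y \<le> 2 ^ (- k) + 2 ^ k y ^ 2\<close>, whose two parts have integrals of the same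
    size.\<close>
  have step: "(\<integral>\<^sup>+x. ennreal (cmod (S (Suc k) x - S k x)) \<partial>torus) \<le> ennreal (V * (1 / 2) ^ k)" for k
  proof -
    have i1: "integrable torus (\<lambda>x. cmod (S (Suc k) x - S k x))"
      using L2_complex_integrable[OF L2_complex_diff[OF SL2 SL2]] by (rule integrable_norm)
    have i2: "integrable torus (\<lambda>x. ((1 / 2) ^ k + 2 ^ k * (cmod (S (Suc k) x - S k x))\<^sup>2) / 2)"
      by (intro integrable_divide Bochner_Integration.integrable_add integrable_mult_right dSi
          finite_measure.integrable_const[OF finite_measure_torus])
    have "(LINT x|torus. cmod (S (Suc k) x - S k x)) \<le> (LINT x|torus. ((1 / 2) ^ k + 2 ^ k * (cmod (S (Suc k) x - S k x))\<^sup>2) / 2)"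
    proof (rule integral_mono[OF i1 i2])
      fix x
      have "2 * cmod (S (Suc k) x - S k x) * 2 ^ k * 1 \<le> 1 + (2 ^ k * cmod (S (Suc k) x - S k x))\<^sup>2"
        using sum_squares_bound[of 1 "2 ^ k * cmod (S (Suc k) x - S k x)"] by (simp add: mult_ac)
      then show "cmod (S (Suc k) x - S k x) \<le> ((1 / 2) ^ k + 2 ^ k * (cmod (S (Suc k) x - S k x))\<^sup>2) / 2"
        by (simp add: field_simps power2_eq_square)
    qed
    also have "\<dots> = ((1 / 2) ^ k * measure torus (space torus :: (real ^ 'n) set) + 2 ^ k * (LINT x|torus. (cmod (S (Suc k) x - S k x))\<^sup>2)) / 2"
    proof -
      have "integrable (torus :: (real ^ 'n) measure) (\<lambda>x. (1 / 2 :: real) ^ k)"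
        by (rule finite_measure.integrable_const[OF finite_measure_torus])
      then show ?thesis using dSi[of "Suc k" k] by simp
    qed
    also have "\<dots> \<le> ((1 / 2) ^ k * V + 2 ^ k * (V * (1 / 4) ^ k)) / 2"
    proof -
      have "measure torus (space torus :: (real ^ 'n) set) = V"
      proof -
        have "complex_of_real (measure torus (space torus :: (real ^ 'n) set)) = complex_of_real V"
          using integral_character[of "0 :: int ^ 'n"] by (simp add: scaleR_conv_of_real V_def)
        then show ?thesis by (simp only: of_real_eq_iff)
      qed
      then show ?thesis using dS[of k "Suc k"] by (intro divide_right_mono add_mono mult_left_mono) auto
    qed
    also have "\<dots> = V * (1 / 2) ^ k"
    proof -
      have "(2::real) ^ k * (1 / 4) ^ k = (1 / 2) ^ k" by (simp flip: power_mult_distrib)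
      then show ?thesis by (simp add: algebra_simps)
    qed
    finally show ?thesis
      using i1 by (subst nn_integral_eq_integral) (auto intro!: ennreal_leI)
  qed
  have "(\<integral>\<^sup>+x. (\<Sum>k. ennreal (cmod (S (Suc k) x - S k x))) \<partial>torus) \<noteq> \<infinity>"
  proof -
    have "(\<integral>\<^sup>+x. (\<Sum>k. ennreal (cmod (S (Suc k) x - S k x))) \<partial>torus)
        = (\<Sum>k. \<integral>\<^sup>+x. ennreal (cmod (S (Suc k) x - S k x)) \<partial>torus)"
      using Sm by (intro nn_integral_suminf) auto
    also have "\<dots> \<le> (\<Sum>k. ennreal (V * (1 / 2) ^ k))" by (intro suminf_le step) auto
    also have "\<dots> = ennreal (\<Sum>k. V * (1 / 2) ^ k)"
      using V by (intro suminf_ennreal_eq) (auto intro!: summable_sums summable_mult summable_geometric)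
    finally show ?thesis by (auto simp: top_unique)
  qed
  then have "AE x in torus. (\<Sum>k. ennreal (cmod (S (Suc k) x - S k x))) \<noteq> \<infinity>"
    using Sm by (intro nn_integral_PInf_AE) auto
  then have conv: "AE x in torus. convergent (\<lambda>k. S k x)"
  proof eventually_elim
    case (elim x)
    then have "summable (\<lambda>k. cmod (S (Suc k) x - S k x))"
      by (intro summable_suminf_not_top) auto
    then have "summable (\<lambda>k. S (Suc k) x - S k x)" by (rule summable_norm_cancel)
    then have "convergent (\<lambda>N. \<Sum>k<N. S (Suc k) x - S k x)" by (simp add: summable_iff_convergent)
    then have "convergent (\<lambda>N. S N x - S 0 x)" by (simp only: sum_lessThan_telescope[where f = "\<lambda>k. S k x"])
    then show ?case using convergent_add[OF _ convergent_const[of "S 0 x"]] by force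
  qed
  \<comment> \<open>\<open>lim\<close> has a value even where the sequence diverges, so
    \<open>g\<close> is defined everywhere and inherits periodicity and Borel measurability from the
    partial sums without an exceptional set.\<close>
  define g where "g x = lim (\<lambda>k. S k x)" for x
  have gb: "g \<in> borel_measurable borel"
    unfolding g_def S_def
    by (intro borel_measurable_lim_metric borel_measurable_continuous_onI continuous_on_trig_sum)
  have gm: "g \<in> borel_measurable torus"
    unfolding g_def using Sm by (intro borel_measurable_lim_metric)
  have gp: "g (x + (2 * pi) *\<^sub>R axis i 1) = g x" for x i
    by (simp add: g_def S_def trig_sum_def character_periodic)
  \<comment> \<open>Almost everywhere convergence does not yet give convergence in L^2; Fatou's
    lemma in the second index of the Cauchy estimate does.\<close>
  have fatou: "(\<integral>\<^sup>+x. ennreal ((cmod (g x - S k x))\<^sup>2) \<partial>torus) \<le> ennreal (V * (1 / 4) ^ k)" for k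
  proof -
    have "(\<integral>\<^sup>+x. ennreal ((cmod (g x - S k x))\<^sup>2) \<partial>torus)
        = (\<integral>\<^sup>+x. liminf (\<lambda>l. ennreal ((cmod (S l x - S k x))\<^sup>2)) \<partial>torus)"
    proof (rule nn_integral_cong_AE, use conv in eventually_elim)
      case (elim x)
      then have "(\<lambda>l. S l x) \<longlonglongrightarrow> g x" unfolding g_def by (simp add: convergent_LIMSEQ_iff)
      then have "(\<lambda>l. ennreal ((cmod (S l x - S k x))\<^sup>2)) \<longlonglongrightarrow> ennreal ((cmod (g x - S k x))\<^sup>2)"
        by (intro tendsto_intros)
      then show ?case using lim_imp_Liminf[OF sequentially_bot] by metis
    qed
    also have "\<dots> \<le> liminf (\<lambda>l. \<integral>\<^sup>+x. ennreal ((cmod (S l x - S k x))\<^sup>2) \<partial>torus)"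
      using Sm by (intro nn_integral_liminf) auto
    also have "\<dots> \<le> liminf (\<lambda>l. ennreal (V * (1 / 4) ^ k))"
    proof (rule Liminf_mono, unfold eventually_sequentially, intro exI[of _ k] allI impI)
      fix l assume "k \<le> l"
      then show "(\<integral>\<^sup>+x. ennreal ((cmod (S l x - S k x))\<^sup>2) \<partial>torus) \<le> ennreal (V * (1 / 4) ^ k)"
        using dSi[of l k] dS[of k l] by (subst nn_integral_eq_integral) (auto intro!: ennreal_leI)
    qed
    also have "\<dots> = ennreal (V * (1 / 4) ^ k)" by (simp add: Liminf_const)
    finally show ?thesis .
  qed
  have gSi: "integrable torus (\<lambda>x. (cmod (g x - S k x))\<^sup>2)" for k
  proof (rule integrableI_bounded)
    show "(\<lambda>x. (cmod (g x - S k x))\<^sup>2) \<in> borel_measurable torus" using gm Sm by auto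
    show "(\<integral>\<^sup>+x. ennreal (norm ((cmod (g x - S k x))\<^sup>2)) \<partial>torus) < \<infinity>"
      using fatou[of k] by (simp add: le_less_trans[OF _ ennreal_less_top])
  qed
  have gS: "(\<lambda>x. g x - S k x) \<in> L2_complex" for k
    using gSi gm Sm by (auto simp: L2_complex_def)
  have gL2: "g \<in> L2_complex" using L2_complex_add[OF gS[of 0] SL2[of 0]] by simp
  have gS': "(LINT x|torus. (cmod (g x - S k x))\<^sup>2) \<le> V * (1 / 4) ^ k" for k
    using fatou[of k] V gSi[of k] by (subst (asm) nn_integral_eq_integral) (auto simp: ennreal_le_iff)
  have fc: "fcoeff g n = a n" for n
  proof -
    have "cmod (fcoeff g n - a n) \<le> 2 * (1 / 2) ^ k" for k
    proof -
      have "V * (cmod (fcoeff (\<lambda>x. g x - S k x) n))\<^sup>2 \<le> V * (1 / 4) ^ k"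
        using order_trans[OF bessel[OF gS, of "{n}"] gS'] by (simp add: V_def)
      then have "(cmod (fcoeff (\<lambda>x. g x - S k x) n))\<^sup>2 \<le> ((1 / 2) ^ k)\<^sup>2"
        using V by (simp add: power2_eq_square flip: power_mult_distrib)
      then have 1: "cmod (fcoeff (\<lambda>x. g x - S k x) n) \<le> (1 / 2) ^ k" by (rule power2_le_imp_le) simp
      have 2: "cmod (fcoeff (S k) n - a n) \<le> (1 / 2) ^ k"
      proof (cases "n \<in> F k")
        case False
        then have "(cmod (a n))\<^sup>2 \<le> (1 / 4) ^ k" using F(3)[of "{n}" k] by simp
        also have "(1 / 4 :: real) ^ k = ((1 / 2) ^ k)\<^sup>2" by (simp add: power2_eq_square flip: power_mult_distrib)
        finally have "cmod (a n) \<le> (1 / 2) ^ k" by (rule power2_le_imp_le) simp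
        then show ?thesis using False F(1) by (simp add: S_def fcoeff_trig_sum)
      qed (use F(1) in \<open>simp add: S_def fcoeff_trig_sum\<close>)
      have "fcoeff (\<lambda>x. g x - S k x) n = fcoeff g n - fcoeff (S k) n"
        by (intro fcoeff_diff L2_complex_integrable gL2 SL2)
      then have eq: "fcoeff g n - a n = fcoeff (\<lambda>x. g x - S k x) n + (fcoeff (S k) n - a n)" by simp
      show ?thesis unfolding eq
        using 1 2 norm_triangle_ineq[of "fcoeff (\<lambda>x. g x - S k x) n" "fcoeff (S k) n - a n"] by linarith
    qed
    then have "\<exists>N. \<forall>k\<ge>N. cmod (fcoeff g n - a n) \<le> 2 * (1 / 2) ^ k" by blast
    moreover have "(\<lambda>k. 2 * (1 / 2 :: real) ^ k) \<longlonglongrightarrow> 2 * 0" by (intro tendsto_intros LIMSEQ_realpow_zero) auto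
    ultimately have "cmod (fcoeff g n - a n) \<le> 2 * 0" by (rule LIMSEQ_le_const[rotated])
    then show ?thesis by simp
  qed
  have "(LINT x|torus. (cmod (g x))\<^sup>2) \<le> V * (\<Sum>\<^sub>\<infinity>n. (cmod (a n))\<^sup>2) + V * (1 / 4) ^ k" for k
  proof -
    have "(LINT x|torus. (cmod (g x - S k x))\<^sup>2) = (LINT x|torus. (cmod (g x))\<^sup>2) - V * (\<Sum>n\<in>F k. (cmod (a n))\<^sup>2)"
      using integral_norm_diff_trig_sum[OF gL2 F(1)[of k]] by (simp add: S_def V_def fc[abs_def])
    moreover have "V * (\<Sum>n\<in>F k. (cmod (a n))\<^sup>2) \<le> V * (\<Sum>\<^sub>\<infinity>n. (cmod (a n))\<^sup>2)"
      using V F(1) by (intro mult_left_mono finite_sum_le_infsum a) auto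
    ultimately show ?thesis using gS'[of k] by linarith
  qed
  then have "\<exists>N. \<forall>k\<ge>N. (LINT x|torus. (cmod (g x))\<^sup>2) \<le> V * (\<Sum>\<^sub>\<infinity>n. (cmod (a n))\<^sup>2) + V * (1 / 4) ^ k" by blast
  moreover have "(\<lambda>k. V * (\<Sum>\<^sub>\<infinity>n. (cmod (a n))\<^sup>2) + V * (1 / 4 :: real) ^ k) \<longlonglongrightarrow> V * (\<Sum>\<^sub>\<infinity>n. (cmod (a n))\<^sup>2) + V * 0"
    by (intro tendsto_intros LIMSEQ_realpow_zero) auto
  ultimately have "(LINT x|torus. (cmod (g x))\<^sup>2) \<le> V * (\<Sum>\<^sub>\<infinity>n. (cmod (a n))\<^sup>2) + V * 0"
    by (rule LIMSEQ_le_const[rotated])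
  then show thesis using that[OF gb gp gL2 _] fc by (auto simp: V_def)
qed

lemma bessel_summable:
  fixes f :: "real ^ 'n \<Rightarrow> complex"
  assumes "f \<in> L2_complex"
  shows "(\<lambda>n. (cmod (fcoeff f n))\<^sup>2) summable_on UNIV"
    and "torus_volume TYPE('n) * (\<Sum>\<^sub>\<infinity>n. (cmod (fcoeff f n))\<^sup>2) \<le> (LINT x|torus. (cmod (f x))\<^sup>2)"
proof -
  have b: "(\<Sum>n\<in>F. (cmod (fcoeff f n))\<^sup>2) \<le> (LINT x|torus. (cmod (f x))\<^sup>2) / torus_volume TYPE('n)" if "finite F" for F
    using bessel[OF assms that] by (simp add: field_simps)
  show s: "(\<lambda>n. (cmod (fcoeff f n))\<^sup>2) summable_on UNIV"
    by (rule nonneg_bdd_above_summable_on) (auto intro!: bdd_aboveI2 b)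
  have "(\<Sum>\<^sub>\<infinity>n. (cmod (fcoeff f n))\<^sup>2) \<le> (LINT x|torus. (cmod (f x))\<^sup>2) / torus_volume TYPE('n)"
    by (rule infsum_le_finite_sums[OF s]) (rule b)
  then show "torus_volume TYPE('n) * (\<Sum>\<^sub>\<infinity>n. (cmod (fcoeff f n))\<^sup>2) \<le> (LINT x|torus. (cmod (f x))\<^sup>2)"
    by (simp add: field_simps)
qed

lemma fcoeff_eq_imp_AE_eq:
  assumes "f \<in> L2_complex" "g \<in> L2_complex" "fcoeff f = fcoeff g"
  shows "AE x in torus. f x = g x"
proof -
  have "fcoeff_null (\<lambda>x. f x - g x)"
    using assms by (auto simp: fcoeff_null_def fcoeff_diff L2_complex_integrable)
  from fcoeff_null_imp_AE_zero[OF this] show ?thesis by simp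
qed

text \<open>Bessel gives one inequality. For the other, the function built by
  \<open>riesz_fischer\<close> from the coefficients of \<open>f\<close> has norm at most their
  square sum, and by uniqueness it agrees with \<open>f\<close> almost everywhere.\<close>

theorem parseval:
  fixes f :: "real ^ 'n \<Rightarrow> complex"
  assumes f: "f \<in> L2_complex"
  shows "((\<lambda>n. (cmod (fcoeff f n))\<^sup>2) has_sum ((LINT x|torus. (cmod (f x))\<^sup>2) / torus_volume TYPE('n))) UNIV"
proof -
  obtain g where g: "g \<in> L2_complex" "fcoeff g = fcoeff f"
    "(LINT x|torus. (cmod (g x))\<^sup>2) \<le> torus_volume TYPE('n) * (\<Sum>\<^sub>\<infinity>n. (cmod (fcoeff f n))\<^sup>2)"
    using riesz_fischer[OF bessel_summable(1)[OF f]] by metis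
  have "AE x in torus. f x = g x" by (rule fcoeff_eq_imp_AE_eq) (simp_all add: f g)
  then have "(LINT x|torus. (cmod (f x))\<^sup>2) = (LINT x|torus. (cmod (g x))\<^sup>2)"
    using f g(1) by (intro integral_cong_AE) (auto simp: L2_complex_def elim: eventually_mono)
  then have "(LINT x|torus. (cmod (f x))\<^sup>2) = torus_volume TYPE('n) * (\<Sum>\<^sub>\<infinity>n. (cmod (fcoeff f n))\<^sup>2)"
    using g(3) bessel_summable(2)[OF f] by simp
  then have "(LINT x|torus. (cmod (f x))\<^sup>2) / torus_volume TYPE('n) = (\<Sum>\<^sub>\<infinity>n. (cmod (fcoeff f n))\<^sup>2)"
    by simp
  then show ?thesis using has_sum_infsum[OF bessel_summable(1)[OF f]] by metis
qed

lemma polarization: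
  "complex_of_real ((cmod (z + w))\<^sup>2) - of_real ((cmod (z + (-1) * w))\<^sup>2)
    + \<i> * (of_real ((cmod (z + \<i> * w))\<^sup>2)) - \<i> * of_real ((cmod (z + (- \<i>) * w))\<^sup>2) = 4 * (z * cnj w)"
  unfolding complex_norm_square by (simp add: algebra_simps)

text \<open>Polarization: Parseval is applied to \<open>f + c * g\<close> for the four fourth roots
  of unity \<open>c\<close>, and the four identities are combined linearly.\<close>

lemma parseval_inner:
  fixes f g :: "real ^ 'n \<Rightarrow> complex"
  assumes f: "f \<in> L2_complex" and g: "g \<in> L2_complex"
  shows "((\<lambda>n. fcoeff f n * cnj (fcoeff g n)) has_sum ((LINT x|torus. f x * cnj (g x)) / of_real (torus_volume TYPE('n)))) UNIV"
proof -
  define V where "V = torus_volume TYPE('n)"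
  define N where "N c = (LINT x|torus. (cmod (f x + c * g x))\<^sup>2)" for c
  have i: "integrable torus (\<lambda>x. (cmod (f x + c * g x))\<^sup>2)" for c
    using L2_complex_add[OF f L2_complex_cmult[OF g]] by (simp add: L2_complex_def)
  have ic: "integrable torus (\<lambda>x. complex_of_real ((cmod (f x + c * g x))\<^sup>2))" for c
    using i[of c] by (subst complex_of_real_integrable_eq)
  have "((\<lambda>n. (cmod (fcoeff (\<lambda>x. f x + c * g x) n))\<^sup>2) has_sum (N c / V)) UNIV" for c
    unfolding N_def V_def by (intro parseval L2_complex_add f L2_complex_cmult g)
  moreover have "fcoeff (\<lambda>x. f x + c * g x) n = fcoeff f n + c * fcoeff g n" for c n
    using fcoeff_add[OF L2_complex_integrable[OF f] L2_complex_integrable[OF L2_complex_cmult[OF g]]]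
    by (simp add: fcoeff_cmult)
  ultimately have h: "((\<lambda>n. (cmod (fcoeff f n + c * fcoeff g n))\<^sup>2) has_sum (N c / V)) UNIV" for c by simp
  have hc: "((\<lambda>n. complex_of_real ((cmod (fcoeff f n + c * fcoeff g n))\<^sup>2)) has_sum of_real (N c / V)) UNIV" for c
    by (rule has_sum_of_real[OF h])
  have d: "((\<lambda>n. - b n) has_sum (- B)) UNIV" if "(b has_sum B) UNIV" for b :: "int ^ 'n \<Rightarrow> complex" and B
    using that by (simp add: has_sum_uminus)
  have "((\<lambda>n. complex_of_real ((cmod (fcoeff f n + 1 * fcoeff g n))\<^sup>2) + - of_real ((cmod (fcoeff f n + (-1) * fcoeff g n))\<^sup>2)
    + \<i> * (of_real ((cmod (fcoeff f n + \<i> * fcoeff g n))\<^sup>2)) + - (\<i> * of_real ((cmod (fcoeff f n + (- \<i>) * fcoeff g n))\<^sup>2)))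
    has_sum (of_real (N 1 / V) + - of_real (N (-1) / V) + \<i> * of_real (N \<i> / V) + - (\<i> * of_real (N (-\<i>) / V)))) UNIV"
    by (intro has_sum_add d has_sum_cmult_right hc)
  then have "((\<lambda>n. 4 * (fcoeff f n * cnj (fcoeff g n)))
    has_sum (of_real (N 1 / V) - of_real (N (-1) / V) + \<i> * of_real (N \<i> / V) - \<i> * of_real (N (-\<i>) / V))) UNIV"
    by (simp add: polarization[simplified])
  moreover have "of_real (N 1) - of_real (N (-1)) + \<i> * of_real (N \<i>) - \<i> * of_real (N (-\<i>))
      = 4 * (LINT x|torus. f x * cnj (g x))"
  proof -
    have "4 * (LINT x|torus. f x * cnj (g x)) = (LINT x|torus. 4 * (f x * cnj (g x)))" by simp
    also have "\<dots> = (LINT x|torus. complex_of_real ((cmod (f x + 1 * g x))\<^sup>2) - of_real ((cmod (f x + (-1) * g x))\<^sup>2)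
      + \<i> * (of_real ((cmod (f x + \<i> * g x))\<^sup>2)) - \<i> * of_real ((cmod (f x + (- \<i>) * g x))\<^sup>2))"
      by (simp only: polarization mult_1_left)
    also have "\<dots> = of_real (N 1) - of_real (N (-1)) + \<i> * of_real (N \<i>) - \<i> * of_real (N (-\<i>))"
      unfolding N_def integral_complex_of_real[symmetric]
      using ic[of 1] ic[of "-1"] ic[of \<i>] ic[of "-\<i>"]
      by (simp only: Bochner_Integration.integral_add Bochner_Integration.integral_diff integral_mult_right_zero
          integrable_mult_right Bochner_Integration.integrable_add Bochner_Integration.integrable_diff)
    finally show ?thesis by simp
  qed
  ultimately have "((\<lambda>n. 4 * (fcoeff f n * cnj (fcoeff g n))) has_sum (4 * ((LINT x|torus. f x * cnj (g x)) / of_real V))) UNIV"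
    by (simp add: add_divide_distrib[symmetric] diff_divide_distrib[symmetric])
  from has_sum_cmult_right[OF this, of "1/4"] show ?thesis unfolding V_def[symmetric] by simp
qed

lemma fcoeff_cnj: "fcoeff (\<lambda>x. cnj (f x)) n = cnj (fcoeff f (- n))"
proof -
  have "(LINT x|torus. cnj (f x) * character (- n) x) = cnj (LINT x|torus. f x * character n x)"
    by (subst Bochner_Integration.integral_cnj[symmetric]) (simp add: character_minus)
  then show ?thesis by (simp add: fcoeff_def)
qed

text \<open>A coefficient of the product is an inner product of \<open>f\<close> with the conjugate
  of \<open>g\<close> times a character, and the coefficients of that second function are shifted,
  conjugated coefficients of \<open>g\<close>. The product itself need only be integrable.\<close>

theorem fcoeff_mult:
  fixes f g :: "real ^ 'n \<Rightarrow> complex"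
  assumes f: "f \<in> L2_complex" and g: "g \<in> L2_complex"
  shows "fcoeff (\<lambda>x. f x * g x) n = conv (fcoeff f) (fcoeff g) n"
proof -
  define h where "h x = cnj (g x) * character n x" for x
  have h: "h \<in> L2_complex" unfolding h_def by (intro L2_complex_mult_character L2_complex_cnj g)
  have "((\<lambda>m. fcoeff f m * cnj (fcoeff h m)) has_sum ((LINT x|torus. f x * cnj (h x)) / of_real (torus_volume TYPE('n)))) UNIV"
    by (rule parseval_inner[OF f h])
  moreover have "cnj (fcoeff h m) = fcoeff g (n - m)" for m
    unfolding h_def fcoeff_mult_character fcoeff_cnj by simp
  moreover have "(LINT x|torus. f x * cnj (h x)) / of_real (torus_volume TYPE('n)) = fcoeff (\<lambda>x. f x * g x) n"
    by (simp add: fcoeff_def h_def character_minus mult.assoc)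
  ultimately show ?thesis unfolding conv_def by (simp add: infsumI)
qed

section \<open>Dictionary between Sobolev representatives and coefficient sequences\<close>

subsection \<open>Fourier coefficients of real functions and of weak derivatives\<close>

definition rcoeff :: "(real ^ 'n \<Rightarrow> real) \<Rightarrow> int ^ 'n \<Rightarrow> complex" where
  "rcoeff u = fcoeff (\<lambda>x. of_real (u x))"

text \<open>The Fourier symbol of the iterated derivative \<open>pdiff js\<close>.\<close>

definition freq_prod :: "'n list \<Rightarrow> int ^ 'n \<Rightarrow> complex" where
  "freq_prod js n = (\<Prod>j\<leftarrow>js. \<i> * of_int (n $ j))"

lemma L2_torus_borel: "u \<in> L2_torus \<Longrightarrow> u \<in> borel_measurable torus"
  unfolding L2_torus_def torus_def by (auto intro: measurable_restrict_space1)

lemma L2_torus_complex: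
  assumes "u \<in> L2_torus"
  shows "(\<lambda>x. complex_of_real (u x)) \<in> L2_complex"
  using assms L2_torus_borel[OF assms] by (auto simp: L2_complex_def L2_torus_def)

lemma L2_torus_integrable: "u \<in> L2_torus \<Longrightarrow> integrable torus u"
  using L2_complex_integrable[OF L2_torus_complex, of u] by (simp add: complex_of_real_integrable_eq)

lemma L2_real_integrable_mult:
  assumes "u \<in> borel_measurable torus" "integrable torus (\<lambda>x. (u x)\<^sup>2)"
    "v \<in> borel_measurable torus" "integrable torus (\<lambda>x. (v x)\<^sup>2)"
  shows "integrable torus (\<lambda>x. u x * v x :: real)"
proof -
  have "(\<lambda>x. complex_of_real (u x)) \<in> L2_complex" "(\<lambda>x. complex_of_real (v x)) \<in> L2_complex"
    using assms by (auto simp: L2_complex_def)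
  from L2_complex_integrable_mult[OF this] show ?thesis
    by (simp add: complex_of_real_integrable_eq flip: of_real_mult)
qed

lemma L2_torus_integrable_mult:
  "u \<in> L2_torus \<Longrightarrow> v \<in> L2_torus \<Longrightarrow> integrable torus (\<lambda>x. u x * v x)"
  by (rule L2_real_integrable_mult) (auto intro: L2_torus_borel simp: L2_torus_def)

lemma L2_torus_cmult: "u \<in> L2_torus \<Longrightarrow> (\<lambda>x. c * u x) \<in> L2_torus"
  by (auto simp: L2_torus_def periodic_def power_mult_distrib)

lemma L2_torus_add:
  assumes "u \<in> L2_torus" "v \<in> L2_torus"
  shows "(\<lambda>x. u x + v x) \<in> L2_torus"
proof -
  have "integrable torus (\<lambda>x. (u x + v x)\<^sup>2)"
    using L2_complex_add[OF L2_torus_complex[OF assms(1)] L2_torus_complex[OF assms(2)]]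
    by (simp add: L2_complex_def flip: of_real_add)
  then show ?thesis using assms by (auto simp: L2_torus_def periodic_def)
qed

lemma rcoeff_add: "u \<in> L2_torus \<Longrightarrow> v \<in> L2_torus \<Longrightarrow> rcoeff (\<lambda>x. u x + v x) n = rcoeff u n + rcoeff v n"
  by (simp add: rcoeff_def fcoeff_add L2_complex_integrable L2_torus_complex)

lemma rcoeff_cmult: "rcoeff (\<lambda>x. c * u x) n = of_real c * rcoeff u n"
  by (simp add: rcoeff_def fcoeff_cmult)

lemma rcoeff_minus_freq: "rcoeff u (- n) = cnj (rcoeff u n)"
  using fcoeff_cnj[of "\<lambda>x. of_real (u x)" "- n"] by (simp add: rcoeff_def)

lemma rcoeff_cong_AE:
  assumes "AE x in torus. u x = v x" "u \<in> borel_measurable torus" "v \<in> borel_measurable torus"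
  shows "rcoeff u n = rcoeff v n"
  unfolding rcoeff_def using assms by (intro fcoeff_cong_AE) (auto elim: eventually_mono)

lemma rcoeff_0:
  "rcoeff u 0 = of_real (LINT x|torus. u x) / of_real (torus_volume TYPE('n))" for u :: "real ^ 'n \<Rightarrow> real"
  by (simp add: rcoeff_def fcoeff_def)

lemma rcoeff_mult:
  "u \<in> L2_torus \<Longrightarrow> v \<in> L2_torus \<Longrightarrow> rcoeff (\<lambda>x. u x * v x) n = conv (rcoeff u) (rcoeff v) n"
  using fcoeff_mult[OF L2_torus_complex L2_torus_complex, of u v n] by (simp add: rcoeff_def)

lemma parseval_real:
  fixes u :: "real ^ 'n \<Rightarrow> real"
  assumes "u \<in> L2_torus"
  shows "((\<lambda>n. (cmod (rcoeff u n))\<^sup>2) has_sum ((LINT x|torus. (u x)\<^sup>2) / torus_volume TYPE('n))) UNIV"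
  using parseval[OF L2_torus_complex[OF assms]] by (simp add: rcoeff_def)

text \<open>Test functions are real, so characters enter only through their real parts. The free
  complex factor \<open>c\<close> makes this family invariant under differentiation: a derivative
  merely multiplies \<open>c\<close>.\<close>

lemma has_derivative_Re_character:
  fixes n :: "int ^ 'n"
  shows "((\<lambda>x. Re (c * character n x)) has_derivative
    (\<lambda>h. Re (c * (\<i> * of_real (\<Sum>j\<in>UNIV. of_int (n $ j) * h $ j)) * character n x))) (at x)"
proof -
  let ?\<theta> = "\<lambda>x. \<Sum>j\<in>UNIV. of_int (n $ j) * x $ j"
  have \<theta>: "(?\<theta> has_derivative ?\<theta>) (at x)"
    by (intro has_derivative_sum has_derivative_mult_right bounded_linear_imp_has_derivative bounded_linear_vec_nth)
  have "(\<lambda>x. Re (c * character n x)) = (\<lambda>x. Re c * cos (?\<theta> x) - Im c * sin (?\<theta> x))"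
    by (auto simp: character_def)
  moreover have "((\<lambda>x. Re c * cos (f x) - Im c * sin (f x)) has_derivative
      (\<lambda>h. Re c * (- sin (f x) * f' h) - Im c * (cos (f x) * f' h))) (at x)"
    if "(f has_derivative f') (at x)" for f f' and x :: "real ^ 'n"
    using that by (auto intro!: derivative_eq_intros simp: mult_ac)
  from this[OF \<theta>] have "((\<lambda>x. Re c * cos (?\<theta> x) - Im c * sin (?\<theta> x)) has_derivative
      (\<lambda>h. Re c * (- sin (?\<theta> x) * ?\<theta> h) - Im c * (cos (?\<theta> x) * ?\<theta> h))) (at x)" .
  moreover have "(\<lambda>h. Re c * (- sin (?\<theta> x) * ?\<theta> h) - Im c * (cos (?\<theta> x) * ?\<theta> h))
      = (\<lambda>h. Re (c * (\<i> * of_real (?\<theta> h)) * character n x))"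
    by (rule ext) (simp add: character_def algebra_simps)
  ultimately show ?thesis by simp
qed

lemma iter_deriv_Re_character:
  "iter_deriv bs (\<lambda>x. Re (c * character n x))
    = (\<lambda>x. Re (c * (\<Prod>b\<leftarrow>bs. \<i> * of_real (\<Sum>j\<in>UNIV. of_int (n $ j) * b $ j)) * character n x))"
proof (induction bs)
  case (Cons b bs)
  show ?case
  proof
    fix x
    have "iter_deriv (b # bs) (\<lambda>x. Re (c * character n x)) x
        = frechet_derivative (iter_deriv bs (\<lambda>x. Re (c * character n x))) (at x) b"
      by (simp add: iter_deriv_def)
    also have "\<dots> = Re (c * (\<Prod>b\<leftarrow>bs. \<i> * of_real (\<Sum>j\<in>UNIV. of_int (n $ j) * b $ j))
        * (\<i> * of_real (\<Sum>j\<in>UNIV. of_int (n $ j) * b $ j)) * character n x)"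
      unfolding Cons.IH frechet_derivative_at[OF has_derivative_Re_character, symmetric] by simp
    finally show "iter_deriv (b # bs) (\<lambda>x. Re (c * character n x)) x = Re (c
        * (\<Prod>b\<leftarrow>b # bs. \<i> * of_real (\<Sum>j\<in>UNIV. of_int (n $ j) * b $ j)) * character n x)"
      by (simp add: mult_ac)
  qed
qed (simp add: iter_deriv_def)

lemma smooth_Re_character: "smooth (\<lambda>x. Re (c * character n x))"
  unfolding smooth_def iter_deriv_Re_character
  using has_derivative_Re_character differentiable_def by blast

lemma periodic_Re_character: "periodic (\<lambda>x. Re (c * character n x))"
  by (simp add: periodic_def character_periodic)

lemma sum_int_mult_axis: "(\<Sum>i\<in>UNIV. of_int (n $ i) * (axis j (1::real) :: real ^ 'n) $ i) = of_int (n $ j)"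
proof -
  have "(\<Sum>i\<in>UNIV. of_int (n $ i) * (axis j (1::real) :: real ^ 'n) $ i)
      = (\<Sum>i\<in>UNIV. if i = j then of_int (n $ j) else 0)"
    by (rule sum.cong) (auto simp: axis_def)
  then show ?thesis by simp
qed

lemma pdiff_Re_character: "pdiff js (\<lambda>x. Re (c * character n x)) = (\<lambda>x. Re (c * freq_prod js n * character n x))"
  by (simp only: pdiff_def iter_deriv_Re_character freq_prod_def list.map_comp o_def sum_int_mult_axis
      of_real_of_int_eq)

lemma freq_prod_minus: "freq_prod js (- n) = (- 1) ^ length js * freq_prod js n"
  by (induction js) (auto simp: freq_prod_def)

lemma integral_mult_Re_character:
  assumes "integrable torus u"
  shows "(LINT x|torus. u x * Re (c * character n x)) = Re (c * (LINT x|torus. of_real (u x) * character n x))"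
proof -
  have i: "integrable torus (\<lambda>x. complex_of_real (u x) * character n x)"
    using assms by (intro integrable_mult_character) (simp add: complex_of_real_integrable_eq)
  have "(LINT x|torus. u x * Re (c * character n x)) = (LINT x|torus. Re (c * (of_real (u x) * character n x)))"
    by (intro Bochner_Integration.integral_cong) (auto simp: algebra_simps)
  also have "\<dots> = Re (LINT x|torus. c * (of_real (u x) * character n x))"
    by (rule integral_Re) (intro integrable_mult_right i)
  finally show ?thesis using i by simp
qed

lemma complex_eq_if_Re_mult_eq:
  assumes "\<And>c. Re (c * z) = Re (c * w)"
  shows "z = w"
  using assms[of 1] assms[of "\<i>"] by (simp add: complex_eq_iff)

text \<open>The weak identity is tested with real parts of multiples of the character at
  \<open>- n\<close>. The sign from integrating by parts cancels against the parity of
  \<open>freq_prod js\<close> under \<open>n \<mapsto> - n\<close>.\<close>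

lemma weak_deriv_rcoeff:
  assumes u: "u \<in> L2_torus" and g: "is_weak_deriv js u g"
  shows "rcoeff g n = freq_prod js n * rcoeff u n"
proof -
  have gL: "g \<in> L2_torus" using g by (simp add: is_weak_deriv_def)
  have weak: "(LINT x|torus. g x * \<eta> x) = (-1) ^ length js * (LINT x|torus. u x * pdiff js \<eta> x)"
    if "smooth \<eta>" "periodic \<eta>" for \<eta>
    using g that by (simp add: is_weak_deriv_def)
  have "(LINT x|torus. of_real (g x) * character (- n) x)
      = freq_prod js n * (LINT x|torus. complex_of_real (u x) * character (- n) x)"
  proof (rule complex_eq_if_Re_mult_eq)
    fix c
    have "Re (c * (LINT x|torus. of_real (g x) * character (- n) x)) = (LINT x|torus. g x * Re (c * character (- n) x))"
      by (rule integral_mult_Re_character[symmetric]) (rule L2_torus_integrable[OF gL])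
    also have "\<dots> = (-1) ^ length js * (LINT x|torus. u x * Re (c * freq_prod js (- n) * character (- n) x))"
      by (simp only: weak[OF smooth_Re_character periodic_Re_character] pdiff_Re_character)
    also have "(LINT x|torus. u x * Re (c * freq_prod js (- n) * character (- n) x))
        = Re (c * freq_prod js (- n) * (LINT x|torus. of_real (u x) * character (- n) x))"
      by (rule integral_mult_Re_character) (rule L2_torus_integrable[OF u])
    also have "(-1) ^ length js * \<dots> = Re (c * (freq_prod js n * (LINT x|torus. of_real (u x) * character (- n) x)))"
      unfolding freq_prod_minus by (cases "even (length js)") (simp_all add: mult.assoc)
    finally show "Re (c * (LINT x|torus. of_real (g x) * character (- n) x))
        = Re (c * (freq_prod js n * (LINT x|torus. of_real (u x) * character (- n) x)))" .
  qed
  then show ?thesis by (simp add: rcoeff_def fcoeff_def)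
qed

text \<open>Prefixing an index \<open>j\<close> multiplies the squared symbol by the square of
  \<open>n $ j\<close>, and summing over \<open>j\<close> gives |n|^2. Summation over tuples spares
  all multinomial coefficients.\<close>

lemma sum_freq_prod_length:
  "(\<Sum>js | length js = l. (cmod (freq_prod js n))\<^sup>2) = freq_sq (n :: int ^ 'n::finite) ^ l"
proof (induction l)
  case (Suc l)
  have eq: "{js :: 'n list. length js = Suc l} = (\<lambda>(j, js). j # js) ` (UNIV \<times> {js. length js = l})"
    by (auto simp: length_Suc_conv)
  have "(\<Sum>js | length js = Suc l. (cmod (freq_prod js n))\<^sup>2)
      = (\<Sum>(j, js)\<in>UNIV \<times> {js. length js = l}. (real_of_int (n $ j))\<^sup>2 * (cmod (freq_prod js n))\<^sup>2)"
    unfolding eq by (subst sum.reindex) (auto simp: inj_on_def freq_prod_def norm_mult power_mult_distrib intro!: sum.cong)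
  also have "\<dots> = (\<Sum>j\<in>UNIV. \<Sum>js | length js = l. (real_of_int (n $ j))\<^sup>2 * (cmod (freq_prod js n))\<^sup>2)"
    by (simp add: sum.cartesian_product)
  also have "\<dots> = freq_sq n * freq_sq n ^ l"
    by (simp add: freq_sq_def sum_distrib_right Suc[unfolded freq_sq_def] flip: sum_distrib_left)
  finally show ?case by simp
qed (auto simp: freq_prod_def)

lemma finite_lists_le: "finite {js :: 'n::finite list. length js \<le> m}"
  using finite_lists_length_le[of "UNIV :: 'n set" m] by simp

lemma sum_freq_prod: "(\<Sum>js | length js \<le> m. (cmod (freq_prod js n))\<^sup>2) = weight m (n :: int ^ 'n::finite)"
proof -
  have "{js :: 'n list. length js \<le> m} = (\<Union>l\<in>{..m}. {js. length js = l})" by auto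
  then have "(\<Sum>js | length js \<le> m. (cmod (freq_prod js n))\<^sup>2) = (\<Sum>l\<le>m. \<Sum>js | length js = l. (cmod (freq_prod js n))\<^sup>2)"
    using finite_lists_length_eq[of "UNIV :: 'n set"] by (simp only:) (subst sum.UNION_disjoint, auto)
  then show ?thesis by (simp add: sum_freq_prod_length weight_def)
qed

lemma freq_prod_le_weight:
  "length js \<le> m \<Longrightarrow> (cmod (freq_prod js n))\<^sup>2 \<le> weight m (n :: int ^ 'n::finite)"
  unfolding sum_freq_prod[symmetric] using finite_lists_le by (intro member_le_sum) auto

lemma sobolev_L2: "u \<in> sobolev m \<Longrightarrow> u \<in> L2_torus"
  by (simp add: sobolev_def)

lemma wderiv_is_weak_deriv:
  assumes "u \<in> sobolev m" "length js \<le> m"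
  shows "is_weak_deriv js u (wderiv js u)"
proof -
  have "\<exists>g. is_weak_deriv js u g" using assms by (simp add: sobolev_def)
  then show ?thesis unfolding wderiv_def by (rule someI_ex)
qed

lemma wderiv_L2: "u \<in> sobolev m \<Longrightarrow> length js \<le> m \<Longrightarrow> wderiv js u \<in> L2_torus"
  using wderiv_is_weak_deriv by (auto simp: is_weak_deriv_def)

lemma rcoeff_wderiv:
  assumes "u \<in> sobolev m" "length js \<le> m"
  shows "rcoeff (wderiv js u) n = freq_prod js n * rcoeff u n"
  by (rule weak_deriv_rcoeff[OF sobolev_L2[OF assms(1)] wderiv_is_weak_deriv[OF assms]])

lemma sob_norm_nonneg: "sob_norm m u \<ge> 0"
  unfolding sob_norm_def by (auto intro!: sum_nonneg)

text \<open>Parseval for each weak derivative, followed by summation of the squared symbols. By the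
  choice of \<open>weight\<close> the result is an identity, up to the volume.\<close>

theorem sob_norm_rcoeff:
  fixes u :: "real ^ 'n \<Rightarrow> real"
  assumes "u \<in> sobolev m"
  shows "((\<lambda>n. weight m n * (cmod (rcoeff u n))\<^sup>2) has_sum ((sob_norm m u)\<^sup>2 / torus_volume TYPE('n))) UNIV"
proof -
  have "((\<lambda>n. \<Sum>js | length js \<le> m. (cmod (rcoeff (wderiv js u) n))\<^sup>2)
      has_sum (\<Sum>js | length js \<le> m. (LINT x|torus. (wderiv js u x)\<^sup>2) / torus_volume TYPE('n))) UNIV"
    by (rule has_sum_finite_sum[OF finite_lists_le]) (intro parseval_real wderiv_L2[OF assms], simp)
  also have "(\<Sum>js | length js \<le> m. (LINT x|torus. (wderiv js u x)\<^sup>2) / torus_volume TYPE('n))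
      = (sob_norm m u)\<^sup>2 / torus_volume TYPE('n)"
    by (simp add: sob_norm_def sum_nonneg flip: sum_divide_distrib)
  also have "(\<lambda>n. \<Sum>js | length js \<le> m. (cmod (rcoeff (wderiv js u) n))\<^sup>2) = (\<lambda>n. weight m n * (cmod (rcoeff u n))\<^sup>2)"
  proof
    fix n
    have "(\<Sum>js | length js \<le> m. (cmod (rcoeff (wderiv js u) n))\<^sup>2)
        = (\<Sum>js | length js \<le> m. (cmod (freq_prod js n))\<^sup>2 * (cmod (rcoeff u n))\<^sup>2)"
      by (intro sum.cong refl) (simp add: rcoeff_wderiv[OF assms] norm_mult power_mult_distrib)
    then show "(\<Sum>js | length js \<le> m. (cmod (rcoeff (wderiv js u) n))\<^sup>2) = weight m n * (cmod (rcoeff u n))\<^sup>2"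
      by (simp add: sum_freq_prod flip: sum_distrib_right)
  qed
  finally show ?thesis .
qed

lemma sobolev_coeff_bound:
  fixes u :: "real ^ 'n \<Rightarrow> real"
  assumes "u \<in> sobolev m"
  shows "coeff_bound m (rcoeff u) ((sob_norm m u)\<^sup>2 / torus_volume TYPE('n))"
proof (rule coeff_boundI)
  fix F :: "(int ^ 'n) set" assume "finite F"
  then show "(\<Sum>n\<in>F. weight m n * (cmod (rcoeff u n))\<^sup>2) \<le> (sob_norm m u)\<^sup>2 / torus_volume TYPE('n)"
    using finite_sum_le_has_sum[OF sob_norm_rcoeff[OF assms]] by (simp add: weight_nonneg)
qed

lemma sob_norm_le_coeff_bound:
  fixes u :: "real ^ 'n \<Rightarrow> real"
  assumes "u \<in> sobolev m" "coeff_bound m (rcoeff u) Q"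
  shows "(sob_norm m u)\<^sup>2 \<le> torus_volume TYPE('n) * Q"
proof -
  have "(sob_norm m u)\<^sup>2 / torus_volume TYPE('n) \<le> Q"
    by (rule has_sum_le_finite_sums[OF sob_norm_rcoeff[OF assms(1)]]) (rule coeff_boundD[OF assms(2)], assumption)
  then show ?thesis by (simp add: field_simps)
qed

subsection \<open>The Sobolev spaces as complete seminormed spaces\<close>

lemma smooth_pdiff_torus:
  fixes \<eta> :: "real ^ 'n \<Rightarrow> real"
  assumes "smooth \<eta>"
  shows "pdiff js \<eta> \<in> borel_measurable torus" and "integrable torus (\<lambda>x. (pdiff js \<eta> x)\<^sup>2)"
proof -
  have "set (map (\<lambda>j. axis j (1::real)) js) \<subseteq> (Basis :: (real ^ 'n) set)" by (auto simp: axis_in_Basis_iff)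
  then have "pdiff js \<eta> differentiable (at x)" for x
    using assms unfolding smooth_def pdiff_def by blast
  then have c: "continuous_on UNIV (pdiff js \<eta>)"
    using differentiable_imp_continuous_within continuous_on_eq_continuous_within by blast
  then show m: "pdiff js \<eta> \<in> borel_measurable torus" by (rule continuous_borel_measurable_torus)
  have "bounded (pdiff js \<eta> ` cbox 0 (\<chi> i. 2 * pi))"
    by (intro compact_imp_bounded compact_continuous_image continuous_on_subset[OF c] compact_cbox) auto
  then obtain B where B: "\<And>x. x \<in> cbox 0 (\<chi> i. 2 * pi) \<Longrightarrow> norm (pdiff js \<eta> x) \<le> B"
    unfolding bounded_iff by blast
  show "integrable torus (\<lambda>x. (pdiff js \<eta> x)\<^sup>2)"
  proof (rule finite_measure.integrable_const_bound[OF finite_measure_torus, of _ "B\<^sup>2"])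
    show "AE x in torus. norm ((pdiff js \<eta> x)\<^sup>2) \<le> B\<^sup>2"
    proof (rule AE_I2)
      fix x :: "real ^ 'n" assume "x \<in> space torus"
      then have "norm (pdiff js \<eta> x) \<le> B" using B by (simp add: space_torus)
      then have "(norm (pdiff js \<eta> x))\<^sup>2 \<le> B\<^sup>2" by (rule power_mono) simp
      then show "norm ((pdiff js \<eta> x)\<^sup>2) \<le> B\<^sup>2" by simp
    qed
  qed (use m in measurable)
qed

lemma L2_torus_integrable_mult_pdiff:
  assumes "u \<in> L2_torus" "smooth \<eta>"
  shows "integrable torus (\<lambda>x. u x * pdiff js \<eta> x)"
  by (rule L2_real_integrable_mult[OF L2_torus_borel[OF assms(1)] _ smooth_pdiff_torus[OF assms(2)]])
     (use assms(1) in \<open>simp add: L2_torus_def\<close>)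

lemma L2_torus_integrable_mult_smooth:
  "u \<in> L2_torus \<Longrightarrow> smooth \<eta> \<Longrightarrow> integrable torus (\<lambda>x. u x * \<eta> x)"
  using L2_torus_integrable_mult_pdiff[of u \<eta> "[]"] by (simp add: pdiff_def iter_deriv_def)

lemma is_weak_deriv_add:
  assumes "u \<in> L2_torus" "v \<in> L2_torus" and g: "is_weak_deriv js u g" and h: "is_weak_deriv js v h"
  shows "is_weak_deriv js (\<lambda>x. u x + v x) (\<lambda>x. g x + h x)"
  unfolding is_weak_deriv_def
proof (intro conjI allI impI)
  have gL: "g \<in> L2_torus" and hL: "h \<in> L2_torus" using g h by (auto simp: is_weak_deriv_def)
  show "(\<lambda>x. g x + h x) \<in> L2_torus" by (rule L2_torus_add[OF gL hL])
  fix \<eta> :: "real ^ 'a \<Rightarrow> real" assume \<eta>: "smooth \<eta> \<and> periodic \<eta>"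
  then have "(LINT x|torus. g x * \<eta> x) = (-1) ^ length js * (LINT x|torus. u x * pdiff js \<eta> x)"
    "(LINT x|torus. h x * \<eta> x) = (-1) ^ length js * (LINT x|torus. v x * pdiff js \<eta> x)"
    using g h by (auto simp: is_weak_deriv_def)
  then show "(LINT x|torus. (g x + h x) * \<eta> x) = (-1) ^ length js * (LINT x|torus. (u x + v x) * pdiff js \<eta> x)"
    using \<eta> gL hL assms by (simp add: distrib_right distrib_left L2_torus_integrable_mult_pdiff L2_torus_integrable_mult_smooth)
qed

lemma is_weak_deriv_cmult:
  assumes "is_weak_deriv js u g"
  shows "is_weak_deriv js (\<lambda>x. c * u x) (\<lambda>x. c * g x)"
  unfolding is_weak_deriv_def
proof (intro conjI allI impI)
  show "(\<lambda>x. c * g x) \<in> L2_torus" using assms by (simp add: is_weak_deriv_def L2_torus_cmult)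
  fix \<eta> :: "real ^ 'a \<Rightarrow> real" assume \<eta>: "smooth \<eta> \<and> periodic \<eta>"
  have "(LINT x|torus. c * g x * \<eta> x) = c * (LINT x|torus. g x * \<eta> x)" by (simp add: mult.assoc)
  also have "\<dots> = c * ((-1) ^ length js * (LINT x|torus. u x * pdiff js \<eta> x))"
    using assms \<eta> by (simp add: is_weak_deriv_def)
  also have "\<dots> = (-1) ^ length js * (LINT x|torus. c * u x * pdiff js \<eta> x)" by (simp add: mult.assoc)
  finally show "(LINT x|torus. c * g x * \<eta> x) = (-1) ^ length js * (LINT x|torus. c * u x * pdiff js \<eta> x)" .
qed

lemma sobolev_add:
  assumes "u \<in> sobolev m" "v \<in> sobolev m"
  shows "(\<lambda>x. u x + v x) \<in> sobolev m"
  unfolding sobolev_def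
proof (intro CollectI conjI allI impI)
  have u: "u \<in> L2_torus" and v: "v \<in> L2_torus" using assms by (auto intro: sobolev_L2)
  then show "(\<lambda>x. u x + v x) \<in> L2_torus" by (rule L2_torus_add)
  show "(LINT x|torus. u x + v x) = 0"
    using assms L2_torus_integrable[OF u] L2_torus_integrable[OF v] by (simp add: sobolev_def)
  show "\<exists>g. is_weak_deriv js (\<lambda>x. u x + v x) g" if "length js \<le> m" for js
    using is_weak_deriv_add[OF u v wderiv_is_weak_deriv[OF assms(1) that] wderiv_is_weak_deriv[OF assms(2) that]]
    by blast
qed

lemma sobolev_cmult:
  assumes "u \<in> sobolev m"
  shows "(\<lambda>x. c * u x) \<in> sobolev m"
  unfolding sobolev_def
proof (intro CollectI conjI allI impI)
  show "(\<lambda>x. c * u x) \<in> L2_torus" by (rule L2_torus_cmult[OF sobolev_L2[OF assms]])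
  show "(LINT x|torus. c * u x) = 0" using assms by (simp add: sobolev_def)
  show "\<exists>g. is_weak_deriv js (\<lambda>x. c * u x) g" if "length js \<le> m" for js
    using is_weak_deriv_cmult[OF wderiv_is_weak_deriv[OF assms that], of c] by blast
qed

lemma sobolev_diff:
  assumes "u \<in> sobolev m" "v \<in> sobolev m"
  shows "(\<lambda>x. u x - v x) \<in> sobolev m"
  using sobolev_add[OF assms(1) sobolev_cmult[OF assms(2), of "-1"]] by simp

lemma sobolev_zero: "(\<lambda>x. 0) \<in> sobolev m"
  by (auto simp: sobolev_def L2_torus_def periodic_def is_weak_deriv_def intro!: exI[of _ "\<lambda>x. 0"])

lemma sobolev_sum:
  "finite I \<Longrightarrow> (\<And>i. i \<in> I \<Longrightarrow> f i \<in> sobolev m) \<Longrightarrow> (\<lambda>x. \<Sum>i\<in>I. f i x) \<in> sobolev m"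
  by (induction I rule: finite_induct) (auto intro: sobolev_zero sobolev_add)

lemma sobolev_mono: "m' \<le> m \<Longrightarrow> sobolev m \<subseteq> sobolev m'"
  by (auto simp: sobolev_def)

lemma sob_norm_mono: "m' \<le> m \<Longrightarrow> sob_norm m' u \<le> sob_norm m u"
  unfolding sob_norm_def using finite_lists_le by (intro real_sqrt_le_mono sum_mono2) auto

lemma rcoeff_sobolev_add:
  "u \<in> sobolev m \<Longrightarrow> v \<in> sobolev m \<Longrightarrow> rcoeff (\<lambda>x. u x + v x) n = rcoeff u n + rcoeff v n"
  by (intro rcoeff_add sobolev_L2)

lemma rcoeff_sobolev_diff:
  assumes "u \<in> sobolev m" "v \<in> sobolev m"
  shows "rcoeff (\<lambda>x. u x - v x) n = rcoeff u n - rcoeff v n"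
  using rcoeff_sobolev_add[OF assms(1) sobolev_cmult[OF assms(2), of "-1"]] rcoeff_cmult[of "-1" v] by simp

lemma rcoeff_sobolev_sum:
  "finite I \<Longrightarrow> (\<And>i. i \<in> I \<Longrightarrow> f i \<in> sobolev m) \<Longrightarrow> rcoeff (\<lambda>x. \<Sum>i\<in>I. f i x) n = (\<Sum>i\<in>I. rcoeff (f i) n)"
proof (induction I rule: finite_induct)
  case empty
  then show ?case by (simp add: rcoeff_def fcoeff_def)
next
  case (insert i I)
  then show ?case by (simp add: rcoeff_sobolev_add[of _ m] sobolev_sum)
qed

lemma rcoeff_sobolev_0: "u \<in> sobolev m \<Longrightarrow> rcoeff u 0 = 0"
  by (simp add: rcoeff_0 sobolev_def)

lemma torus_volume_ge_1: "torus_volume TYPE('n::finite) \<ge> 1"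
  using pi_gt3 by (intro one_le_power) simp

text \<open>Both the weight and the volume of the torus are at least 1, so no constant appears. This
  continuity of the coefficients carries limits in \<open>sob_norm\<close> over to each
  frequency.\<close>

lemma norm_rcoeff_le_sob_norm:
  assumes "u \<in> sobolev m"
  shows "cmod (rcoeff u (n :: int ^ 'n)) \<le> sob_norm m u"
proof (rule power2_le_imp_le[OF _ sob_norm_nonneg])
  have "1 * (cmod (rcoeff u n))\<^sup>2 \<le> weight m n * (cmod (rcoeff u n))\<^sup>2"
    by (intro mult_right_mono weight_ge_1) auto
  also have "\<dots> \<le> (sob_norm m u)\<^sup>2 / torus_volume TYPE('n)"
    by (rule coeff_bound_point[OF sobolev_coeff_bound[OF assms]])
  also have "\<dots> \<le> (sob_norm m u)\<^sup>2 / 1"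
    by (intro divide_left_mono torus_volume_ge_1) auto
  finally show "(cmod (rcoeff u n))\<^sup>2 \<le> (sob_norm m u)\<^sup>2" by simp
qed

lemma sobolev_coeff_bound':
  assumes "u \<in> sobolev m" "sob_norm m u \<le> B"
  shows "coeff_bound m (rcoeff (u :: real ^ 'n \<Rightarrow> real)) (B\<^sup>2)"
proof (rule coeff_bound_mono[OF sobolev_coeff_bound[OF assms(1)]])
  have "(sob_norm m u)\<^sup>2 / torus_volume TYPE('n) \<le> (sob_norm m u)\<^sup>2 / 1"
    by (intro divide_left_mono torus_volume_ge_1) auto
  also have "\<dots> \<le> B\<^sup>2" using power_mono[OF assms(2) sob_norm_nonneg, of 2] by simp
  finally show "(sob_norm m u)\<^sup>2 / torus_volume TYPE('n) \<le> B\<^sup>2" .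
qed simp

text \<open>Takes the place of the triangle inequality throughout. It is read off from the
  coefficients, because \<open>wderiv\<close> is a choice and hence additive only almost
  everywhere.\<close>

lemma sob_norm_diff_sq:
  assumes u: "u \<in> sobolev m" and v: "v \<in> sobolev m"
  shows "(sob_norm m (\<lambda>x. u x - v x))\<^sup>2 \<le> 2 * ((sob_norm m u)\<^sup>2 + (sob_norm m (v :: real ^ 'n \<Rightarrow> real))\<^sup>2)"
proof -
  have "rcoeff (\<lambda>x. u x - v x) = (\<lambda>n. rcoeff u n - rcoeff v n)"
    by (rule ext) (rule rcoeff_sobolev_diff[OF u v])
  then have "coeff_bound m (rcoeff (\<lambda>x. u x - v x))
      (2 * ((sob_norm m u)\<^sup>2 / torus_volume TYPE('n) + (sob_norm m v)\<^sup>2 / torus_volume TYPE('n)))"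
    using coeff_bound_diff[OF sobolev_coeff_bound[OF u] sobolev_coeff_bound[OF v]] by simp
  from sob_norm_le_coeff_bound[OF sobolev_diff[OF u v] this] show ?thesis
    by (simp add: algebra_simps)
qed

lemma sob_norm_cmult_minus:
  assumes "u \<in> sobolev m"
  shows "sob_norm m (\<lambda>x. - u x) = sob_norm m (u :: real ^ 'n \<Rightarrow> real)"
proof -
  have u': "(\<lambda>x. - u x) \<in> sobolev m" using sobolev_cmult[OF assms, of "-1"] by simp
  have "rcoeff (\<lambda>x. - u x) n = - rcoeff u n" for n using rcoeff_cmult[of "-1" u n] by simp
  then have "(sob_norm m (\<lambda>x. - u x))\<^sup>2 / torus_volume TYPE('n) = (sob_norm m u)\<^sup>2 / torus_volume TYPE('n)"
    using has_sum_unique[OF sob_norm_rcoeff[OF u']] sob_norm_rcoeff[OF assms] by simp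
  then show ?thesis by (simp add: power2_eq_iff_nonneg[OF sob_norm_nonneg sob_norm_nonneg])
qed

lemma sob_norm_triangle_sq:
  assumes u: "u \<in> sobolev m" and v: "v \<in> sobolev m" and w: "w \<in> sobolev m"
  shows "(sob_norm m (\<lambda>x. u x - v x))\<^sup>2
    \<le> 2 * ((sob_norm m (\<lambda>x. u x - w x))\<^sup>2 + (sob_norm m (\<lambda>x. v x - w x))\<^sup>2)"
  using sob_norm_diff_sq[OF sobolev_diff[OF u w] sobolev_diff[OF v w]] by simp

lemma sob_norm_sq_le:
  assumes u: "u \<in> sobolev m" and w: "w \<in> sobolev m"
  shows "(sob_norm m u)\<^sup>2 \<le> 2 * ((sob_norm m (\<lambda>x. u x - w x))\<^sup>2 + (sob_norm m w)\<^sup>2)"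
proof -
  have "(\<lambda>x. - w x) \<in> sobolev m" using sobolev_cmult[OF w, of "-1"] by simp
  from sob_norm_diff_sq[OF sobolev_diff[OF u w] this] show ?thesis
    by (simp add: sob_norm_cmult_minus[OF w])
qed

lemma sob_norm_zero [simp]: "sob_norm m (\<lambda>x. 0 :: real) = 0"
  using sob_norm_triangle_sq[OF sobolev_zero sobolev_zero sobolev_zero, of m]
    sob_norm_le_coeff_bound[OF sobolev_zero, of m 0] by (simp add: coeff_bound_def rcoeff_def fcoeff_def)

text \<open>Strong convergence implies weak convergence. Young's inequality with a small parameter
  \<open>s\<close> is used in place of Cauchy-Schwarz.\<close>

lemma integral_mult_tendsto_0:
  fixes f :: "nat \<Rightarrow> 'a \<Rightarrow> real"
  assumes f: "\<And>k. integrable M (\<lambda>x. (f k x)\<^sup>2)" and h: "integrable M (\<lambda>x. (h x)\<^sup>2)"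
    and fh: "\<And>k. integrable M (\<lambda>x. f k x * h x)" and lim: "(\<lambda>k. LINT x|M. (f k x)\<^sup>2) \<longlonglongrightarrow> 0"
  shows "(\<lambda>k. LINT x|M. f k x * h x) \<longlonglongrightarrow> 0"
proof (rule LIMSEQ_I)
  fix e :: real assume e: "e > 0"
  define H where "H = (LINT x|M. (h x)\<^sup>2)"
  have H: "H \<ge> 0" by (simp add: H_def)
  \<comment> \<open>Chosen so that the part with \<open>h\<close> stays below \<open>e / 2\<close>;
    the 1 covers \<open>H = 0\<close>.\<close>
  define s where "s = e / (H + 1)"
  have s: "s > 0" using e H by (simp add: s_def add_nonneg_pos)
  have sH: "s * H \<le> e" using e H by (simp add: s_def field_simps)
  obtain N where N: "\<And>k. k \<ge> N \<Longrightarrow> norm ((LINT x|M. (f k x)\<^sup>2) - 0) < s * e"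
    using LIMSEQ_D[OF lim, of "s * e"] s e by auto
  have "norm ((LINT x|M. f k x * h x) - 0) < e" if k: "k \<ge> N" for k
  proof -
    have "\<bar>LINT x|M. f k x * h x\<bar> \<le> (LINT x|M. \<bar>f k x * h x\<bar>)" by (rule integral_abs_bound)
    also have "\<dots> \<le> (LINT x|M. 1 / (2 * s) * (f k x)\<^sup>2 + s / 2 * (h x)\<^sup>2)"
    proof (rule integral_mono)
      fix x
      have "2 * \<bar>f k x\<bar> * (s * \<bar>h x\<bar>) \<le> (f k x)\<^sup>2 + (s * h x)\<^sup>2"
        using sum_squares_bound[of "\<bar>f k x\<bar>" "s * \<bar>h x\<bar>"] by (simp add: power_mult_distrib)
      then show "\<bar>f k x * h x\<bar> \<le> 1 / (2 * s) * (f k x)\<^sup>2 + s / 2 * (h x)\<^sup>2"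
        using s by (simp add: field_simps abs_mult power2_eq_square)
    qed (use f h fh in auto)
    also have "\<dots> = 1 / (2 * s) * (LINT x|M. (f k x)\<^sup>2) + s / 2 * H"
      using f h by (simp add: H_def)
    also have "\<dots> < 1 / (2 * s) * (s * e) + e / 2"
      using N[OF k] s sH by (intro add_less_le_mono mult_strict_left_mono) auto
    also have "\<dots> = e" using s by simp
    finally show ?thesis by simp
  qed
  then show "\<exists>N. \<forall>k\<ge>N. norm ((LINT x|M. f k x * h x) - 0) < e" by blast
qed

text \<open>The symmetry of \<open>a\<close> says that the complex function with these coefficients
  and its conjugate have the same ones, so its real part keeps them.\<close>

lemma real_riesz_fischer:
  fixes a :: "int ^ 'n \<Rightarrow> complex"
  assumes a: "coeff_bound 0 a Q" and sym: "\<And>n. a (- n) = cnj (a n)"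
  obtains u where "u \<in> L2_torus" "rcoeff u = a"
proof -
  have w0: "weight 0 n = 1" for n :: "int ^ 'n" by (simp add: weight_def)
  have "(\<lambda>n. (cmod (a n))\<^sup>2) summable_on UNIV"
    by (rule nonneg_bdd_above_summable_on)
       (use coeff_boundD[OF a] in \<open>auto intro!: bdd_aboveI2[where M = Q] simp: w0\<close>)
  then obtain g where g: "g \<in> borel_measurable borel" "\<And>x i. g (x + (2 * pi) *\<^sub>R axis i 1) = g x"
    "g \<in> L2_complex" "fcoeff g = a"
    by (rule riesz_fischer) (rule that; assumption)
  define u where "u x = Re (g x)" for x
  have "integrable torus (\<lambda>x. (u x)\<^sup>2)"
  proof (rule Bochner_Integration.integrable_bound)
    show "integrable torus (\<lambda>x. (cmod (g x))\<^sup>2)" using g(3) by (simp add: L2_complex_def)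
    show "(\<lambda>x. (u x)\<^sup>2) \<in> borel_measurable torus" using g(3) by (auto simp: L2_complex_def u_def)
    show "AE x in torus. norm ((u x)\<^sup>2) \<le> norm ((cmod (g x))\<^sup>2)"
      by (simp add: u_def cmod_power2)
  qed
  moreover have "u \<in> borel_measurable lebesgue"
    using g(1) unfolding u_def by (intro measurable_completion) simp
  ultimately have u: "u \<in> L2_torus" using g(2) by (simp add: L2_torus_def periodic_def u_def)
  have "rcoeff u n = a n" for n
  proof -
    have "(\<lambda>x. complex_of_real (u x)) = (\<lambda>x. (1/2) * (g x + cnj (g x)))"
      by (auto simp: u_def complex_add_cnj)
    then have "rcoeff u n = (1/2) * (fcoeff g n + cnj (fcoeff g (- n)))"
      unfolding rcoeff_def
      by (simp only: fcoeff_cmult fcoeff_add[OF L2_complex_integrable[OF g(3)] L2_complex_integrable[OF L2_complex_cnj[OF g(3)]]] fcoeff_cnj)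
    then show ?thesis by (simp add: g(4) sym)
  qed
  then show thesis using that u by blast
qed

lemma freq_prod_uminus_cnj: "freq_prod js (- n) = cnj (freq_prod js n)"
  by (induction js) (auto simp: freq_prod_def)

theorem sobolev_complete:
  fixes u :: "nat \<Rightarrow> real ^ 'n \<Rightarrow> real"
  assumes u: "\<And>k. u k \<in> sobolev m" and a: "\<And>k. coeff_bound m (\<lambda>n. rcoeff (u k) n - a n) (\<epsilon> k)"
    and \<epsilon>: "\<epsilon> \<longlonglongrightarrow> 0"
  obtains U where "U \<in> sobolev m" "rcoeff U = a"
proof -
  have lim: "(\<lambda>k. rcoeff (u k) n) \<longlonglongrightarrow> a n" for n
  proof -
    have "(cmod (rcoeff (u k) n - a n))\<^sup>2 \<le> \<epsilon> k" for k
    proof -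
      have "1 * (cmod (rcoeff (u k) n - a n))\<^sup>2 \<le> weight m n * (cmod (rcoeff (u k) n - a n))\<^sup>2"
        by (intro mult_right_mono weight_ge_1) auto
      then show ?thesis using coeff_bound_point[OF a[of k], of n] by simp
    qed
    then have "(\<lambda>k. (cmod (rcoeff (u k) n - a n))\<^sup>2) \<longlonglongrightarrow> 0"
      by (intro tendsto_sandwich[OF _ _ tendsto_const \<epsilon>] always_eventually allI) simp_all
    then have "(\<lambda>k. sqrt ((cmod (rcoeff (u k) n - a n))\<^sup>2)) \<longlonglongrightarrow> sqrt 0" by (rule tendsto_real_sqrt)
    then have "(\<lambda>k. rcoeff (u k) n - a n) \<longlonglongrightarrow> 0" by (simp add: tendsto_norm_zero_iff)
    then show ?thesis by (simp add: LIM_zero_iff)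
  qed
  have sym: "a (- n) = cnj (a n)" for n
    using LIMSEQ_unique[OF lim[of "- n"]] tendsto_cnj[OF lim[of n]] by (simp add: rcoeff_minus_freq)
  have ab: "coeff_bound m a (2 * ((sob_norm m (u 0))\<^sup>2 + \<epsilon> 0))"
    using coeff_bound_diff[OF sobolev_coeff_bound'[OF u[of 0] order_refl] a[of 0]] by simp
  have shift: "coeff_bound 0 (\<lambda>n. freq_prod js n * b n) Q" if "coeff_bound m b Q" "length js \<le> m" for b js Q
  proof -
    have "coeff_bound 0 (\<lambda>n. freq_prod js n * b n) (1 * Q)"
    proof (rule coeff_bound_le[OF that(1)])
      fix n
      have "(cmod (freq_prod js n))\<^sup>2 * (cmod (b n))\<^sup>2 \<le> weight m n * (cmod (b n))\<^sup>2"
        by (intro mult_right_mono freq_prod_le_weight that) auto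
      then show "weight 0 n * (cmod (freq_prod js n * b n))\<^sup>2 \<le> 1 * (weight m n * (cmod (b n))\<^sup>2)"
        by (simp add: weight_def[of 0] norm_mult power_mult_distrib)
    qed simp
    then show ?thesis by simp
  qed
  have "\<exists>g. g \<in> L2_torus \<and> rcoeff g = (\<lambda>n. freq_prod js n * a n)" if js: "length js \<le> m" for js
  proof -
    have "freq_prod js (- n) * a (- n) = cnj (freq_prod js n * a n)" for n
      by (simp add: freq_prod_uminus_cnj sym)
    then show ?thesis using real_riesz_fischer[OF shift[OF ab js]] by metis
  qed
  then obtain g where g: "\<And>js. length js \<le> m \<Longrightarrow> g js \<in> L2_torus"
    "\<And>js. length js \<le> m \<Longrightarrow> rcoeff (g js) = (\<lambda>n. freq_prod js n * a n)"
    by metis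
  \<comment> \<open>The derivative along the empty tuple, whose symbol is 1.\<close>
  define U where "U = g []"
  have UL: "U \<in> L2_torus" and Uc: "rcoeff U = a" unfolding U_def using g[of "[]"] by (auto simp: freq_prod_def)
  have L2lim: "(\<lambda>k. LINT x|torus. (wderiv js (u k) x - g js x)\<^sup>2) \<longlonglongrightarrow> 0"
    and dL: "\<And>k. (\<lambda>x. wderiv js (u k) x - g js x) \<in> L2_torus" if js: "length js \<le> m" for js
  proof -
    show dL: "(\<lambda>x. wderiv js (u k) x - g js x) \<in> L2_torus" for k
      using L2_torus_add[OF wderiv_L2[OF u js] L2_torus_cmult[OF g(1)[OF js], of "-1"]] by simp
    have "(LINT x|torus. (wderiv js (u k) x - g js x)\<^sup>2) \<le> torus_volume TYPE('n) * \<epsilon> k" for k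
    proof -
      have "rcoeff (\<lambda>x. wderiv js (u k) x + (-1) * g js x) n = freq_prod js n * (rcoeff (u k) n - a n)" for n
        by (subst rcoeff_add[OF wderiv_L2[OF u js] L2_torus_cmult[OF g(1)[OF js]]])
           (simp only: rcoeff_cmult rcoeff_wderiv[OF u js] g(2)[OF js], simp add: algebra_simps)
      then have c: "rcoeff (\<lambda>x. wderiv js (u k) x - g js x) n = freq_prod js n * (rcoeff (u k) n - a n)" for n
        by simp
      have "(LINT x|torus. (wderiv js (u k) x - g js x)\<^sup>2) / torus_volume TYPE('n) \<le> \<epsilon> k"
        by (rule has_sum_le_finite_sums[OF parseval_real[OF dL]])
           (use coeff_boundD[OF shift[OF a[of k] js]] in \<open>simp add: c weight_def[of 0]\<close>)
      then show ?thesis by (simp add: field_simps)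
    qed
    then have e1: "\<forall>\<^sub>F k in sequentially. (LINT x|torus. (wderiv js (u k) x - g js x)\<^sup>2) \<le> torus_volume TYPE('n) * \<epsilon> k"
      by (intro always_eventually allI)
    have l: "(\<lambda>k. torus_volume TYPE('n) * \<epsilon> k) \<longlonglongrightarrow> 0"
      using tendsto_mult_left[OF \<epsilon>, of "torus_volume TYPE('n)"] by (simp only: mult_zero_right)
    have e2: "\<forall>\<^sub>F k in sequentially. 0 \<le> (LINT x|torus. (wderiv js (u k) x - g js x)\<^sup>2)"
      by (intro always_eventually allI) simp
    show "(\<lambda>k. LINT x|torus. (wderiv js (u k) x - g js x)\<^sup>2) \<longlonglongrightarrow> 0"
      by (rule tendsto_sandwich[OF e2 e1 tendsto_const l])
  qed
  have inner_lim: "(\<lambda>k. LINT x|torus. wderiv js (u k) x * h x) \<longlonglongrightarrow> (LINT x|torus. g js x * h x)"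
    if js: "length js \<le> m" and h: "h \<in> borel_measurable torus" "integrable torus (\<lambda>x. (h x)\<^sup>2)" for js h
  proof -
    have i: "integrable torus (\<lambda>x. v x * h x)" if "v \<in> L2_torus" for v
      by (rule L2_real_integrable_mult[OF L2_torus_borel[OF that] _ h]) (use that in \<open>simp add: L2_torus_def\<close>)
    have "(\<lambda>k. LINT x|torus. (wderiv js (u k) x - g js x) * h x) \<longlonglongrightarrow> 0"
      using dL[OF js] h(2) i L2lim[OF js] by (intro integral_mult_tendsto_0) (auto simp: L2_torus_def)
    moreover have "(LINT x|torus. (wderiv js (u k) x - g js x) * h x)
        = (LINT x|torus. wderiv js (u k) x * h x) - (LINT x|torus. g js x * h x)" for k
      using i[OF wderiv_L2[OF u js]] i[OF g(1)[OF js]] by (simp add: left_diff_distrib)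
    ultimately show ?thesis by (simp add: LIM_zero_iff)
  qed
  have "is_weak_deriv js U (g js)" if js: "length js \<le> m" for js
    unfolding is_weak_deriv_def
  proof (intro conjI allI impI g js)
    fix \<eta> :: "real ^ 'n \<Rightarrow> real" assume \<eta>: "smooth \<eta> \<and> periodic \<eta>"
    \<comment> \<open>\<open>wderiv []\<close> is a choice and agrees with the function only almost
      everywhere, which is enough under the integral.\<close>
    have nil: "(LINT x|torus. wderiv [] (u k) x * h x) = (LINT x|torus. u k x * h x)"
      if "h \<in> borel_measurable torus" for k h
    proof -
      have "AE x in torus. complex_of_real (wderiv [] (u k) x) = complex_of_real (u k x)"
      proof (rule fcoeff_eq_imp_AE_eq)
        show "fcoeff (\<lambda>x. complex_of_real (wderiv [] (u k) x)) = fcoeff (\<lambda>x. complex_of_real (u k x))"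
          using rcoeff_wderiv[OF u, of "[]" k] by (auto simp: rcoeff_def freq_prod_def)
      qed (use wderiv_L2[OF u, of "[]" k] sobolev_L2[OF u[of k]] in \<open>auto intro: L2_torus_complex\<close>)
      then show ?thesis
        using L2_torus_borel[OF wderiv_L2[OF u, of "[]" k]] L2_torus_borel[OF sobolev_L2[OF u[of k]]] that
        by (intro integral_cong_AE) (auto elim: eventually_mono)
    qed
    note pm = smooth_pdiff_torus[OF conjunct1[OF \<eta>]]
    have \<eta>m: "\<eta> \<in> borel_measurable torus" "integrable torus (\<lambda>x. (\<eta> x)\<^sup>2)"
      using pm[of "[]"] by (simp_all add: pdiff_def iter_deriv_def)
    have 1: "(\<lambda>k. LINT x|torus. wderiv js (u k) x * \<eta> x) \<longlonglongrightarrow> (LINT x|torus. g js x * \<eta> x)"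
      by (rule inner_lim[OF js \<eta>m])
    have "(\<lambda>k. LINT x|torus. wderiv [] (u k) x * pdiff js \<eta> x) \<longlonglongrightarrow> (LINT x|torus. g [] x * pdiff js \<eta> x)"
      by (rule inner_lim[OF _ pm]) simp
    then have "(\<lambda>k. (-1) ^ length js * (LINT x|torus. u k x * pdiff js \<eta> x))
        \<longlonglongrightarrow> (-1) ^ length js * (LINT x|torus. U x * pdiff js \<eta> x)"
      unfolding nil[OF pm(1)] U_def by (intro tendsto_intros)
    moreover have "(-1) ^ length js * (LINT x|torus. u k x * pdiff js \<eta> x) = (LINT x|torus. wderiv js (u k) x * \<eta> x)" for k
      using wderiv_is_weak_deriv[OF u js, of k] \<eta> by (simp add: is_weak_deriv_def)
    ultimately show "(LINT x|torus. g js x * \<eta> x) = (-1) ^ length js * (LINT x|torus. U x * pdiff js \<eta> x)"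
      using LIMSEQ_unique[OF 1] by simp
  qed
  moreover have "(LINT x|torus. U x) = 0"
  proof -
    have "rcoeff U 0 = 0"
      using LIMSEQ_unique[OF lim[of 0]] Uc rcoeff_sobolev_0[OF u] by simp
    then show ?thesis by (simp add: rcoeff_0)
  qed
  ultimately have "U \<in> sobolev m" using UL by (auto simp: sobolev_def)
  then show thesis using that Uc by blast
qed

section \<open>Continuity and Bochner integration in time with values in a Sobolev space\<close>

subsection \<open>Continuous Sobolev-valued functions of time\<close>

lemma abs_sob_norm [simp]: "\<bar>sob_norm m u\<bar> = sob_norm m u"
  by (rule abs_of_nonneg) (rule sob_norm_nonneg)

lemma C_sobD: "u \<in> C_sob m J \<Longrightarrow> t \<in> J \<Longrightarrow> u t \<in> sobolev m"
  by (simp add: C_sob_def)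

text \<open>Heine-Cantor by a Lebesgue number of a cover of \<open>J\<close>. Two errors below
  \<open>e / 2\<close> combine to one below \<open>e\<close>, since the factor 2 in
  \<open>sob_norm_triangle_sq\<close> gives exactly \<open>e\<^sup>2\<close>.\<close>

lemma C_sob_uniformly_continuous:
  fixes u :: "real \<Rightarrow> real ^ 'n \<Rightarrow> real"
  assumes u: "u \<in> C_sob m J" and J: "compact J" and e: "e > 0"
  obtains \<delta> where "\<delta> > 0"
    "\<And>s t. s \<in> J \<Longrightarrow> t \<in> J \<Longrightarrow> \<bar>s - t\<bar> < \<delta> \<Longrightarrow> sob_norm m (\<lambda>x. u s x - u t x) < e"
proof -
  have "\<exists>d>0. \<forall>y\<in>J. dist y r < d \<longrightarrow> sob_norm m (\<lambda>x. u y x - u r x) < e / 2" if r: "r \<in> J" for r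
  proof -
    have "((\<lambda>t. sob_norm m (\<lambda>x. u t x - u r x)) \<longlongrightarrow> 0) (at r within J)"
      using u r by (simp add: C_sob_def)
    then have "\<forall>\<^sub>F y in at r within J. sob_norm m (\<lambda>x. u y x - u r x) < e / 2"
      using e by (intro order_tendstoD(2)) auto
    then obtain d where d: "d > 0" "\<And>y. y \<in> J \<Longrightarrow> y \<noteq> r \<Longrightarrow> dist y r < d \<Longrightarrow> sob_norm m (\<lambda>x. u y x - u r x) < e / 2"
      unfolding eventually_at by blast
    have "sob_norm m (\<lambda>x. u r x - u r x) < e / 2" using e by simp
    then have "sob_norm m (\<lambda>x. u y x - u r x) < e / 2" if "y \<in> J" "dist y r < d" for y
      using d(2)[OF that(1) _ that(2)] by (cases "y = r") auto
    then show ?thesis using d(1) by blast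
  qed
  then obtain d where d: "\<And>r. r \<in> J \<Longrightarrow> d r > 0"
    "\<And>r y. r \<in> J \<Longrightarrow> y \<in> J \<Longrightarrow> dist y r < d r \<Longrightarrow> sob_norm m (\<lambda>x. u y x - u r x) < e / 2"
    by metis
  have cover: "J \<subseteq> \<Union>((\<lambda>r. ball r (d r)) ` J)" using d(1) by force
  obtain \<delta> where \<delta>: "\<delta> > 0" "\<And>x. x \<in> J \<Longrightarrow> \<exists>G\<in>(\<lambda>r. ball r (d r)) ` J. ball x \<delta> \<subseteq> G"
    using Heine_Borel_lemma[OF J cover] by blast
  show thesis
  proof (rule that[OF \<delta>(1)])
    fix s t assume s: "s \<in> J" and t: "t \<in> J" and st: "\<bar>s - t\<bar> < \<delta>"
    obtain r where r: "r \<in> J" "ball s \<delta> \<subseteq> ball r (d r)" using \<delta>(2)[OF s] by blast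
    have "s \<in> ball s \<delta>" "t \<in> ball s \<delta>" using \<delta>(1) st by (auto simp: dist_real_def)
    then have "s \<in> ball r (d r)" "t \<in> ball r (d r)" using r(2) by blast+
    then have sr: "dist s r < d r" "dist t r < d r" by (simp_all add: dist_commute)
    have "(sob_norm m (\<lambda>x. u s x - u t x))\<^sup>2
        \<le> 2 * ((sob_norm m (\<lambda>x. u s x - u r x))\<^sup>2 + (sob_norm m (\<lambda>x. u t x - u r x))\<^sup>2)"
      by (rule sob_norm_triangle_sq[OF C_sobD[OF u s] C_sobD[OF u t] C_sobD[OF u r(1)]])
    also have "\<dots> < 2 * ((e / 2)\<^sup>2 + (e / 2)\<^sup>2)"
      using d(2)[OF r(1) s sr(1)] d(2)[OF r(1) t sr(2)] sob_norm_nonneg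
      by (intro mult_strict_left_mono add_strict_mono power_strict_mono) auto
    also have "\<dots> = e\<^sup>2" by (simp add: power2_eq_square)
    finally show "sob_norm m (\<lambda>x. u s x - u t x) < e" using e by (simp add: power_less_imp_less_base)
  qed
qed

lemma C_sob_bounded:
  fixes u :: "real \<Rightarrow> real ^ 'n \<Rightarrow> real"
  assumes u: "u \<in> C_sob m J" and J: "compact J"
  obtains B where "B \<ge> 0" "\<And>t. t \<in> J \<Longrightarrow> sob_norm m (u t) \<le> B"
proof -
  obtain \<delta> where \<delta>: "\<delta> > 0"
    "\<And>s t. s \<in> J \<Longrightarrow> t \<in> J \<Longrightarrow> \<bar>s - t\<bar> < \<delta> \<Longrightarrow> sob_norm m (\<lambda>x. u s x - u t x) < 1"
    by (rule C_sob_uniformly_continuous[OF u J, of 1]) auto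
  obtain C where C: "C \<subseteq> J" "finite C" "J \<subseteq> (\<Union>r\<in>C. ball r \<delta>)"
    by (rule compactE_image[OF J, of J "\<lambda>r. ball r \<delta>"]) (use \<delta>(1) in auto)
  define Q where "Q = (\<Sum>r\<in>C. 2 * (1 + (sob_norm m (u r))\<^sup>2))"
  have "sob_norm m (u t) \<le> sqrt Q" if t: "t \<in> J" for t
  proof (rule real_le_rsqrt)
    obtain r where r: "r \<in> C" "t \<in> ball r \<delta>" using C(3) t by blast
    then have rJ: "r \<in> J" and tr: "\<bar>t - r\<bar> < \<delta>" using C(1) by (auto simp: dist_real_def)
    have "(sob_norm m (u t))\<^sup>2 \<le> 2 * ((sob_norm m (\<lambda>x. u t x - u r x))\<^sup>2 + (sob_norm m (u r))\<^sup>2)"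
      by (rule sob_norm_sq_le[OF C_sobD[OF u t] C_sobD[OF u rJ]])
    also have "\<dots> \<le> 2 * (1\<^sup>2 + (sob_norm m (u r))\<^sup>2)"
      using \<delta>(2)[OF t rJ tr] sob_norm_nonneg by (intro mult_left_mono add_mono power_mono) auto
    also have "\<dots> \<le> Q" unfolding Q_def using r(1) C(2)
      by (subst power_one, intro member_le_sum) auto
    finally show "(sob_norm m (u t))\<^sup>2 \<le> Q" .
  qed
  moreover have "Q \<ge> 0" unfolding Q_def by (intro sum_nonneg) auto
  ultimately show thesis using that[of "sqrt Q"] by auto
qed

lemma C_sob_mono:
  assumes "m' \<le> m"
  shows "C_sob m J \<subseteq> C_sob m' J"
proof
  fix u :: "real \<Rightarrow> real ^ 'n \<Rightarrow> real" assume u: "u \<in> C_sob m J"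
  have "((\<lambda>t. sob_norm m' (\<lambda>x. u t x - u r x)) \<longlongrightarrow> 0) (at r within J)" if "r \<in> J" for r
  proof (rule Lim_null_comparison)
    show "((\<lambda>t. sob_norm m (\<lambda>x. u t x - u r x)) \<longlongrightarrow> 0) (at r within J)" using u that by (simp add: C_sob_def)
    show "\<forall>\<^sub>F t in at r within J. norm (sob_norm m' (\<lambda>x. u t x - u r x)) \<le> sob_norm m (\<lambda>x. u t x - u r x)"
      using sob_norm_mono[OF assms] by (intro always_eventually allI) simp
  qed
  then show "u \<in> C_sob m' J" using u sobolev_mono[OF assms] by (auto simp: C_sob_def)
qed

lemma C_sob_subset: "J' \<subseteq> J \<Longrightarrow> C_sob m J \<subseteq> C_sob m J'"
  unfolding C_sob_def by (auto intro: tendsto_within_subset)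

lemma C_sob_diff:
  fixes u v :: "real \<Rightarrow> real ^ 'n \<Rightarrow> real"
  assumes u: "u \<in> C_sob m J" and v: "v \<in> C_sob m J"
  shows "(\<lambda>t x. u t x - v t x) \<in> C_sob m J"
proof -
  have "((\<lambda>t. sob_norm m (\<lambda>x. (u t x - v t x) - (u r x - v r x))) \<longlongrightarrow> 0) (at r within J)" if r: "r \<in> J" for r
  proof (rule Lim_null_comparison)
    let ?g = "\<lambda>t. sqrt (2 * ((sob_norm m (\<lambda>x. u t x - u r x))\<^sup>2 + (sob_norm m (\<lambda>x. v t x - v r x))\<^sup>2))"
    have "(?g \<longlongrightarrow> sqrt (2 * (0\<^sup>2 + 0\<^sup>2))) (at r within J)"
      using u v r by (intro tendsto_intros) (auto simp: C_sob_def)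
    then show "(?g \<longlongrightarrow> 0) (at r within J)" by simp
    have "sob_norm m (\<lambda>x. (u t x - v t x) - (u r x - v r x)) \<le> ?g t" if t: "t \<in> J" for t
    proof (rule real_le_rsqrt)
      have "(\<lambda>x. (u t x - v t x) - (u r x - v r x)) = (\<lambda>x. (u t x - u r x) - (v t x - v r x))" by auto
      then show "(sob_norm m (\<lambda>x. (u t x - v t x) - (u r x - v r x)))\<^sup>2
        \<le> 2 * ((sob_norm m (\<lambda>x. u t x - u r x))\<^sup>2 + (sob_norm m (\<lambda>x. v t x - v r x))\<^sup>2)"
        using sob_norm_diff_sq[OF sobolev_diff[OF C_sobD[OF u t] C_sobD[OF u r]] sobolev_diff[OF C_sobD[OF v t] C_sobD[OF v r]]]
        by simp
    qed
    then show "\<forall>\<^sub>F t in at r within J. norm (sob_norm m (\<lambda>x. (u t x - v t x) - (u r x - v r x))) \<le> ?g t"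
      by (simp add: eventually_at_filter)
  qed
  then show ?thesis using u v by (auto simp: C_sob_def intro: sobolev_diff)
qed

lemma continuous_on_rcoeff:
  assumes u: "u \<in> C_sob m J"
  shows "continuous_on J (\<lambda>t. rcoeff (u t) n)"
  unfolding continuous_on_def
proof
  fix r assume r: "r \<in> J"
  have "((\<lambda>t. rcoeff (u t) n - rcoeff (u r) n) \<longlongrightarrow> 0) (at r within J)"
  proof (rule Lim_null_comparison)
    show "((\<lambda>t. sob_norm m (\<lambda>x. u t x - u r x)) \<longlongrightarrow> 0) (at r within J)" using u r by (simp add: C_sob_def)
    have "norm (rcoeff (u t) n - rcoeff (u r) n) \<le> sob_norm m (\<lambda>x. u t x - u r x)" if t: "t \<in> J" for t
      using norm_rcoeff_le_sob_norm[OF sobolev_diff[OF C_sobD[OF u t] C_sobD[OF u r]], of n]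
      by (simp add: rcoeff_sobolev_diff[OF C_sobD[OF u t] C_sobD[OF u r]])
    then show "\<forall>\<^sub>F t in at r within J. norm (rcoeff (u t) n - rcoeff (u r) n) \<le> sob_norm m (\<lambda>x. u t x - u r x)"
      by (simp add: eventually_at_filter)
  qed
  then show "((\<lambda>t. rcoeff (u t) n) \<longlongrightarrow> rcoeff (u r) n) (at r within J)" by (simp add: LIM_zero_iff)
qed

subsection \<open>Integrals of Sobolev-valued functions and of their Fourier coefficients\<close>

lemma sob_simple_integral_sobolev:
  assumes "sob_simple m J s"
  shows "sob_simple_integral J s \<in> sobolev m"
  unfolding sob_simple_integral_def using assms
  by (intro sobolev_sum sobolev_cmult) (auto simp: sob_simple_def)

lemma rcoeff_sob_simple_integral:
  fixes s :: "real \<Rightarrow> real ^ 'n \<Rightarrow> real"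
  assumes s: "sob_simple m J s" and J: "J \<in> lmeasurable"
  shows "integrable (lebesgue_on J) (\<lambda>\<tau>. rcoeff (s \<tau>) n)"
    and "(LINT \<tau>|lebesgue_on J. rcoeff (s \<tau>) n) = rcoeff (sob_simple_integral J s) n"
proof -
  define A where "A g = {t \<in> J. s t = g}" for g
  have fin: "finite (s ` J)" and A: "A g \<in> sets lebesgue" for g using s by (auto simp: sob_simple_def A_def)
  have AJ: "A g \<subseteq> J" for g by (auto simp: A_def)
  have Jm: "J \<in> sets lebesgue" using J by auto
  have Am: "A g \<in> sets (lebesgue_on J)" for g using A AJ Jm by (simp add: sets_restrict_space_iff)
  interpret finite_measure "lebesgue_on J" by (rule finite_measure_lebesgue_on[OF J])
  have expand: "rcoeff (s \<tau>) n = (\<Sum>g\<in>s ` J. indicator (A g) \<tau> *\<^sub>R rcoeff g n)" if "\<tau> \<in> J" for \<tau>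
  proof -
    have "(\<Sum>g\<in>s ` J. indicator (A g) \<tau> *\<^sub>R rcoeff g n) = (\<Sum>g\<in>s ` J. if g = s \<tau> then rcoeff g n else 0)"
      using that by (intro sum.cong) (auto simp: A_def)
    then show ?thesis using fin that by simp
  qed
  have i: "integrable (lebesgue_on J) (\<lambda>\<tau>. indicator (A g) \<tau> *\<^sub>R rcoeff g n)" for g
    using Am emeasure_finite by (intro integrable_scaleR_left integrable_real_indicator) (auto simp: less_top[symmetric])
  have cong: "integrable (lebesgue_on J) (\<lambda>\<tau>. rcoeff (s \<tau>) n)
      \<longleftrightarrow> integrable (lebesgue_on J) (\<lambda>\<tau>. \<Sum>g\<in>s ` J. indicator (A g) \<tau> *\<^sub>R rcoeff g n)"
    by (rule Bochner_Integration.integrable_cong) (auto simp: expand)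
  show "integrable (lebesgue_on J) (\<lambda>\<tau>. rcoeff (s \<tau>) n)"
    unfolding cong by (intro Bochner_Integration.integrable_sum i)
  have "(LINT \<tau>|lebesgue_on J. rcoeff (s \<tau>) n) = (LINT \<tau>|lebesgue_on J. (\<Sum>g\<in>s ` J. indicator (A g) \<tau> *\<^sub>R rcoeff g n))"
    by (rule Bochner_Integration.integral_cong) (auto simp: expand)
  also have "\<dots> = (\<Sum>g\<in>s ` J. (LINT \<tau>|lebesgue_on J. indicator (A g) \<tau> *\<^sub>R rcoeff g n))"
    by (rule Bochner_Integration.integral_sum) (rule i)
  also have "\<dots> = (\<Sum>g\<in>s ` J. of_real (measure lebesgue (A g)) * rcoeff g n)"
  proof (rule sum.cong)
    fix g
    have "(LINT \<tau>|lebesgue_on J. indicator (A g) \<tau> *\<^sub>R rcoeff g n) = measure (lebesgue_on J) (A g) *\<^sub>R rcoeff g n"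
      using Am[of g] by (subst integral_scaleR_left) (auto intro!: integrable_real_indicator simp: less_top[symmetric] Int_absorb2[OF AJ])
    also have "measure (lebesgue_on J) (A g) = measure lebesgue (A g)"
      using Jm AJ by (intro measure_restrict_space) auto
    finally show "(LINT \<tau>|lebesgue_on J. indicator (A g) \<tau> *\<^sub>R rcoeff g n) = of_real (measure lebesgue (A g)) * rcoeff g n"
      by (simp add: scaleR_conv_of_real)
  qed simp
  also have "\<dots> = rcoeff (sob_simple_integral J s) n"
  proof -
    have "rcoeff (\<lambda>x. \<Sum>g\<in>s ` J. measure lebesgue (A g) * g x) n = (\<Sum>g\<in>s ` J. rcoeff (\<lambda>x. measure lebesgue (A g) * g x) n)"
      using s by (intro rcoeff_sobolev_sum[OF fin, of _ m] sobolev_cmult) (auto simp: sob_simple_def)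
    then show ?thesis by (simp add: sob_simple_integral_def A_def rcoeff_cmult)
  qed
  finally show "(LINT \<tau>|lebesgue_on J. rcoeff (s \<tau>) n) = rcoeff (sob_simple_integral J s) n" .
qed

lemma continuous_integrable_lebesgue_on:
  fixes c :: "real \<Rightarrow> complex"
  assumes "continuous_on {0..t} c"
  shows "integrable (lebesgue_on {0..t}) c" "(LINT \<tau>|lebesgue_on {0..t}. c \<tau>) = integral {0..t} c"
proof -
  have "set_integrable lebesgue {0..t} c"
    using absolutely_integrable_continuous[of 0 t c] assms by (simp add: cbox_interval)
  then show i: "integrable (lebesgue_on {0..t}) c"
    by (simp add: set_integrable_def integrable_restrict_space)
  show "(LINT \<tau>|lebesgue_on {0..t}. c \<tau>) = integral {0..t} c"
    by (rule lebesgue_integral_eq_integral[OF i]) auto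
qed

text \<open>A coefficient commutes with the integral of simple functions by linearity, and with the
  limit because it is bounded by the norm. Agreement with the continuous \<open>c\<close> is asked
  for only at almost every time, since a time derivative is known no better.\<close>

theorem has_sob_integral_rcoeff:
  assumes U: "has_sob_integral m {0..t} u U" and c: "continuous_on {0..t} c"
    and uc: "AE \<tau> in lebesgue_on {0..t}. rcoeff (u \<tau>) n = c \<tau>"
  shows "rcoeff U n = integral {0..t} c"
proof -
  let ?M = "lebesgue_on {0..t}"
  obtain s where s: "\<And>i. sob_simple m {0..t} (s i)"
    "(\<lambda>i. \<integral>\<^sup>+ \<tau>. ennreal (sob_norm m (\<lambda>x. s i \<tau> x - u \<tau> x)) \<partial>?M) \<longlonglongrightarrow> 0"
    "(\<lambda>i. sob_norm m (\<lambda>x. sob_simple_integral {0..t} (s i) x - U x)) \<longlonglongrightarrow> 0"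
    using U unfolding has_sob_integral_def by blast
  have US: "U \<in> sobolev m" and uS: "AE \<tau> in ?M. u \<tau> \<in> sobolev m"
    using U unfolding has_sob_integral_def sob_measurable_def by auto
  note ci = continuous_integrable_lebesgue_on[OF c]
  have lm: "{0..t} \<in> lmeasurable" by simp
  have le: "cmod (rcoeff (sob_simple_integral {0..t} (s i)) n - integral {0..t} c)
      \<le> (\<integral>\<^sup>+ \<tau>. ennreal (sob_norm m (\<lambda>x. s i \<tau> x - u \<tau> x)) \<partial>?M)" for i
  proof -
    note r = rcoeff_sob_simple_integral[OF s(1) lm, of i n]
    have "rcoeff (sob_simple_integral {0..t} (s i)) n - integral {0..t} c = (LINT \<tau>|?M. rcoeff (s i \<tau>) n - c \<tau>)"
      using r ci by simp
    then have "ennreal (cmod (rcoeff (sob_simple_integral {0..t} (s i)) n - integral {0..t} c))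
        \<le> (\<integral>\<^sup>+ \<tau>. ennreal (cmod (rcoeff (s i \<tau>) n - c \<tau>)) \<partial>?M)"
      using integral_norm_bound_ennreal[OF Bochner_Integration.integrable_diff[OF r(1) ci(1)]] by simp
    also have "\<dots> \<le> (\<integral>\<^sup>+ \<tau>. ennreal (sob_norm m (\<lambda>x. s i \<tau> x - u \<tau> x)) \<partial>?M)"
    proof (rule nn_integral_mono_AE)
      have "AE \<tau> in ?M. \<tau> \<in> {0..t}" by (rule AE_I2) simp
      with uS uc show "AE \<tau> in ?M. ennreal (cmod (rcoeff (s i \<tau>) n - c \<tau>)) \<le> ennreal (sob_norm m (\<lambda>x. s i \<tau> x - u \<tau> x))"
      proof eventually_elim
        case (elim \<tau>)
        have "s i \<tau> \<in> sobolev m" using s(1)[of i] elim(3) by (auto simp: sob_simple_def)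
        then show ?case
          using norm_rcoeff_le_sob_norm[OF sobolev_diff[OF _ elim(1)], of "s i \<tau>" n]
            rcoeff_sobolev_diff[OF _ elim(1), of "s i \<tau>" n] elim(2) by (intro ennreal_leI) simp
      qed
    qed
    finally show ?thesis .
  qed
  have "(\<lambda>i. ennreal (cmod (rcoeff (sob_simple_integral {0..t} (s i)) n - integral {0..t} c))) \<longlonglongrightarrow> 0"
    by (rule tendsto_sandwich[OF _ _ tendsto_const s(2)]) (auto intro!: always_eventually le)
  then have "(\<lambda>i. cmod (rcoeff (sob_simple_integral {0..t} (s i)) n - integral {0..t} c)) \<longlonglongrightarrow> 0"
    by (simp add: ennreal_0[symmetric] del: ennreal_0)
  then have 1: "(\<lambda>i. rcoeff (sob_simple_integral {0..t} (s i)) n) \<longlonglongrightarrow> integral {0..t} c"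
    by (simp add: tendsto_norm_zero_iff LIM_zero_iff)
  have "(\<lambda>i. rcoeff (sob_simple_integral {0..t} (s i)) n - rcoeff U n) \<longlonglongrightarrow> 0"
  proof (rule Lim_null_comparison[OF _ s(3)], intro always_eventually allI)
    fix i
    note S = sob_simple_integral_sobolev[OF s(1)[of i]]
    show "norm (rcoeff (sob_simple_integral {0..t} (s i)) n - rcoeff U n)
        \<le> sob_norm m (\<lambda>x. sob_simple_integral {0..t} (s i) x - U x)"
      using norm_rcoeff_le_sob_norm[OF sobolev_diff[OF S US], of n] by (simp add: rcoeff_sobolev_diff[OF S US])
  qed
  then have "(\<lambda>i. rcoeff (sob_simple_integral {0..t} (s i)) n) \<longlonglongrightarrow> rcoeff U n" by (simp add: LIM_zero_iff)
  then show ?thesis using LIMSEQ_unique[OF 1] by simp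
qed

text \<open>Time is rounded down to the grid of step \<open>1 / Suc N\<close>. Rounding down stays
  inside the interval, takes finitely many values there, and is measurable because the floor
  function is.\<close>

lemma step_approximation_simple:
  fixes u :: "real \<Rightarrow> real ^ 'n \<Rightarrow> real"
  assumes u: "u ` {0..t} \<subseteq> sobolev m"
  shows "sob_simple m {0..t} (\<lambda>\<tau>. u (of_int \<lfloor>\<tau> * real (Suc N)\<rfloor> / real (Suc N)))"
    and "\<And>\<tau>. \<tau> \<in> {0..t} \<Longrightarrow> of_int \<lfloor>\<tau> * real (Suc N)\<rfloor> / real (Suc N) \<in> {0..t}"
    and "\<And>\<tau>. \<bar>of_int \<lfloor>\<tau> * real (Suc N)\<rfloor> / real (Suc N) - \<tau>\<bar> < inverse (real (Suc N))"
proof -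
  define K where "K = real (Suc N)"
  have K: "K > 0" by (simp add: K_def)
  show mem: "of_int \<lfloor>\<tau> * K\<rfloor> / K \<in> {0..t}" if "\<tau> \<in> {0..t}" for \<tau>
  proof -
    have "of_int \<lfloor>\<tau> * K\<rfloor> / K \<le> (\<tau> * K) / K" using K by (intro divide_right_mono) auto
    then show ?thesis using that K by auto
  qed
  show "\<bar>of_int \<lfloor>\<tau> * K\<rfloor> / K - \<tau>\<bar> < inverse K" for \<tau>
  proof -
    have "\<bar>of_int \<lfloor>\<tau> * K\<rfloor> - \<tau> * K\<bar> < 1" by linarith
    then have "\<bar>of_int \<lfloor>\<tau> * K\<rfloor> - \<tau> * K\<bar> / K < 1 / K" using K by (intro divide_strict_right_mono)
    moreover have "of_int \<lfloor>\<tau> * K\<rfloor> / K - \<tau> = (of_int \<lfloor>\<tau> * K\<rfloor> - \<tau> * K) / K" using K by (simp add: field_simps)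
    ultimately show ?thesis using K by (simp add: inverse_eq_divide)
  qed
  show "sob_simple m {0..t} (\<lambda>\<tau>. u (of_int \<lfloor>\<tau> * K\<rfloor> / K))"
    unfolding sob_simple_def
  proof (intro conjI allI)
    have "(\<lambda>\<tau>. u (of_int \<lfloor>\<tau> * K\<rfloor> / K)) ` {0..t} \<subseteq> (\<lambda>i. u (of_int i / K)) ` {0..\<lfloor>t * K\<rfloor>}"
      using K by (force intro!: floor_mono mult_right_mono)
    then show "finite ((\<lambda>\<tau>. u (of_int \<lfloor>\<tau> * K\<rfloor> / K)) ` {0..t})" by (rule finite_subset) simp
    show "(\<lambda>\<tau>. u (of_int \<lfloor>\<tau> * K\<rfloor> / K)) ` {0..t} \<subseteq> sobolev m" using u mem by blast
    fix g
    have "(\<lambda>\<tau>. \<lfloor>\<tau> * K\<rfloor>) \<in> borel \<rightarrow>\<^sub>M count_space UNIV" by measurable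
    then have "(\<lambda>\<tau>. \<lfloor>\<tau> * K\<rfloor>) -` {i. u (of_int i / K) = g} \<inter> space borel \<in> sets borel"
      by (rule measurable_sets) simp
    then have "{0..t} \<inter> (\<lambda>\<tau>. \<lfloor>\<tau> * K\<rfloor>) -` {i. u (of_int i / K) = g} \<in> sets borel" by auto
    moreover have "{\<tau> \<in> {0..t}. u (of_int \<lfloor>\<tau> * K\<rfloor> / K) = g} = {0..t} \<inter> (\<lambda>\<tau>. \<lfloor>\<tau> * K\<rfloor>) -` {i. u (of_int i / K) = g}"
      by auto
    ultimately show "{\<tau> \<in> {0..t}. u (of_int \<lfloor>\<tau> * K\<rfloor> / K) = g} \<in> sets lebesgue" by (simp add: sets_completionI_sets)
  qed
qed

lemma ennreal_tendsto_0I: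
  fixes f :: "nat \<Rightarrow> ennreal"
  assumes "\<And>e::real. e > 0 \<Longrightarrow> \<exists>N0. \<forall>N\<ge>N0. f N \<le> ennreal e"
  shows "f \<longlonglongrightarrow> 0"
proof (rule order_tendstoI)
  fix a :: ennreal assume a: "0 < a"
  obtain e :: real where e: "e > 0" "ennreal e < a"
  proof (cases a)
    case (real r)
    then show ?thesis using a that[of "r / 2"] by (auto simp: ennreal_less_iff)
  next
    case top
    then show ?thesis using that[of 1] by simp
  qed
  obtain N0 where "\<forall>N\<ge>N0. f N \<le> ennreal e" using assms[OF e(1)] by blast
  then show "\<forall>\<^sub>F N in sequentially. f N < a"
    unfolding eventually_sequentially using e(2) by (blast intro: le_less_trans)
qed simp

text \<open>\<open>sob_integral\<close> is a choice, so it means something only once an integral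
  exists. Its coefficients must be the time integrals \<open>a\<close> of the coefficients; the
  integrals of the step functions approach \<open>a\<close> in the weighted norm, and completeness
  produces the element.\<close>

theorem has_sob_integral_exists:
  fixes u :: "real \<Rightarrow> real ^ 'n \<Rightarrow> real"
  assumes u: "u \<in> C_sob m {0..t}" and t: "t \<ge> 0"
  obtains U where "has_sob_integral m {0..t} u U"
proof -
  define s where "s N \<tau> = u (of_int \<lfloor>\<tau> * real (Suc N)\<rfloor> / real (Suc N))" for N \<tau>
  have uS: "u ` {0..t} \<subseteq> sobolev m" using C_sobD[OF u] by blast
  note step = step_approximation_simple[OF uS]
  have simple: "sob_simple m {0..t} (s N)" for N unfolding s_def by (rule step(1))
  have lm: "{0..t} \<in> lmeasurable" by simp
  have unif: "\<exists>N0. \<forall>N\<ge>N0. \<forall>\<tau>\<in>{0..t}. sob_norm m (\<lambda>x. s N \<tau> x - u \<tau> x) < e" if e: "e > 0" for e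
  proof -
    obtain \<delta> where \<delta>: "\<delta> > 0" "\<And>s \<tau>. s \<in> {0..t} \<Longrightarrow> \<tau> \<in> {0..t} \<Longrightarrow> \<bar>s - \<tau>\<bar> < \<delta> \<Longrightarrow> sob_norm m (\<lambda>x. u s x - u \<tau> x) < e"
      by (rule C_sob_uniformly_continuous[OF u _ e]) auto
    obtain N0 where N0: "inverse (real (Suc N0)) < \<delta>" using reals_Archimedean[OF \<delta>(1)] by blast
    have "sob_norm m (\<lambda>x. s N \<tau> x - u \<tau> x) < e" if N: "N \<ge> N0" and \<tau>: "\<tau> \<in> {0..t}" for N \<tau>
    proof -
      have "inverse (real (Suc N)) \<le> inverse (real (Suc N0))" using N by (intro le_imp_inverse_le) auto
      then show ?thesis unfolding s_def using step(3)[where \<tau> = \<tau> and N = N] N0 by (intro \<delta>(2) step(2) \<tau>) linarith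
    qed
    then show ?thesis by blast
  qed
  have meas: "sob_measurable m {0..t} u"
    unfolding sob_measurable_def
  proof (intro conjI exI[of _ s] allI simple)
    show "AE \<tau> in lebesgue_on {0..t}. u \<tau> \<in> sobolev m" by (rule AE_I2) (simp add: C_sobD[OF u])
    show "AE \<tau> in lebesgue_on {0..t}. (\<lambda>N. sob_norm m (\<lambda>x. s N \<tau> x - u \<tau> x)) \<longlonglongrightarrow> 0"
    proof (rule AE_I2, rule LIMSEQ_I)
      fix \<tau> e :: real assume "\<tau> \<in> space (lebesgue_on {0..t})" "e > 0"
      then show "\<exists>N0. \<forall>N\<ge>N0. norm (sob_norm m (\<lambda>x. s N \<tau> x - u \<tau> x) - 0) < e"
        using unif[of e] sob_norm_nonneg[of m] by force
    qed
  qed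
  define a where "a n = integral {0..t} (\<lambda>\<tau>. rcoeff (u \<tau>) n)" for n
  define I where "I N = sob_simple_integral {0..t} (s N)" for N
  have IS: "I N \<in> sobolev m" for N unfolding I_def by (rule sob_simple_integral_sobolev[OF simple])
  note cu = continuous_on_rcoeff[OF u]
  \<comment> \<open>A uniform error \<open>e\<close> of the step function becomes an error of
    squared size \<open>t\<^sup>2 * e\<^sup>2\<close> of the integral, at the full order
    \<open>m\<close>.\<close>
  have approx: "coeff_bound m (\<lambda>n. rcoeff (I N) n - a n) (t\<^sup>2 * e\<^sup>2)"
    if e: "\<And>\<tau>. \<tau> \<in> {0..t} \<Longrightarrow> sob_norm m (\<lambda>x. s N \<tau> x - u \<tau> x) \<le> e" for N e
  proof -
    note r = rcoeff_sob_simple_integral[OF simple[of N] lm]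
    have i: "(\<lambda>\<tau>. rcoeff (s N \<tau>) n - rcoeff (u \<tau>) n) integrable_on {0..t}"
      and eq: "integral {0..t} (\<lambda>\<tau>. rcoeff (s N \<tau>) n - rcoeff (u \<tau>) n) = rcoeff (I N) n - a n" for n
    proof -
      have ir: "(\<lambda>\<tau>. rcoeff (s N \<tau>) n) integrable_on {0..t}"
        by (rule integrable_on_lebesgue_on[OF r(1)]) simp
      have iu: "(\<lambda>\<tau>. rcoeff (u \<tau>) n) integrable_on {0..t}" by (rule integrable_continuous_real[OF cu])
      show "(\<lambda>\<tau>. rcoeff (s N \<tau>) n - rcoeff (u \<tau>) n) integrable_on {0..t}" by (rule integrable_diff[OF ir iu])
      have "integral {0..t} (\<lambda>\<tau>. rcoeff (s N \<tau>) n) = rcoeff (I N) n"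
        using lebesgue_integral_eq_integral[OF r(1)] r(2) by (simp add: I_def)
      then show "integral {0..t} (\<lambda>\<tau>. rcoeff (s N \<tau>) n - rcoeff (u \<tau>) n) = rcoeff (I N) n - a n"
        using integral_diff[OF ir iu] by (simp add: a_def)
    qed
    have "coeff_bound m (\<lambda>n. integral {0..t} (\<lambda>\<tau>. rcoeff (s N \<tau>) n - rcoeff (u \<tau>) n)) (t\<^sup>2 * e\<^sup>2)"
    proof (rule coeff_bound_integral[OF t i])
      fix \<tau> assume \<tau>: "\<tau> \<in> {0..t}"
      have sS: "s N \<tau> \<in> sobolev m" unfolding s_def by (rule C_sobD[OF u step(2)[OF \<tau>]])
      have "rcoeff (\<lambda>x. s N \<tau> x - u \<tau> x) = (\<lambda>n. rcoeff (s N \<tau>) n - rcoeff (u \<tau>) n)"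
        by (rule ext) (rule rcoeff_sobolev_diff[OF sS C_sobD[OF u \<tau>]])
      then show "coeff_bound m (\<lambda>n. rcoeff (s N \<tau>) n - rcoeff (u \<tau>) n) (e\<^sup>2)"
        using sobolev_coeff_bound'[OF sobolev_diff[OF sS C_sobD[OF u \<tau>]] e[OF \<tau>]] by simp
    qed
    then show ?thesis unfolding eq .
  qed
  \<comment> \<open>A subsequence with an explicit rate supplies the null sequence required by
    \<open>sobolev_complete\<close>.\<close>
  have "\<exists>N. \<forall>\<tau>\<in>{0..t}. sob_norm m (\<lambda>x. s N \<tau> x - u \<tau> x) \<le> inverse (real (Suc i))" for i
    using unif[of "inverse (real (Suc i))"] by (force intro: less_imp_le)
  then obtain N where N: "\<And>i \<tau>. \<tau> \<in> {0..t} \<Longrightarrow> sob_norm m (\<lambda>x. s (N i) \<tau> x - u \<tau> x) \<le> inverse (real (Suc i))"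
    by metis
  have "(\<lambda>i. t\<^sup>2 * (inverse (real (Suc i)))\<^sup>2) \<longlonglongrightarrow> t\<^sup>2 * 0\<^sup>2"
    by (intro tendsto_intros LIMSEQ_inverse_real_of_nat)
  then have l: "(\<lambda>i. t\<^sup>2 * (inverse (real (Suc i)))\<^sup>2) \<longlonglongrightarrow> 0" by (simp only: zero_power2 mult_zero_right)
  obtain U where U: "U \<in> sobolev m" "rcoeff U = a"
    by (rule sobolev_complete[OF IS approx[OF N] l])
  have "has_sob_integral m {0..t} u U"
    unfolding has_sob_integral_def
  proof (intro conjI meas U exI[of _ s] allI simple)
    show "(\<lambda>N. \<integral>\<^sup>+ \<tau>. ennreal (sob_norm m (\<lambda>x. s N \<tau> x - u \<tau> x)) \<partial>lebesgue_on {0..t}) \<longlonglongrightarrow> 0"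
    proof (rule ennreal_tendsto_0I)
      fix e :: real assume e: "e > 0"
      obtain N0 where N0: "\<And>N \<tau>. N \<ge> N0 \<Longrightarrow> \<tau> \<in> {0..t} \<Longrightarrow> sob_norm m (\<lambda>x. s N \<tau> x - u \<tau> x) < e / (t + 1)"
        using unif[of "e / (t + 1)"] divide_pos_pos[OF e, of "t + 1"] t by (metis add_nonneg_pos zero_less_one)
      have "(\<integral>\<^sup>+ \<tau>. ennreal (sob_norm m (\<lambda>x. s N \<tau> x - u \<tau> x)) \<partial>lebesgue_on {0..t}) \<le> ennreal e" if "N \<ge> N0" for N
      proof -
        have "(\<integral>\<^sup>+ \<tau>. ennreal (sob_norm m (\<lambda>x. s N \<tau> x - u \<tau> x)) \<partial>lebesgue_on {0..t})
            \<le> (\<integral>\<^sup>+ \<tau>. ennreal (e / (t + 1)) \<partial>lebesgue_on {0..t})"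
          using N0[OF that] by (intro nn_integral_mono ennreal_leI) (auto intro: less_imp_le)
        also have "\<dots> = ennreal (e / (t + 1)) * ennreal t"
          using t by (simp add: emeasure_restrict_space)
        also have "\<dots> = ennreal (e / (t + 1) * t)" using e t by (subst ennreal_mult[symmetric]) auto
        also have "\<dots> \<le> ennreal e" using e t by (intro ennreal_leI) (simp add: field_simps)
        finally show ?thesis .
      qed
      then show "\<exists>N0. \<forall>N\<ge>N0. (\<integral>\<^sup>+ \<tau>. ennreal (sob_norm m (\<lambda>x. s N \<tau> x - u \<tau> x)) \<partial>lebesgue_on {0..t}) \<le> ennreal e"
        by blast
    qed
    show "(\<lambda>N. sob_norm m (\<lambda>x. sob_simple_integral {0..t} (s N) x - U x)) \<longlonglongrightarrow> 0"
    proof (rule LIMSEQ_I)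
      fix e :: real assume e: "e > 0"
      define V where "V = torus_volume TYPE('n)"
      have V: "V > 0" by (simp add: V_def)
      \<comment> \<open>The error of the integral is at most \<open>sqrt V * t * \<epsilon>\<close>;
        using \<open>t + 1\<close> makes it strictly less than \<open>e\<close> and also covers
        \<open>t = 0\<close>.\<close>
      define \<epsilon> where "\<epsilon> = e / (sqrt V * (t + 1))"
      have \<epsilon>: "\<epsilon> > 0" using e V t by (simp add: \<epsilon>_def)
      obtain N0 where N0: "\<And>N \<tau>. N \<ge> N0 \<Longrightarrow> \<tau> \<in> {0..t} \<Longrightarrow> sob_norm m (\<lambda>x. s N \<tau> x - u \<tau> x) < \<epsilon>"
        using unif[OF \<epsilon>] by blast
      have "norm (sob_norm m (\<lambda>x. sob_simple_integral {0..t} (s N) x - U x) - 0) < e" if "N \<ge> N0" for N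
      proof -
        have "rcoeff (\<lambda>x. I N x - U x) = (\<lambda>n. rcoeff (I N) n - a n)"
          unfolding U(2)[symmetric] by (rule ext) (rule rcoeff_sobolev_diff[OF IS U(1)])
        then have "coeff_bound m (rcoeff (\<lambda>x. I N x - U x)) (t\<^sup>2 * \<epsilon>\<^sup>2)"
          using approx[of N \<epsilon>] N0[OF that] by (simp add: less_imp_le)
        from sob_norm_le_coeff_bound[OF sobolev_diff[OF IS U(1)] this]
        have "(sob_norm m (\<lambda>x. I N x - U x))\<^sup>2 \<le> V * (t\<^sup>2 * \<epsilon>\<^sup>2)" by (simp add: V_def)
        also have "\<dots> = (sqrt V * t * \<epsilon>)\<^sup>2" using V by (simp add: power_mult_distrib)
        finally have "sob_norm m (\<lambda>x. I N x - U x) \<le> sqrt V * t * \<epsilon>"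
          by (rule power2_le_imp_le) (use V t \<epsilon> in simp)
        also have "sqrt V * t * \<epsilon> = e * (t / (t + 1))" using V t by (simp add: \<epsilon>_def)
        also have "\<dots> < e * 1" using e t by (intro mult_strict_left_mono) auto
        also have "\<dots> = e" by simp
        finally show ?thesis using sob_norm_nonneg by (simp add: I_def)
      qed
      then show "\<exists>N0. \<forall>N\<ge>N0. norm (sob_norm m (\<lambda>x. sob_simple_integral {0..t} (s N) x - U x) - 0) < e" by blast
    qed
  qed
  then show thesis by (rule that)
qed

section \<open>Test functions in time and the fundamental lemma of the calculus of
  variations\<close>

subsection \<open>Smooth bump functions and weak derivatives in time\<close>

text \<open>The powers in the denominator make the family stable: a derivative of
  \<open>flat k\<close> is a combination of \<open>flat (k + 2)\<close> and
  \<open>flat (Suc k)\<close>, also at the origin.\<close>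

definition flat :: "nat \<Rightarrow> real \<Rightarrow> real" where
  "flat k x = (if x \<le> 0 then 0 else exp (- (1 / x)) / x ^ k)"

lemma flat_nonneg: "flat k x \<ge> 0"
  by (simp add: flat_def)

text \<open>A single term of the exponential series, the one of order \<open>Suc k\<close>, already
  beats \<open>1 / x ^ k\<close> with a factor \<open>x\<close> to spare. Since
  \<open>flat k h / h = flat (Suc k) h\<close>, this gives the derivative at 0 for every
  \<open>k\<close>.\<close>

lemma flat_bound: "\<bar>flat k x\<bar> \<le> fact (Suc k) * \<bar>x\<bar>"
proof (cases "x \<le> 0")
  case True
  then have "flat k x = 0" by (simp add: flat_def)
  then show ?thesis by (simp add: mult_nonneg_nonneg del: fact_Suc)
next
  case False
  then have x: "x > 0" by simp
  have "(1 / x) ^ Suc k / fact (Suc k) \<le> exp (1 / x)"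
  proof -
    have "(\<Sum>i\<in>{Suc k}. (1 / x) ^ i /\<^sub>R fact i) \<le> exp (1 / x)"
      unfolding exp_def using x by (intro sum_le_suminf summable_exp_generic) auto
    then show ?thesis by (simp add: divide_inverse mult.commute)
  qed
  then have "exp (- (1 / x)) * ((1 / x) ^ Suc k / fact (Suc k)) \<le> exp (- (1 / x)) * exp (1 / x)"
    by (intro mult_left_mono) auto
  then have "exp (- (1 / x)) * ((1 / x) ^ Suc k / fact (Suc k)) \<le> 1" by (simp flip: exp_add)
  then have "exp (- (1 / x)) / x ^ k * (1 / (x * fact (Suc k))) \<le> 1"
    by (simp add: power_divide mult_ac)
  then have "exp (- (1 / x)) / x ^ k \<le> x * fact (Suc k)"
    using x by (simp add: divide_le_eq pos_divide_le_eq mult_ac)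
  then show ?thesis using x by (simp add: flat_def mult.commute)
qed

lemma flat_has_derivative:
  "(flat k has_real_derivative (flat (k + 2) x - real k * flat (Suc k) x)) (at x)"
proof -
  consider "x < 0" | "x = 0" | "x > 0" by linarith
  then show ?thesis
  proof cases
    case 1
    have "((\<lambda>x. 0) has_real_derivative (flat (k + 2) x - real k * flat (Suc k) x)) (at x)"
      using 1 by (simp add: flat_def)
    then show ?thesis
      by (rule has_field_derivative_transform_within_open[of _ _ _ "{..<0}"]) (use 1 in \<open>auto simp: flat_def\<close>)
  next
    case 2
    have "(\<lambda>h. flat k h / h) \<midarrow>0\<rightarrow> 0"
    proof (rule Lim_null_comparison)
      show "\<forall>\<^sub>F h in at 0. norm (flat k h / h) \<le> fact (Suc (Suc k)) * \<bar>h\<bar>"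
      proof (intro always_eventually allI)
        fix h :: real
        have "flat k h / h = flat (Suc k) h" by (simp add: flat_def)
        then show "norm (flat k h / h) \<le> fact (Suc (Suc k)) * \<bar>h\<bar>" using flat_bound[of "Suc k" h] by simp
      qed
      have "((\<lambda>h::real. fact (Suc (Suc k)) * \<bar>h\<bar>) \<longlongrightarrow> fact (Suc (Suc k)) * \<bar>0\<bar>) (at 0)"
        by (intro tendsto_intros)
      then show "((\<lambda>h::real. fact (Suc (Suc k)) * \<bar>h\<bar>) \<longlongrightarrow> 0) (at 0)" by simp
    qed
    then show ?thesis using 2 by (simp add: DERIV_def flat_def)
  next
    case 3
    have "((\<lambda>x. exp (- (1 / x)) / x ^ k) has_real_derivative
        (exp (- (1 / x)) * (1 / x ^ 2) * x ^ k - exp (- (1 / x)) * (real k * x ^ (k - 1))) / (x ^ k * x ^ k)) (at x)"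
      using 3 by (auto intro!: derivative_eq_intros simp: power2_eq_square)
    moreover have "(exp (- (1 / x)) * (1 / x ^ 2) * x ^ k - exp (- (1 / x)) * (real k * x ^ (k - 1))) / (x ^ k * x ^ k)
        = flat (k + 2) x - real k * flat (Suc k) x"
      using 3 by (cases k) (auto simp: flat_def field_simps power2_eq_square)
    ultimately have "((\<lambda>x. exp (- (1 / x)) / x ^ k) has_real_derivative (flat (k + 2) x - real k * flat (Suc k) x)) (at x)"
      by simp
    then show ?thesis
      by (rule has_field_derivative_transform_within_open[of _ _ _ "{0<..}"]) (use 3 in \<open>auto simp: flat_def\<close>)
  qed
qed

text \<open>A class that contains the bumps and is closed under differentiation: the product rule
  yields sums of products of the same kind.\<close>

inductive bump_like :: "(real \<Rightarrow> real) \<Rightarrow> bool" where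
  prod: "bump_like (\<lambda>x. c * flat k (x - a) * flat l (b - x))"
| add: "bump_like f \<Longrightarrow> bump_like g \<Longrightarrow> bump_like (\<lambda>x. f x + g x)"

lemma bump_like_derivative:
  "bump_like f \<Longrightarrow> \<exists>f'. bump_like f' \<and> (\<forall>x. (f has_real_derivative f' x) (at x))"
proof (induction rule: bump_like.induct)
  case (prod c k a l b)
  define f' where "f' x = (c * flat (k + 2) (x - a) * flat l (b - x) + (- c * real k) * flat (Suc k) (x - a) * flat l (b - x))
    + ((- c) * flat k (x - a) * flat (l + 2) (b - x) + (c * real l) * flat k (x - a) * flat (Suc l) (b - x))" for x
  have "bump_like f'" unfolding f'_def by (intro bump_like.intros)
  moreover have "((\<lambda>x. c * flat k (x - a) * flat l (b - x)) has_real_derivative f' x) (at x)" for x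
  proof -
    have 1: "((\<lambda>x. flat k (x - a)) has_real_derivative (flat (k + 2) (x - a) - real k * flat (Suc k) (x - a)) * 1) (at x)"
      by (rule DERIV_chain2[OF flat_has_derivative]) (auto intro!: derivative_eq_intros)
    have 2: "((\<lambda>x. flat l (b - x)) has_real_derivative (flat (l + 2) (b - x) - real l * flat (Suc l) (b - x)) * (- 1)) (at x)"
      by (rule DERIV_chain2[OF flat_has_derivative]) (auto intro!: derivative_eq_intros)
    show ?thesis unfolding f'_def
      by (rule DERIV_cong[OF DERIV_mult[OF DERIV_cmult[OF 1] 2]]) (simp add: algebra_simps)
  qed
  ultimately show ?case by blast
next
  case (add f g)
  then obtain f' g' where "bump_like f'" "bump_like g'" "\<And>x. (f has_real_derivative f' x) (at x)"
    "\<And>x. (g has_real_derivative g' x) (at x)" by blast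
  then show ?case
    by (intro exI[of _ "\<lambda>x. f' x + g' x"]) (auto intro: bump_like.add DERIV_add)
qed

text \<open>The only basis vector of the reals is 1, so iterated directional derivatives are
  iterated ordinary derivatives and never leave the class \<open>P\<close>.\<close>

lemma smooth_if_derivative_closed:
  fixes P :: "(real \<Rightarrow> real) \<Rightarrow> bool"
  assumes closed: "\<And>f. P f \<Longrightarrow> \<exists>f'. P f' \<and> (\<forall>x. (f has_real_derivative f' x) (at x))" and P: "P f"
  shows "smooth f"
proof -
  have "P (iter_deriv bs f)" if "set bs \<subseteq> Basis" for bs
    using that
  proof (induction bs)
    case Nil
    then show ?case using P by (simp add: iter_deriv_def)
  next
    case (Cons b bs)
    then have "P (iter_deriv bs f)" and b: "b = 1" by auto
    then obtain g' where g': "P g'" "\<And>x. (iter_deriv bs f has_real_derivative g' x) (at x)"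
      using closed by blast
    have "frechet_derivative (iter_deriv bs f) (at x) b = g' x" for x
      using frechet_derivative_at[OF g'(2)[of x, unfolded has_field_derivative_def]] b
      by (metis mult.right_neutral)
    then have "iter_deriv (b # bs) f = g'" by (auto simp: iter_deriv_def)
    then show ?case using g'(1) by simp
  qed
  then show ?thesis unfolding smooth_def
    using closed real_differentiable_def differentiable_def by (metis has_field_derivative_def)
qed

definition bump :: "real \<Rightarrow> real \<Rightarrow> real" where
  "bump \<epsilon> x = flat 0 x * flat 0 (\<epsilon> - x)"

lemma bump_nonneg: "bump \<epsilon> x \<ge> 0"
  by (simp add: bump_def flat_nonneg)

lemma bump_eq_0: "x \<notin> {0..\<epsilon>} \<Longrightarrow> bump \<epsilon> x = 0"
  by (auto simp: bump_def flat_def)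

lemma bump_like_bump: "bump_like (\<lambda>x. c * bump \<epsilon> (x - s))"
proof -
  have "(\<lambda>x. c * bump \<epsilon> (x - s)) = (\<lambda>x. c * flat 0 (x - s) * flat 0 ((s + \<epsilon>) - x))"
    by (auto simp: bump_def algebra_simps)
  then show ?thesis using bump_like.prod[of c 0 s 0 "s + \<epsilon>"] by simp
qed

lemma continuous_on_bump: "continuous_on S (\<lambda>x. bump \<epsilon> (x - s))"
proof -
  obtain f' where "\<And>x. ((\<lambda>x. 1 * bump \<epsilon> (x - s)) has_real_derivative f' x) (at x)"
    using bump_like_derivative[OF bump_like_bump[of 1 \<epsilon> s]] by blast
  then show ?thesis
    by (intro DERIV_continuous_on[where D = f']) (auto intro: has_field_derivative_at_within)
qed

text \<open>The mass does not depend on the position \<open>s\<close> as long as the support fits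
  into the interval. Hence two translates differ by a function of mean zero.\<close>

lemma bump_integral:
  assumes "\<epsilon> > 0"
  obtains I where "I > 0" "\<And>s a b. a \<le> s \<Longrightarrow> s + \<epsilon> \<le> b \<Longrightarrow> ((\<lambda>x. bump \<epsilon> (x - s)) has_integral I) {a..b}"
proof -
  define I where "I = integral {0..\<epsilon>} (bump \<epsilon>)"
  have c: "continuous_on {0..\<epsilon>} (bump \<epsilon>)" using continuous_on_bump[of _ \<epsilon> 0] by simp
  then have hI: "(bump \<epsilon> has_integral I) {0..\<epsilon>}"
    unfolding I_def by (intro integrable_integral integrable_continuous_real)
  have "I \<noteq> 0"
  proof
    assume "I = 0"
    then have "\<forall>x\<in>{0..\<epsilon>}. bump \<epsilon> x = 0"
      using integral_eq_0_iff[OF c assms] bump_nonneg unfolding I_def by auto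
    moreover have "bump \<epsilon> (\<epsilon> / 2) > 0" using assms by (simp add: bump_def flat_def)
    ultimately show False using assms by auto
  qed
  moreover have "I \<ge> 0" using has_integral_nonneg[OF hI] bump_nonneg by blast
  ultimately have "I > 0" by simp
  moreover have "((\<lambda>x. bump \<epsilon> (x - s)) has_integral I) {a..b}" if "a \<le> s" "s + \<epsilon> \<le> b" for s a b
  proof (rule has_integral_on_superset)
    show "((\<lambda>x. bump \<epsilon> (x - s)) has_integral I) {s..s + \<epsilon>}"
      using has_integral_shift_real_ivl[OF hI, of "- s"] by (simp add: add.commute)
  qed (use that in \<open>auto intro: bump_eq_0\<close>)
  ultimately show thesis using that by blast
qed

text \<open>Testing with the antiderivative of the difference of two translates of a bump shows that the
  local averages of \<open>g - \<integral> r\<close> at two points agree.\<close>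

theorem du_bois_reymond:
  fixes g r :: "real \<Rightarrow> complex"
  assumes T: "T > 0" and g: "continuous_on {0..T} g" and r: "continuous_on {0..T} r"
    and weak: "\<And>\<eta>. smooth \<eta> \<Longrightarrow> (\<exists>a b. 0 < a \<and> b < T \<and> (\<forall>t. t \<notin> {a..b} \<longrightarrow> \<eta> t = 0)) \<Longrightarrow>
      integral {0..T} (\<lambda>t. deriv \<eta> t *\<^sub>R g t) = - integral {0..T} (\<lambda>t. \<eta> t *\<^sub>R r t)"
    and t: "t \<in> {0..T}"
  shows "(g has_vector_derivative r t) (at t within {0..T})"
proof -
  \<comment> \<open>A primitive of the expected derivative; what has to be shown is that
    \<open>g - R\<close> is constant.\<close>
  define R where "R t = integral {0..t} r" for t
  have dR: "(R has_vector_derivative r t) (at t within {0..T})" if "t \<in> {0..T}" for t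
    unfolding R_def by (rule integral_has_vector_derivative[OF r that])
  have cR: "continuous_on {0..T} R"
    using dR has_vector_derivative_continuous continuous_on_eq_continuous_within by blast
  define G where "G t = g t - R t" for t
  have cG: "continuous_on {0..T} G" unfolding G_def by (intro continuous_intros g cR)
  have eq: "integral {0..T} (\<lambda>t. bump \<epsilon> (t - s0) *\<^sub>R G t) = integral {0..T} (\<lambda>t. bump \<epsilon> (t - s1) *\<^sub>R G t)"
    if \<epsilon>: "\<epsilon> > 0" and s: "0 < s0" "s0 \<le> s1" "s1 + \<epsilon> < T" for \<epsilon> s0 s1
  proof -
    obtain I where I: "\<And>s a b. a \<le> s \<Longrightarrow> s + \<epsilon> \<le> b \<Longrightarrow> ((\<lambda>x. bump \<epsilon> (x - s)) has_integral I) {a..b}"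
      using bump_integral[OF \<epsilon>] by metis
    \<comment> \<open>The difference of two translates has mean zero, so its primitive
      \<open>\<eta>\<close> vanishes again after the second bump and is an admissible test
      function.\<close>
    define \<rho> where "\<rho> x = 1 * bump \<epsilon> (x - s0) + (- 1) * bump \<epsilon> (x - s1)" for x
    have \<rho>b: "bump_like \<rho>" unfolding \<rho>_def by (intro bump_like.add bump_like_bump)
    have c\<rho>: "continuous_on S \<rho>" for S unfolding \<rho>_def by (intro continuous_intros continuous_on_bump)
    have \<rho>0: "\<rho> x = 0" if "x \<notin> {s0..s1 + \<epsilon>}" for x
      using that s \<epsilon> by (auto simp: \<rho>_def bump_eq_0)
    define \<eta> where "\<eta> t = integral {0..t} \<rho>" for t
    have h\<rho>: "(\<rho> has_integral 0) {0..t}" if "t \<ge> s1 + \<epsilon>" for t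
      unfolding \<rho>_def using s that
      by (rule_tac has_integral_eq_rhs[OF has_integral_add[OF has_integral_mult_right[OF I] has_integral_mult_right[OF I]]]) auto
    have \<eta>0: "\<eta> t = 0" if "t \<notin> {s0..s1 + \<epsilon>}" for t
    proof (cases "t < s0")
      case True
      then have "\<eta> t = integral {0..t} (\<lambda>x. 0)"
        unfolding \<eta>_def by (intro integral_cong \<rho>0) auto
      then show ?thesis by simp
    next
      case False
      then have "t \<ge> s1 + \<epsilon>" using that by auto
      then show ?thesis unfolding \<eta>_def using h\<rho> by (intro integral_unique)
    qed
    have d\<eta>: "(\<eta> has_real_derivative \<rho> x) (at x)" for x
    proof (cases "x < s0")
      case True
      have "((\<lambda>t. 0) has_real_derivative \<rho> x) (at x)" using \<rho>0[of x] True by simp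
      then show ?thesis
        by (rule has_field_derivative_transform_within_open[of _ _ _ "{..<s0}"]) (use True \<eta>0 in auto)
    next
      case False
      then have x: "x \<in> {0..x + 1}" "0 < x" "x < x + 1" using s by auto
      have "(\<eta> has_real_derivative \<rho> x) (at x within {0..x + 1})"
        unfolding \<eta>_def using integral_has_real_derivative[OF c\<rho> x(1)] .
      then show ?thesis using at_within_Icc_at[OF x(2,3)] by simp
    qed
    \<comment> \<open>\<open>\<eta>\<close> is given as an integral, not as a combination of
      products of \<open>flat\<close>. Adjoining it to the class suffices, because its derivative
      \<open>\<rho>\<close> belongs to the class.\<close>
    have sm: "smooth \<eta>"
    proof (rule smooth_if_derivative_closed[of "\<lambda>f. f = \<eta> \<or> bump_like f"])
      show "\<exists>f'. (f' = \<eta> \<or> bump_like f') \<and> (\<forall>x. (f has_real_derivative f' x) (at x))" if "f = \<eta> \<or> bump_like f" for f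
        using that d\<eta> \<rho>b bump_like_derivative by blast
    qed simp
    have supp: "\<exists>a b. 0 < a \<and> b < T \<and> (\<forall>t. t \<notin> {a..b} \<longrightarrow> \<eta> t = 0)"
      using s \<eta>0 by (intro exI[of _ s0] exI[of _ "s1 + \<epsilon>"]) auto
    have der: "deriv \<eta> t = \<rho> t" for t by (rule DERIV_imp_deriv[OF d\<eta>])
    have c\<eta>: "continuous_on {0..T} \<eta>"
      using d\<eta> by (intro DERIV_continuous_on[where D = \<rho>]) (auto intro: has_field_derivative_at_within)
    have w: "integral {0..T} (\<lambda>t. \<rho> t *\<^sub>R g t) = - integral {0..T} (\<lambda>t. \<eta> t *\<^sub>R r t)"
      using weak[OF sm supp] by (simp add: der)
    \<comment> \<open>Integration by parts: \<open>R\<close> satisfies the same weak identity as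
      \<open>g\<close>, so \<open>\<rho>\<close> annihilates their difference
      \<open>G\<close>.\<close>
    have "((\<lambda>t. \<rho> t *\<^sub>R R t + \<eta> t *\<^sub>R r t) has_integral (\<eta> T *\<^sub>R R T - \<eta> 0 *\<^sub>R R 0)) {0..T}"
    proof (rule fundamental_theorem_of_calculus)
      fix x assume x: "x \<in> {0..T}"
      have "(\<eta> has_field_derivative \<rho> x) (at x within {0..T})" by (rule has_field_derivative_at_within[OF d\<eta>])
      from has_vector_derivative_scaleR[OF this dR[OF x]]
      show "((\<lambda>t. \<eta> t *\<^sub>R R t) has_vector_derivative \<rho> x *\<^sub>R R x + \<eta> x *\<^sub>R r x) (at x within {0..T})"
        by (simp add: add.commute)
    qed (use T in simp)
    moreover have "\<eta> 0 = 0" "\<eta> T = 0" using \<eta>0[of 0] \<eta>0[of T] s \<epsilon> by auto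
    ultimately have "integral {0..T} (\<lambda>t. \<rho> t *\<^sub>R R t + \<eta> t *\<^sub>R r t) = 0" by (simp add: integral_unique)
    moreover have "integral {0..T} (\<lambda>t. \<rho> t *\<^sub>R R t + \<eta> t *\<^sub>R r t)
        = integral {0..T} (\<lambda>t. \<rho> t *\<^sub>R R t) + integral {0..T} (\<lambda>t. \<eta> t *\<^sub>R r t)"
      by (intro integral_add integrable_continuous_real continuous_intros c\<rho> cR c\<eta> r)
    moreover have "integral {0..T} (\<lambda>t. \<rho> t *\<^sub>R G t) = integral {0..T} (\<lambda>t. \<rho> t *\<^sub>R g t) - integral {0..T} (\<lambda>t. \<rho> t *\<^sub>R R t)"
      unfolding G_def scaleR_diff_right
      by (intro integral_diff integrable_continuous_real continuous_intros c\<rho> cR g)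
    ultimately have "integral {0..T} (\<lambda>t. \<rho> t *\<^sub>R G t) = 0" using w by (simp add: add_eq_0_iff)
    moreover have "integral {0..T} (\<lambda>t. \<rho> t *\<^sub>R G t)
        = integral {0..T} (\<lambda>t. bump \<epsilon> (t - s0) *\<^sub>R G t) - integral {0..T} (\<lambda>t. bump \<epsilon> (t - s1) *\<^sub>R G t)"
      by (subst integral_diff[symmetric])
        (auto intro!: integrable_continuous_real continuous_intros continuous_on_bump cG simp: \<rho>_def scaleR_diff_left)
    ultimately show ?thesis by simp
  qed
  \<comment> \<open>The mass \<open>I\<close> of the bump depends on its width, so the error of the
    local average is measured relative to \<open>I\<close>, which can then be divided out.\<close>
  have near: "\<exists>d>0. \<forall>\<epsilon>. 0 < \<epsilon> \<and> \<epsilon> < d \<longrightarrow> (\<forall>I. ((\<lambda>x. bump \<epsilon> (x - s)) has_integral I) {0..T} \<longrightarrow>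
      cmod (integral {0..T} (\<lambda>t. bump \<epsilon> (t - s) *\<^sub>R G t) - I *\<^sub>R G s) \<le> I * e)"
    if s: "s \<in> {0<..<T}" and e: "e > 0" for s e
  proof -
    have "s \<in> {0..T}" using s by auto
    then obtain d where d: "d > 0" "\<And>x. x \<in> {0..T} \<Longrightarrow> dist x s < d \<Longrightarrow> dist (G x) (G s) < e"
      using cG e unfolding continuous_on_iff by blast
    have "cmod (integral {0..T} (\<lambda>t. bump \<epsilon> (t - s) *\<^sub>R G t) - I *\<^sub>R G s) \<le> I * e"
      if \<epsilon>: "0 < \<epsilon>" "\<epsilon> < d" and I: "((\<lambda>x. bump \<epsilon> (x - s)) has_integral I) {0..T}" for \<epsilon> I
    proof -
      have i1: "(\<lambda>t. bump \<epsilon> (t - s) *\<^sub>R G t) integrable_on {0..T}"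
        by (intro integrable_continuous_real continuous_intros continuous_on_bump cG)
      have h: "((\<lambda>t. bump \<epsilon> (t - s) *\<^sub>R G t - bump \<epsilon> (t - s) *\<^sub>R G s) has_integral
          (integral {0..T} (\<lambda>t. bump \<epsilon> (t - s) *\<^sub>R G t) - I *\<^sub>R G s)) {0..T}"
        by (intro has_integral_diff integrable_integral i1 has_integral_scaleR_left I)
      have he: "((\<lambda>t. bump \<epsilon> (t - s) * e) has_integral (I * e)) {0..T}" by (rule has_integral_mult_left[OF I])
      have "norm (integral {0..T} (\<lambda>t. bump \<epsilon> (t - s) *\<^sub>R G t - bump \<epsilon> (t - s) *\<^sub>R G s))
          \<le> integral {0..T} (\<lambda>t. bump \<epsilon> (t - s) * e)"
      proof (rule integral_norm_bound_integral)
        fix x assume x: "x \<in> {0..T}"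
        show "norm (bump \<epsilon> (x - s) *\<^sub>R G x - bump \<epsilon> (x - s) *\<^sub>R G s) \<le> bump \<epsilon> (x - s) * e"
        proof (cases "x - s \<in> {0..\<epsilon>}")
          case True
          then have "dist x s < d" using \<epsilon> by (auto simp: dist_real_def)
          then have "norm (G x - G s) \<le> e" using d(2)[OF x] by (simp add: dist_norm)
          then show ?thesis by (simp add: bump_nonneg mult_left_mono flip: scaleR_diff_right)
        qed (simp add: bump_eq_0)
      qed (use h he in \<open>auto simp: integrable_on_def\<close>)
      then show ?thesis unfolding integral_unique[OF h] integral_unique[OF he] .
    qed
    then show ?thesis using d(1) by blast
  qed
  have const_le: "G s0 = G s1" if s0: "s0 \<in> {0<..<T}" and s1: "s1 \<in> {0<..<T}" and le: "s0 \<le> s1" for s0 s1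
  proof -
    have "cmod (G s0 - G s1) \<le> 0 + e" if e: "e > 0" for e
    proof -
      have e2: "e / 2 > 0" using e by simp
      from near[OF s0 e2] obtain d0 where d0: "d0 > 0"
        "\<forall>\<epsilon>. 0 < \<epsilon> \<and> \<epsilon> < d0 \<longrightarrow> (\<forall>I. ((\<lambda>x. bump \<epsilon> (x - s0)) has_integral I) {0..T} \<longrightarrow>
          cmod (integral {0..T} (\<lambda>t. bump \<epsilon> (t - s0) *\<^sub>R G t) - I *\<^sub>R G s0) \<le> I * (e / 2))"
        by (elim exE conjE)
      from near[OF s1 e2] obtain d1 where d1: "d1 > 0"
        "\<forall>\<epsilon>. 0 < \<epsilon> \<and> \<epsilon> < d1 \<longrightarrow> (\<forall>I. ((\<lambda>x. bump \<epsilon> (x - s1)) has_integral I) {0..T} \<longrightarrow>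
          cmod (integral {0..T} (\<lambda>t. bump \<epsilon> (t - s1) *\<^sub>R G t) - I *\<^sub>R G s1) \<le> I * (e / 2))"
        by (elim exE conjE)
      define \<epsilon> where "\<epsilon> = min (min d0 d1) (T - s1) / 2"
      have \<epsilon>: "0 < \<epsilon>" "\<epsilon> < d0" "\<epsilon> < d1" "s1 + \<epsilon> < T"
        using d0(1) d1(1) s1 by (auto simp: \<epsilon>_def min_def field_simps)
      obtain I where I: "I > 0" "\<And>s a b. a \<le> s \<Longrightarrow> s + \<epsilon> \<le> b \<Longrightarrow> ((\<lambda>x. bump \<epsilon> (x - s)) has_integral I) {a..b}"
        using bump_integral[OF \<epsilon>(1)] by metis
      define J where "J = integral {0..T} (\<lambda>t. bump \<epsilon> (t - s0) *\<^sub>R G t)"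
      have b0: "cmod (J - I *\<^sub>R G s0) \<le> I * (e / 2)"
        unfolding J_def using s0 le \<epsilon> by (intro d0(2)[rule_format] conjI I(2)) auto
      have b1: "cmod (J - I *\<^sub>R G s1) \<le> I * (e / 2)"
      proof -
        have "J = integral {0..T} (\<lambda>t. bump \<epsilon> (t - s1) *\<^sub>R G t)"
          unfolding J_def using s0 by (intro eq[OF \<epsilon>(1) _ le \<epsilon>(4)]) simp
        moreover have "cmod (integral {0..T} (\<lambda>t. bump \<epsilon> (t - s1) *\<^sub>R G t) - I *\<^sub>R G s1) \<le> I * (e / 2)"
          using s1 \<epsilon> by (intro d1(2)[rule_format] conjI I(2)) auto
        ultimately show ?thesis by (simp only:)
      qed
      have split: "I *\<^sub>R (G s0 - G s1) = (J - I *\<^sub>R G s1) - (J - I *\<^sub>R G s0)" by (simp add: scaleR_diff_right)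
      have "cmod (I *\<^sub>R (G s0 - G s1)) \<le> I * (e / 2) + I * (e / 2)"
        unfolding split using b0 b1 norm_triangle_ineq4[of "J - I *\<^sub>R G s1" "J - I *\<^sub>R G s0"] by linarith
      then have "I * cmod (G s0 - G s1) \<le> I * e"
        unfolding norm_scaleR using I(1) by (simp only: abs_of_pos field_sum_of_halves flip: distrib_left)
      then show ?thesis using I(1) by simp
    qed
    then have "cmod (G s0 - G s1) \<le> 0" by (rule field_le_epsilon)
    then show ?thesis by simp
  qed
  define K where "K = G (T / 2)"
  have half: "T / 2 \<in> {0<..<T}" using T by auto
  have "G s = K" if "s \<in> {0<..<T}" for s
    using const_le[OF that half] const_le[OF half that] unfolding K_def by (cases "s \<le> T / 2") auto
  \<comment> \<open>Test functions vanish near the end points, so constancy is reached there only by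
    continuity.\<close>
  moreover have "continuous_on (closure {0<..<T}) G" using cG T by simp
  ultimately have GK: "G s = K" if "s \<in> {0..T}" for s
    using continuous_constant_on_closure[of "{0<..<T}" G K s] that T by auto
  have "((\<lambda>t. K + R t) has_vector_derivative 0 + r t) (at t within {0..T})"
    by (intro has_vector_derivative_add has_vector_derivative_const dR t)
  then show ?thesis
    using has_vector_derivative_transform[OF t, of g "\<lambda>t. K + R t" "r t"] GK by (simp add: G_def eq_diff_eq diff_eq_eq)
qed

section \<open>Transfer of the equation and of the norms to coefficients, and conclusion\<close>

subsection \<open>From the equation to its Fourier coefficients\<close>

lemma smooth_real_continuous:
  fixes \<eta> :: "real \<Rightarrow> real"
  assumes "smooth \<eta>"
  shows "continuous_on S \<eta>" and "continuous_on S (deriv \<eta>)"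
proof -
  have d: "iter_deriv bs \<eta> differentiable (at x)" if "set bs \<subseteq> Basis" for bs x
    using assms that by (simp add: smooth_def)
  have d0: "\<eta> differentiable (at x)" for x using d[of "[]" x] by (simp add: iter_deriv_def)
  have "iter_deriv [1] \<eta> = deriv \<eta>"
  proof
    fix x
    have D: "(\<eta> has_real_derivative deriv \<eta> x) (at x)"
      using d0[of x] by (simp add: DERIV_deriv_iff_real_differentiable)
    show "iter_deriv [1] \<eta> x = deriv \<eta> x"
      using frechet_derivative_at[OF D[unfolded has_field_derivative_def]]
      by (simp add: iter_deriv_def) (metis mult.right_neutral)
  qed
  then have d1: "deriv \<eta> differentiable (at x)" for x using d[of "[1]" x] by simp
  have c: "continuous_on S g" if "\<And>x. g differentiable (at x)" for g :: "real \<Rightarrow> real"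
    by (intro continuous_at_imp_continuous_on ballI differentiable_imp_continuous_within that)
  show "continuous_on S \<eta>" "continuous_on S (deriv \<eta>)" using c d0 d1 by blast+
qed

lemma sob_norm_component_le: "sob_norm m (\<lambda>x. v x $ j) \<le> vec_sob_norm m (v :: real ^ 'n \<Rightarrow> real ^ 'n)"
proof -
  have "(sob_norm m (\<lambda>x. v x $ j))\<^sup>2 \<le> (\<Sum>j\<in>UNIV. (sob_norm m (\<lambda>x. v x $ j))\<^sup>2)"
    by (rule member_le_sum[of j UNIV "\<lambda>j. (sob_norm m (\<lambda>x. v x $ j))\<^sup>2"]) auto
  then show ?thesis unfolding vec_sob_norm_def by (rule real_le_rsqrt)
qed

lemma vec_sob_norm_nonneg: "vec_sob_norm m v \<ge> 0"
  by (simp add: vec_sob_norm_def sum_nonneg)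

lemma C_sob_sigma_component:
  assumes v: "v \<in> C_sob_sigma m J"
  shows "(\<lambda>t x. v t x $ j) \<in> C_sob m J"
  unfolding C_sob_def
proof (intro CollectI conjI ballI)
  show "(\<lambda>x. v t x $ j) \<in> sobolev m" if "t \<in> J" for t
    using v that by (simp add: C_sob_sigma_def sobolev_sigma_def)
  fix r assume r: "r \<in> J"
  show "((\<lambda>t. sob_norm m (\<lambda>x. v t x $ j - v r x $ j)) \<longlongrightarrow> 0) (at r within J)"
  proof (rule Lim_null_comparison)
    show "((\<lambda>t. vec_sob_norm m (\<lambda>x. v t x - v r x)) \<longlongrightarrow> 0) (at r within J)"
      using v r by (simp add: C_sob_sigma_def)
    show "\<forall>\<^sub>F t in at r within J. norm (sob_norm m (\<lambda>x. v t x $ j - v r x $ j)) \<le> vec_sob_norm m (\<lambda>x. v t x - v r x)"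
      using sob_norm_component_le[of m "\<lambda>x. v t x - v r x" j for t] by (intro always_eventually allI) simp
  qed
qed

text \<open>A supremum of reals dominates its members only if they are bounded above; this is
  checked for \<open>vec_C_norm\<close> and \<open>relax_norm\<close> before either is used.\<close>

lemma vec_sob_norm_bdd_above:
  assumes "\<And>j. \<exists>B. \<forall>t\<in>J. sob_norm m (\<lambda>x. V t x $ j) \<le> B"
  shows "bdd_above ((\<lambda>t. vec_sob_norm m (V t :: real ^ 'n \<Rightarrow> real ^ 'n)) ` J)"
proof -
  obtain B where B: "\<And>j t. t \<in> J \<Longrightarrow> sob_norm m (\<lambda>x. V t x $ j) \<le> B j" using assms by metis
  show ?thesis
  proof (rule bdd_aboveI2)
    fix t assume "t \<in> J"
    then show "vec_sob_norm m (V t) \<le> sqrt (\<Sum>j\<in>UNIV. (B j)\<^sup>2)"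
      unfolding vec_sob_norm_def using B sob_norm_nonneg
      by (intro real_sqrt_le_mono sum_mono power_mono) auto
  qed
qed

lemma vec_C_norm_upper:
  assumes v: "v \<in> C_sob_sigma m J" and J: "compact J" and t: "t \<in> J"
  shows "vec_sob_norm m (v t) \<le> vec_C_norm m J v"
  unfolding vec_C_norm_def
proof (rule cSUP_upper[OF t vec_sob_norm_bdd_above])
  fix j
  show "\<exists>B. \<forall>t\<in>J. sob_norm m (\<lambda>x. v t x $ j) \<le> B"
    by (rule C_sob_bounded[OF C_sob_sigma_component[OF v, of j] J]) blast
qed

text \<open>The weak condition is tested with real parts of multiples of one character. All complex
  multiples are allowed, so the complex sum vanishes.\<close>

lemma divergence_free_rcoeff:
  fixes v :: "real ^ 'n \<Rightarrow> real ^ 'n"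
  assumes v: "v \<in> sobolev_sigma m"
  shows "(\<Sum>j\<in>UNIV. of_int (n $ j) * rcoeff (\<lambda>x. v x $ j) n) = 0"
proof -
  have i: "integrable torus (\<lambda>x. v x $ j)" for j
    using v by (intro L2_torus_integrable sobolev_L2[of _ m]) (simp add: sobolev_sigma_def)
  have div: "(LINT x|torus. (\<Sum>j\<in>UNIV. v x $ j * pdiff [j] \<eta> x)) = 0" if "smooth \<eta>" "periodic \<eta>" for \<eta>
    using v that by (simp add: sobolev_sigma_def divergence_free_def)
  define Z where "Z j = (LINT x|torus. complex_of_real (v x $ j) * character (- n) x)" for j
  have "(\<Sum>j\<in>UNIV. freq_prod [j] (- n) * Z j) = 0"
  proof (rule complex_eq_if_Re_mult_eq)
    fix c
    have ic: "integrable torus (\<lambda>x. v x $ j * Re (c * freq_prod [j] (- n) * character (- n) x))" for j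
    proof -
      have "integrable torus (\<lambda>x. c * freq_prod [j] (- n) * (complex_of_real (v x $ j) * character (- n) x))"
        using i by (intro integrable_mult_right integrable_mult_character) (simp add: complex_of_real_integrable_eq)
      from integrable_Re[OF this] show ?thesis
        by (rule back_subst[where P = "integrable torus"]) (auto simp: algebra_simps)
    qed
    have "0 = (LINT x|torus. (\<Sum>j\<in>UNIV. v x $ j * pdiff [j] (\<lambda>x. Re (c * character (- n) x)) x))"
      by (rule div[OF smooth_Re_character periodic_Re_character, symmetric])
    also have "\<dots> = (LINT x|torus. (\<Sum>j\<in>UNIV. v x $ j * Re (c * freq_prod [j] (- n) * character (- n) x)))"
      by (simp only: pdiff_Re_character)
    also have "\<dots> = (\<Sum>j\<in>UNIV. (LINT x|torus. v x $ j * Re (c * freq_prod [j] (- n) * character (- n) x)))"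
      by (rule Bochner_Integration.integral_sum) (rule ic)
    also have "\<dots> = (\<Sum>j\<in>UNIV. Re (c * freq_prod [j] (- n) * Z j))"
      unfolding Z_def by (intro sum.cong refl integral_mult_Re_character i)
    also have "\<dots> = Re (c * (\<Sum>j\<in>UNIV. freq_prod [j] (- n) * Z j))"
      by (simp only: sum_distrib_left Re_sum mult.assoc)
    finally show "Re (c * (\<Sum>j\<in>UNIV. freq_prod [j] (- n) * Z j)) = Re (c * 0)" by simp
  qed
  moreover have "(\<Sum>j\<in>UNIV. freq_prod [j] (- n) * Z j) = - \<i> * (\<Sum>j\<in>UNIV. of_int (n $ j) * Z j)"
    by (simp add: freq_prod_def sum_distrib_left sum_negf mult.assoc)
  ultimately have "(\<Sum>j\<in>UNIV. of_int (n $ j) * Z j) = 0" by simp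
  moreover have "(\<Sum>j\<in>UNIV. of_int (n $ j) * rcoeff (\<lambda>x. v x $ j) n)
      = (\<Sum>j\<in>UNIV. of_int (n $ j) * Z j) / of_real (torus_volume TYPE('n))"
    by (simp add: rcoeff_def fcoeff_def Z_def sum_divide_distrib)
  ultimately show ?thesis by simp
qed

lemma sob_integral_rcoeff:
  fixes u :: "real \<Rightarrow> real ^ 'n \<Rightarrow> real"
  assumes u: "u \<in> C_sob m {0..T}" and t: "t \<in> {0..T}"
  shows "sob_integral m {0..t} u \<in> sobolev m"
    and "rcoeff (sob_integral m {0..t} u) = (\<lambda>n. integral {0..t} (\<lambda>s. rcoeff (u s) n))"
proof -
  have ut: "u \<in> C_sob m {0..t}" using C_sob_subset[of "{0..t}" "{0..T}" m] u t by auto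
  have "\<exists>U. has_sob_integral m {0..t} u U"
    by (rule has_sob_integral_exists[OF ut]) (use t in auto)
  then have h: "has_sob_integral m {0..t} u (sob_integral m {0..t} u)"
    unfolding sob_integral_def by (rule someI_ex)
  then show "sob_integral m {0..t} u \<in> sobolev m" by (simp add: has_sob_integral_def)
  show "rcoeff (sob_integral m {0..t} u) = (\<lambda>n. integral {0..t} (\<lambda>s. rcoeff (u s) n))"
    by (rule ext, rule has_sob_integral_rcoeff[OF h continuous_on_rcoeff[OF ut]]) simp
qed

text \<open>Uniform in \<open>t\<close>, as needed for the supremum in \<open>relax_norm\<close> to
  be one of a bounded set.\<close>

lemma sob_norm_sob_integral_le:
  fixes u :: "real \<Rightarrow> real ^ 'n \<Rightarrow> real"
  assumes u: "u \<in> C_sob m {0..T}" and t: "t \<in> {0..T}" and B: "\<And>s. s \<in> {0..T} \<Longrightarrow> sob_norm m (u s) \<le> B"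
  shows "sob_norm m (sob_integral m {0..t} u) \<le> sqrt (torus_volume TYPE('n) * (T\<^sup>2 * B\<^sup>2))"
proof (rule real_le_rsqrt)
  have "coeff_bound m (\<lambda>n. integral {0..t} (\<lambda>s. rcoeff (u s) n)) (t\<^sup>2 * B\<^sup>2)"
  proof (rule coeff_bound_integral)
    show "(\<lambda>s. rcoeff (u s) n) integrable_on {0..t}" for n
      using t by (intro integrable_continuous_real continuous_on_subset[OF continuous_on_rcoeff[OF u]]) auto
    show "coeff_bound m (rcoeff (u s)) (B\<^sup>2)" if "s \<in> {0..t}" for s
      using t that by (intro sobolev_coeff_bound' C_sobD[OF u] B) auto
  qed (use t in auto)
  then have "coeff_bound m (rcoeff (sob_integral m {0..t} u)) (T\<^sup>2 * B\<^sup>2)"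
    unfolding sob_integral_rcoeff(2)[OF u t]
    by (rule coeff_bound_mono) (use t in \<open>auto intro!: mult_right_mono power_mono\<close>)
  then show "(sob_norm m (sob_integral m {0..t} u))\<^sup>2 \<le> torus_volume TYPE('n) * (T\<^sup>2 * B\<^sup>2)"
    by (rule sob_norm_le_coeff_bound[OF sob_integral_rcoeff(1)[OF u t]])
qed

lemma relax_norm_upper:
  fixes v :: "real \<Rightarrow> real ^ 'n \<Rightarrow> real ^ 'n"
  assumes v: "\<And>j. (\<lambda>t x. v t x $ j) \<in> C_sob k {0..T}" and t: "t \<in> {0..T}"
  shows "coeff_bound k (\<lambda>n. integral {0..t} (\<lambda>s. rcoeff (\<lambda>x. v s x $ j) n)) ((relax_norm T k v)\<^sup>2)"
    and "relax_norm T k v \<ge> 0"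
proof -
  let ?W = "\<lambda>t. vec_sob_integral k {0..t} v"
  have comp: "(\<lambda>x. ?W t x $ j) = sob_integral k {0..t} (\<lambda>t x. v t x $ j)" for t j
    by (auto simp: vec_sob_integral_def)
  have "bdd_above ((\<lambda>t. vec_sob_norm k (?W t)) ` {0..T})"
  proof (rule vec_sob_norm_bdd_above)
    fix j
    obtain B where B: "\<And>s. s \<in> {0..T} \<Longrightarrow> sob_norm k (\<lambda>x. v s x $ j) \<le> B"
      using C_sob_bounded[OF v compact_Icc] by metis
    show "\<exists>B. \<forall>t\<in>{0..T}. sob_norm k (\<lambda>x. ?W t x $ j) \<le> B"
      unfolding comp using sob_norm_sob_integral_le[OF v _ B] by blast
  qed
  then have le: "vec_sob_norm k (?W t) \<le> relax_norm T k v"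
    unfolding relax_norm_def by (rule cSUP_upper[OF t])
  then show "relax_norm T k v \<ge> 0" using vec_sob_norm_nonneg[of k "?W t"] by linarith
  have "sob_norm k (sob_integral k {0..t} (\<lambda>t x. v t x $ j)) \<le> relax_norm T k v"
    using sob_norm_component_le[of k "?W t" j] le unfolding comp by linarith
  from sobolev_coeff_bound'[OF sob_integral_rcoeff(1)[OF v t] this]
  show "coeff_bound k (\<lambda>n. integral {0..t} (\<lambda>s. rcoeff (\<lambda>x. v s x $ j) n)) ((relax_norm T k v)\<^sup>2)"
    unfolding sob_integral_rcoeff(2)[OF v t] .
qed

lemma conv_cmult_right: "conv a (\<lambda>m. c * b m) n = c * conv a b n"
  unfolding conv_def by (subst infsum_cmult_right'[symmetric]) (simp add: mult_ac)

text \<open>Coefficients do not see null sets, so the equation almost everywhere on the torus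
  becomes an identity at each frequency. The product \<open>v $ j * wderiv [j] \<phi>\<close>
  becomes a convolution, and the vanishing divergence brings it to conservative form.\<close>

lemma advection_diffusion_rcoeff:
  fixes v :: "real ^ 'n \<Rightarrow> real ^ 'n" and \<phi> w :: "real ^ 'n \<Rightarrow> real"
  assumes k: "real k > real CARD('n) / 2" and v: "v \<in> sobolev_sigma k" and \<phi>: "\<phi> \<in> sobolev (k + 2)"
    and w: "w \<in> sobolev m"
    and eq: "AE x in torus. w x + (\<Sum>j\<in>UNIV. v x $ j * wderiv [j] \<phi> x) - (\<Sum>j\<in>UNIV. wderiv [j, j] \<phi> x) = 0"
  shows "rcoeff w n = - of_real (freq_sq n) * rcoeff \<phi> n
    - \<i> * (\<Sum>j\<in>UNIV. of_int (n $ j) * conv (rcoeff (\<lambda>x. v x $ j)) (rcoeff \<phi>) n)"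
proof -
  have vS: "(\<lambda>x. v x $ j) \<in> sobolev k" for j using v by (simp add: sobolev_sigma_def)
  have vL: "(\<lambda>x. v x $ j) \<in> L2_torus" for j by (rule sobolev_L2[OF vS])
  have d1: "wderiv [j] \<phi> \<in> L2_torus" and d2: "wderiv [j, j] \<phi> \<in> L2_torus" for j
    by (rule wderiv_L2[OF \<phi>], simp)+
  have i1: "integrable torus (\<lambda>x. complex_of_real (v x $ j * wderiv [j] \<phi> x))" for j
    unfolding complex_of_real_integrable_eq by (rule L2_torus_integrable_mult[OF vL d1])
  have i2: "integrable torus (\<lambda>x. complex_of_real (wderiv [j, j] \<phi> x))" for j
    by (rule L2_complex_integrable[OF L2_torus_complex[OF d2]])
  define h where "h x = (\<Sum>j\<in>UNIV. wderiv [j, j] \<phi> x) - (\<Sum>j\<in>UNIV. v x $ j * wderiv [j] \<phi> x)" for x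
  have hc: "(\<lambda>x. complex_of_real (h x)) = (\<lambda>x. (\<Sum>j\<in>UNIV. complex_of_real (wderiv [j, j] \<phi> x))
      - (\<Sum>j\<in>UNIV. complex_of_real (v x $ j * wderiv [j] \<phi> x)))"
    by (simp add: h_def)
  have "AE x in torus. w x = h x" using eq by eventually_elim (simp add: h_def)
  moreover have "h \<in> borel_measurable torus"
    unfolding h_def using L2_torus_borel[OF d2] L2_torus_borel[OF d1] L2_torus_borel[OF vL]
    by (intro borel_measurable_diff borel_measurable_sum borel_measurable_times) auto
  ultimately have "rcoeff w n = rcoeff h n"
    by (rule rcoeff_cong_AE[OF _ L2_torus_borel[OF sobolev_L2[OF w]]])
  also have "\<dots> = (\<Sum>j\<in>UNIV. fcoeff (\<lambda>x. complex_of_real (wderiv [j, j] \<phi> x)) n)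
      - (\<Sum>j\<in>UNIV. fcoeff (\<lambda>x. complex_of_real (v x $ j * wderiv [j] \<phi> x)) n)"
    unfolding rcoeff_def hc using i1 i2 by (simp add: fcoeff_diff fcoeff_sum del: of_real_mult)
  also have "\<dots> = (\<Sum>j\<in>UNIV. rcoeff (wderiv [j, j] \<phi>) n) - (\<Sum>j\<in>UNIV. rcoeff (\<lambda>x. v x $ j * wderiv [j] \<phi> x) n)"
    by (simp add: rcoeff_def)
  also have "(\<Sum>j\<in>UNIV. rcoeff (wderiv [j, j] \<phi>) n) = - of_real (freq_sq n) * rcoeff \<phi> n"
  proof -
    have "rcoeff (wderiv [j, j] \<phi>) n = - (of_real ((real_of_int (n $ j))\<^sup>2) * rcoeff \<phi> n)" for j
    proof -
      have "freq_prod [j, j] n = - of_real ((real_of_int (n $ j))\<^sup>2)"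
        by (simp add: freq_prod_def power2_eq_square complex_eq_iff)
      then show ?thesis by (subst rcoeff_wderiv[OF \<phi>]) simp_all
    qed
    then show ?thesis by (simp add: freq_sq_def sum_negf sum_distrib_right)
  qed
  also have "(\<Sum>j\<in>UNIV. rcoeff (\<lambda>x. v x $ j * wderiv [j] \<phi> x) n)
      = \<i> * (\<Sum>j\<in>UNIV. of_int (n $ j) * conv (rcoeff (\<lambda>x. v x $ j)) (rcoeff \<phi>) n)"
  proof -
    \<comment> \<open>\<open>conv_divergence_free\<close> asks for one bound common to all
      components; the sum provides it.\<close>
    define B where "B = (\<Sum>j\<in>UNIV. (sob_norm k (\<lambda>x. v x $ j))\<^sup>2)"
    have q: "coeff_bound k (rcoeff (\<lambda>x. v x $ j)) B" for j
      by (rule coeff_bound_mono[OF sobolev_coeff_bound'[OF vS order_refl]])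
        (auto simp: B_def intro: member_le_sum[of j UNIV "\<lambda>j. (sob_norm k (\<lambda>x. v x $ j))\<^sup>2"])
    have p: "coeff_bound (Suc k) (rcoeff \<phi>) ((sob_norm (k + 2) \<phi>)\<^sup>2)"
      by (rule coeff_bound_mono[OF sobolev_coeff_bound'[OF \<phi> order_refl]]) auto
    have "rcoeff (\<lambda>x. v x $ j * wderiv [j] \<phi> x) n
        = \<i> * conv (rcoeff (\<lambda>x. v x $ j)) (\<lambda>m. of_int (m $ j) * rcoeff \<phi> m) n" for j
    proof -
      have "rcoeff (wderiv [j] \<phi>) = (\<lambda>m. \<i> * (of_int (m $ j) * rcoeff \<phi> m))"
        by (rule ext) (subst rcoeff_wderiv[OF \<phi>], auto simp: freq_prod_def)
      then show ?thesis by (simp add: rcoeff_mult[OF vL d1] conv_cmult_right)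
    qed
    then have "(\<Sum>j\<in>UNIV. rcoeff (\<lambda>x. v x $ j * wderiv [j] \<phi> x) n)
        = \<i> * (\<Sum>j\<in>UNIV. conv (rcoeff (\<lambda>x. v x $ j)) (\<lambda>m. of_int (m $ j) * rcoeff \<phi> m) n)"
      by (simp add: sum_distrib_left)
    also have "\<dots> = \<i> * (\<Sum>j\<in>UNIV. of_int (n $ j) * conv (rcoeff (\<lambda>x. v x $ j)) (rcoeff \<phi>) n)"
      using conv_divergence_free[OF k q p divergence_free_rcoeff[OF v]] by simp
    finally show ?thesis .
  qed
  finally show ?thesis .
qed

text \<open>The time derivative \<open>w\<close> is only square integrable, but at almost every time
  its coefficient equals \<open>r\<close>, which is continuous because the convolution series
  converges uniformly. \<open>du_bois_reymond\<close> then makes the weak derivative classical, up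
  to both end points.\<close>

theorem is_solution_rcoeff:
  fixes v :: "real \<Rightarrow> real ^ 'n \<Rightarrow> real ^ 'n"
  assumes k: "real k > real CARD('n) / 2" and T: "T > 0"
    and v: "v \<in> C_sob_sigma (k + 2) {0..T}" and sol: "is_solution k T v f \<phi>" and t: "t \<in> {0..T}"
  shows "((\<lambda>t. rcoeff (\<phi> t) n) has_vector_derivative
      (- of_real (freq_sq n) * rcoeff (\<phi> t) n
       - \<i> * (\<Sum>j\<in>UNIV. of_int (n $ j) * conv (rcoeff (\<lambda>x. v t x $ j)) (rcoeff (\<phi> t)) n)))
    (at t within {0..T})"
proof -
  define r where "r t = - of_real (freq_sq n) * rcoeff (\<phi> t) n
       - \<i> * (\<Sum>j\<in>UNIV. of_int (n $ j) * conv (rcoeff (\<lambda>x. v t x $ j)) (rcoeff (\<phi> t)) n)" for t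
  have \<phi>: "\<phi> \<in> C_sob (k + 2) {0..T}" using sol by (simp add: is_solution_def)
  obtain w where w: "w \<in> L2_sob (k + 1) {0..T}" "is_time_deriv (k + 1) T \<phi> w"
    "AE t in lebesgue_on {0..T}. AE x in torus.
       w t x + (\<Sum>j\<in>UNIV. v t x $ j * wderiv [j] (\<phi> t) x) - (\<Sum>j\<in>UNIV. wderiv [j, j] (\<phi> t) x) = 0"
    using sol unfolding is_solution_def by blast
  have c\<phi>: "continuous_on {0..T} (\<lambda>t. rcoeff (\<phi> t) m)" for m by (rule continuous_on_rcoeff[OF \<phi>])
  have cr: "continuous_on {0..T} r"
  proof -
    obtain B where B: "\<And>t. t \<in> {0..T} \<Longrightarrow> sob_norm (k + 2) (\<phi> t) \<le> B"
      using C_sob_bounded[OF \<phi> compact_Icc] by metis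
    have p: "coeff_bound k (rcoeff (\<phi> t)) (B\<^sup>2)" if "t \<in> {0..T}" for t
      by (rule coeff_bound_mono[OF sobolev_coeff_bound'[OF C_sobD[OF \<phi> that] B[OF that]]]) auto
    have "continuous_on {0..T} (\<lambda>t. conv (rcoeff (\<lambda>x. v t x $ j)) (rcoeff (\<phi> t)) n)" for j
    proof -
      note vj = C_sob_sigma_component[OF v, of j]
      obtain B' where B': "\<And>t. t \<in> {0..T} \<Longrightarrow> sob_norm (k + 2) (\<lambda>x. v t x $ j) \<le> B'"
        using C_sob_bounded[OF vj compact_Icc] by metis
      have q: "coeff_bound k (rcoeff (\<lambda>x. v t x $ j)) (B'\<^sup>2)" if "t \<in> {0..T}" for t
        by (rule coeff_bound_mono[OF sobolev_coeff_bound'[OF C_sobD[OF vj that] B'[OF that]]]) auto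
      show ?thesis by (rule conv_continuous_on[OF k q p continuous_on_rcoeff[OF vj] c\<phi>])
    qed
    then show ?thesis unfolding r_def by (intro continuous_intros c\<phi>)
  qed
  have wr: "AE t in lebesgue_on {0..T}. rcoeff (w t) n = r t"
  proof -
    have "AE t in lebesgue_on {0..T}. w t \<in> sobolev (k + 1)"
      using w(1) by (simp add: L2_sob_def sob_measurable_def)
    moreover have "AE t in lebesgue_on {0..T}. t \<in> {0..T}" by (rule AE_I2) simp
    ultimately show ?thesis using w(3)
    proof eventually_elim
      case (elim t)
      have "v t \<in> sobolev_sigma k"
        using v elim(2) sobolev_mono[of k "k + 2"] by (auto simp: C_sob_sigma_def sobolev_sigma_def)
      from advection_diffusion_rcoeff[OF k this C_sobD[OF \<phi> elim(2)] elim(1,3)] show ?case by (simp add: r_def)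
    qed
  qed
  have "((\<lambda>t. rcoeff (\<phi> t) n) has_vector_derivative r t) (at t within {0..T})"
  proof (rule du_bois_reymond[OF T c\<phi> cr _ t])
    fix \<eta> :: "real \<Rightarrow> real"
    assume sm: "smooth \<eta>" and supp: "\<exists>a b. 0 < a \<and> b < T \<and> (\<forall>t. t \<notin> {a..b} \<longrightarrow> \<eta> t = 0)"
    then obtain U where U: "has_sob_integral (k + 1) {0..T} (\<lambda>t x. deriv \<eta> t * \<phi> t x) U"
      "has_sob_integral (k + 1) {0..T} (\<lambda>t x. \<eta> t * w t x) (\<lambda>x. - U x)"
      using w(2) unfolding is_time_deriv_def by blast
    note c\<eta> = smooth_real_continuous[OF sm]
    have 1: "rcoeff U n = integral {0..T} (\<lambda>t. deriv \<eta> t *\<^sub>R rcoeff (\<phi> t) n)"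
      by (rule has_sob_integral_rcoeff[OF U(1)])
        (auto intro!: continuous_intros c\<eta> c\<phi> simp: rcoeff_cmult scaleR_conv_of_real)
    have 2: "rcoeff (\<lambda>x. - U x) n = integral {0..T} (\<lambda>t. \<eta> t *\<^sub>R r t)"
    proof (rule has_sob_integral_rcoeff[OF U(2)])
      show "continuous_on {0..T} (\<lambda>t. \<eta> t *\<^sub>R r t)" by (intro continuous_intros c\<eta> cr)
      show "AE t in lebesgue_on {0..T}. rcoeff (\<lambda>x. \<eta> t * w t x) n = \<eta> t *\<^sub>R r t"
        using wr by eventually_elim (simp add: rcoeff_cmult scaleR_conv_of_real)
    qed
    have "rcoeff (\<lambda>x. - U x) n = - rcoeff U n" using rcoeff_cmult[of "-1" U n] by simp
    then show "integral {0..T} (\<lambda>t. deriv \<eta> t *\<^sub>R rcoeff (\<phi> t) n) = - integral {0..T} (\<lambda>t. \<eta> t *\<^sub>R r t)"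
      using 1 2 by (metis minus_minus)
  qed
  then show ?thesis unfolding r_def .
qed

theorem theorem3p2:
  fixes T R :: real and k :: nat
  assumes "CARD('n::finite) \<ge> 2"
    and "T > 0"
    and "real k > real CARD('n) / 2"
    and "R > 0"
  shows "\<exists>C > 0. \<forall>(f :: real ^ 'n \<Rightarrow> real) v\<^sub>1 v\<^sub>2 \<phi>\<^sub>1 \<phi>\<^sub>2.
     f \<in> sobolev (k + 2) \<longrightarrow>
     v\<^sub>1 \<in> C_sob_sigma (k + 2) {0..T} \<longrightarrow>
     v\<^sub>2 \<in> C_sob_sigma (k + 2) {0..T} \<longrightarrow>
     is_solution k T v\<^sub>1 f \<phi>\<^sub>1 \<longrightarrow>
     is_solution k T v\<^sub>2 f \<phi>\<^sub>2 \<longrightarrow>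
     sob_norm (k + 2) f + vec_C_norm (k + 2) {0..T} v\<^sub>1 + vec_C_norm (k + 2) {0..T} v\<^sub>2 \<le> R \<longrightarrow>
     C_norm k {0..T} (\<lambda>t x. \<phi>\<^sub>1 t x - \<phi>\<^sub>2 t x)
       \<le> C * relax_norm T k (\<lambda>t x. v\<^sub>1 t x - v\<^sub>2 t x) powr (1 / 2)"
proof -
  obtain C0 where C0: "C0 > 0"
    and stab: "\<forall>p1 p2 (q1 :: 'n \<Rightarrow> real \<Rightarrow> int ^ 'n \<Rightarrow> complex) q2 M \<delta>.
      coeff_velocity k T R q1 \<longrightarrow> coeff_velocity k T R q2 \<longrightarrow>
      coeff_solution T q1 p1 \<longrightarrow> coeff_solution T q2 p2 \<longrightarrow>
      (\<forall>t\<in>{0..T}. coeff_bound (k + 2) (p1 t) M) \<longrightarrow> (\<forall>t\<in>{0..T}. coeff_bound (k + 2) (p2 t) M) \<longrightarrow>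
      coeff_bound (k + 2) (p2 0) (R\<^sup>2) \<longrightarrow> p1 0 = p2 0 \<longrightarrow> \<delta> \<ge> 0 \<longrightarrow>
      (\<forall>t\<in>{0..T}. \<forall>j. coeff_bound k (\<lambda>n. integral {0..t} (\<lambda>s. q1 j s n - q2 j s n)) (\<delta>\<^sup>2)) \<longrightarrow>
      (\<forall>t\<in>{0..T}. coeff_bound k (\<lambda>n. p1 t n - p2 t n) (C0 * \<delta>))"
    using coeff_stability[OF assms(3) assms(2) assms(4)] by (elim exE conjE)
  define V where "V = torus_volume TYPE('n)"
  have V: "V > 0" by (simp add: V_def)
  \<comment> \<open>\<open>V\<close> is the volume lost in Parseval's identity. The coefficient
    bound \<open>C0 * \<delta>\<close> concerns squares, so both the constant and
    \<open>\<delta>\<close> appear under a root.\<close>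
  have main: "C_norm k {0..T} (\<lambda>t x. \<phi>\<^sub>1 t x - \<phi>\<^sub>2 t x)
      \<le> sqrt (V * C0) * relax_norm T k (\<lambda>t x. v\<^sub>1 t x - v\<^sub>2 t x) powr (1 / 2)"
    if f: "f \<in> sobolev (k + 2)" and v1: "v\<^sub>1 \<in> C_sob_sigma (k + 2) {0..T}" and v2: "v\<^sub>2 \<in> C_sob_sigma (k + 2) {0..T}"
      and s1: "is_solution k T v\<^sub>1 f \<phi>\<^sub>1" and s2: "is_solution k T v\<^sub>2 f \<phi>\<^sub>2"
      and R: "sob_norm (k + 2) f + vec_C_norm (k + 2) {0..T} v\<^sub>1 + vec_C_norm (k + 2) {0..T} v\<^sub>2 \<le> R"
    for f :: "real ^ 'n \<Rightarrow> real" and v\<^sub>1 v\<^sub>2 \<phi>\<^sub>1 \<phi>\<^sub>2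
  proof -
    define \<delta> where "\<delta> = relax_norm T k (\<lambda>t x. v\<^sub>1 t x - v\<^sub>2 t x)"
    have zero: "0 \<in> {0..T}" using assms(2) by simp
    have vn: "vec_C_norm (k + 2) {0..T} v\<^sub>1 \<ge> 0" "vec_C_norm (k + 2) {0..T} v\<^sub>2 \<ge> 0"
      using order_trans[OF vec_sob_norm_nonneg vec_C_norm_upper[OF v1 compact_Icc zero]]
        order_trans[OF vec_sob_norm_nonneg vec_C_norm_upper[OF v2 compact_Icc zero]] by auto
    have fR: "sob_norm (k + 2) f \<le> R" and v1R: "vec_C_norm (k + 2) {0..T} v\<^sub>1 \<le> R" and v2R: "vec_C_norm (k + 2) {0..T} v\<^sub>2 \<le> R"
      using R vn sob_norm_nonneg[of "k + 2" f] by linarith+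
    have vel: "coeff_velocity k T R (\<lambda>j t. rcoeff (\<lambda>x. v t x $ j))"
      if v: "v \<in> C_sob_sigma (k + 2) {0..T}" and vR: "vec_C_norm (k + 2) {0..T} v \<le> R"
      for v :: "real \<Rightarrow> real ^ 'n \<Rightarrow> real ^ 'n"
      unfolding coeff_velocity_def
    proof (intro conjI ballI allI continuous_on_rcoeff[OF C_sob_sigma_component[OF v]])
      fix t j assume t: "t \<in> {0..T}"
      show "coeff_bound (k + 2) (rcoeff (\<lambda>x. v t x $ j)) (R\<^sup>2)"
      proof (rule sobolev_coeff_bound'[OF C_sobD[OF C_sob_sigma_component[OF v] t]])
        show "sob_norm (k + 2) (\<lambda>x. v t x $ j) \<le> R"
          by (rule order_trans[OF sob_norm_component_le order_trans[OF vec_C_norm_upper[OF v compact_Icc t] vR]])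
      qed
    next
      fix t and n :: "int ^ 'n" assume "t \<in> {0..T}"
      then show "(\<Sum>j\<in>UNIV. of_int (n $ j) * rcoeff (\<lambda>x. v t x $ j) n) = 0"
        using divergence_free_rcoeff[of "v t" "k + 2" n] v by (simp add: C_sob_sigma_def)
    qed
    have sol: "coeff_solution T (\<lambda>j t. rcoeff (\<lambda>x. v t x $ j)) (\<lambda>t. rcoeff (\<phi> t))"
      if "v \<in> C_sob_sigma (k + 2) {0..T}" "is_solution k T v f \<phi>" for v \<phi>
      unfolding coeff_solution_def using is_solution_rcoeff[OF assms(3) assms(2) that] by blast
    have \<phi>1: "\<phi>\<^sub>1 \<in> C_sob (k + 2) {0..T}" and \<phi>2: "\<phi>\<^sub>2 \<in> C_sob (k + 2) {0..T}"
      using s1 s2 by (auto simp: is_solution_def)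
    obtain B1 where B1: "\<And>t. t \<in> {0..T} \<Longrightarrow> sob_norm (k + 2) (\<phi>\<^sub>1 t) \<le> B1"
      using C_sob_bounded[OF \<phi>1 compact_Icc] by metis
    obtain B2 where B2: "\<And>t. t \<in> {0..T} \<Longrightarrow> sob_norm (k + 2) (\<phi>\<^sub>2 t) \<le> B2"
      using C_sob_bounded[OF \<phi>2 compact_Icc] by metis
    \<comment> \<open>One number serves as \<open>M\<close> for both solutions. It may depend on
      them, because \<open>C0\<close> was fixed before \<open>M\<close>.\<close>
    have p1: "coeff_bound (k + 2) (rcoeff (\<phi>\<^sub>1 t)) (B1\<^sup>2 + B2\<^sup>2)" if "t \<in> {0..T}" for t
      by (rule coeff_bound_mono[OF sobolev_coeff_bound'[OF C_sobD[OF \<phi>1 that] B1[OF that]]]) auto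
    have p2: "coeff_bound (k + 2) (rcoeff (\<phi>\<^sub>2 t)) (B1\<^sup>2 + B2\<^sup>2)" if "t \<in> {0..T}" for t
      by (rule coeff_bound_mono[OF sobolev_coeff_bound'[OF C_sobD[OF \<phi>2 that] B2[OF that]]]) auto
    \<comment> \<open>Both solutions equal \<open>f\<close> at time 0 only almost everywhere, but
      their coefficients there coincide exactly.\<close>
    have init: "rcoeff (\<phi> 0) = rcoeff f" if \<phi>: "\<phi> \<in> C_sob (k + 2) {0..T}" and "is_solution k T v f \<phi>" for v \<phi>
    proof
      fix n
      have "AE x in torus. \<phi> 0 x = f x" using that(2) by (simp add: is_solution_def)
      then show "rcoeff (\<phi> 0) n = rcoeff f n"
        by (rule rcoeff_cong_AE[OF _ L2_torus_borel[OF sobolev_L2[OF C_sobD[OF \<phi> zero]]] L2_torus_borel[OF sobolev_L2[OF f]]])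
    qed
    have p20: "coeff_bound (k + 2) (rcoeff (\<phi>\<^sub>2 0)) (R\<^sup>2)"
      unfolding init[OF \<phi>2 s2] by (rule sobolev_coeff_bound'[OF f fR])
    have p120: "rcoeff (\<phi>\<^sub>1 0) = rcoeff (\<phi>\<^sub>2 0)" by (simp only: init[OF \<phi>1 s1] init[OF \<phi>2 s2])
    have vd: "(\<lambda>t x. (v\<^sub>1 t x - v\<^sub>2 t x) $ j) \<in> C_sob k {0..T}" for j
      using C_sob_diff[OF C_sob_sigma_component[OF v1] C_sob_sigma_component[OF v2], of j j]
        C_sob_mono[of k "k + 2" "{0..T}"] by auto
    have \<delta>0: "\<delta> \<ge> 0" unfolding \<delta>_def by (rule relax_norm_upper(2)[OF vd zero])
    have W: "coeff_bound k (\<lambda>n. integral {0..t} (\<lambda>s. rcoeff (\<lambda>x. v\<^sub>1 s x $ j) n - rcoeff (\<lambda>x. v\<^sub>2 s x $ j) n)) (\<delta>\<^sup>2)"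
      if t: "t \<in> {0..T}" for t j
    proof -
      have "integral {0..t} (\<lambda>s. rcoeff (\<lambda>x. (v\<^sub>1 s x - v\<^sub>2 s x) $ j) n)
          = integral {0..t} (\<lambda>s. rcoeff (\<lambda>x. v\<^sub>1 s x $ j) n - rcoeff (\<lambda>x. v\<^sub>2 s x $ j) n)" for n
      proof (rule integral_cong)
        fix s assume "s \<in> {0..t}"
        then have s: "s \<in> {0..T}" using t by auto
        show "rcoeff (\<lambda>x. (v\<^sub>1 s x - v\<^sub>2 s x) $ j) n = rcoeff (\<lambda>x. v\<^sub>1 s x $ j) n - rcoeff (\<lambda>x. v\<^sub>2 s x $ j) n"
          using rcoeff_sobolev_diff[OF C_sobD[OF C_sob_sigma_component[OF v1] s] C_sobD[OF C_sob_sigma_component[OF v2] s]]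
          by simp
      qed
      then show ?thesis using relax_norm_upper(1)[OF vd t, of j] by (simp only: \<delta>_def)
    qed
    have diff: "\<forall>t\<in>{0..T}. coeff_bound k (\<lambda>n. rcoeff (\<phi>\<^sub>1 t) n - rcoeff (\<phi>\<^sub>2 t) n) (C0 * \<delta>)"
      by (rule stab[rule_format, where ?q1.0 = "\<lambda>j t. rcoeff (\<lambda>x. v\<^sub>1 t x $ j)" and ?q2.0 = "\<lambda>j t. rcoeff (\<lambda>x. v\<^sub>2 t x $ j)"
            and ?p1.0 = "\<lambda>t. rcoeff (\<phi>\<^sub>1 t)" and ?p2.0 = "\<lambda>t. rcoeff (\<phi>\<^sub>2 t)" and M = "B1\<^sup>2 + B2\<^sup>2", THEN ballI])
         (assumption | rule vel[OF v1 v1R] vel[OF v2 v2R] sol[OF v1 s1] sol[OF v2 s2] p1 p2 p20 p120 \<delta>0 W)+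
    show ?thesis unfolding C_norm_def
    proof (rule cSUP_least)
      show "{0..T} \<noteq> {}" using assms(2) by simp
      fix t assume t: "t \<in> {0..T}"
      have \<phi>S: "\<phi>\<^sub>1 t \<in> sobolev k" "\<phi>\<^sub>2 t \<in> sobolev k"
        using C_sobD[OF \<phi>1 t] C_sobD[OF \<phi>2 t] sobolev_mono[of k "k + 2"] by auto
      have "rcoeff (\<lambda>x. \<phi>\<^sub>1 t x - \<phi>\<^sub>2 t x) = (\<lambda>n. rcoeff (\<phi>\<^sub>1 t) n - rcoeff (\<phi>\<^sub>2 t) n)"
        by (rule ext) (rule rcoeff_sobolev_diff[OF \<phi>S])
      then have "coeff_bound k (rcoeff (\<lambda>x. \<phi>\<^sub>1 t x - \<phi>\<^sub>2 t x)) (C0 * \<delta>)" using diff t by simp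
      from sob_norm_le_coeff_bound[OF sobolev_diff[OF \<phi>S] this]
      have "(sob_norm k (\<lambda>x. \<phi>\<^sub>1 t x - \<phi>\<^sub>2 t x))\<^sup>2 \<le> (V * C0) * \<delta>" by (simp add: V_def mult.assoc)
      then have "sob_norm k (\<lambda>x. \<phi>\<^sub>1 t x - \<phi>\<^sub>2 t x) \<le> sqrt ((V * C0) * \<delta>)" by (rule real_le_rsqrt)
      also have "\<dots> = sqrt (V * C0) * sqrt \<delta>" by (rule real_sqrt_mult)
      also have "sqrt \<delta> = \<delta> powr (1 / 2)" using \<delta>0 by (simp add: powr_half_sqrt)
      finally show "sob_norm k (\<lambda>x. \<phi>\<^sub>1 t x - \<phi>\<^sub>2 t x) \<le> sqrt (V * C0) * relax_norm T k (\<lambda>t x. v\<^sub>1 t x - v\<^sub>2 t x) powr (1 / 2)"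
        by (simp only: \<delta>_def)
    qed
  qed
  have "sqrt (V * C0) > 0" using V C0 by simp
  with main show ?thesis by blast
qed

end
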